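(* Let $G$ be an affine algebraic group over an algebraically closed field $K$ such that $G^{0}$ is reductive, and let $T$ be a connected closed subgroup of $G^{0}$ which is an algebraic torus. Let $(X,G)$ be an effective regular action of $G$ on an affine Krull $K$-scheme $X=\mathrm{Spec}(R)$. Suppose that $G=Z_G(T)$ and $\mathcal{Q}(R)^{T}=\mathcal{Q}(R^{T})$. Then $$\mathfrak{R}(R,G;T)\vert_{R^{T}}=\mathfrak{R}(R^{T},G)\vert_{R^{T}}.$$
   Context: $K$ is an algebraically closed field of arbitrary characteristic; $G^0$ is the identity component of $G$; $Z_G(T)$ is the centralizer of $T$ in $G$. For a commutative ring $A$, $\mathcal{Q}(A)$ is its total quotient ring. An affine Krull $K$-scheme is $\mathrm{Spec}(R)$ with $R$ a commutative $K$-algebra (not necessarily finitely generated) that is a Krull domain. The action $(X,G)$ is regular if $G$ acts rationally on $R$ by $K$-algebra automorphisms; it is effective if $\mathrm{Ker}(G\to\mathrm{Aut}(R))$ is finite. If $G$ acts on a ring $A$ and $\mathfrak{P}$ is a prime of $A$, the inertia group is $\mathcal{I}_G(\mathfrak{P})=\{\sigma\in G\mid \sigma(x)-x\in\mathfrak{P}\ (x\in A)\}$. Here $\mathrm{ht}$ denotes height. For a closed normal subgroup $H$ of $G$, let $\mathrm{Ht}^1(R^{H},R^{G})=\{\mathfrak{p}\in\mathrm{Spec}(R^{H})\mid \mathrm{ht}(\mathfrak{p})=\mathrm{ht}(\mathfrak{p}\cap R^{G})=1\}$ and $\mathrm{Ht}^1(R,R^{G};R^{H})=\{\mathfrak{P}\in\mathrm{Spec}(R)\mid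 \mathrm{ht}(\mathfrak{P})=\mathrm{ht}(\mathfrak{P}\cap R^{H})=\mathrm{ht}(\mathfrak{P}\cap R^{G})=1\}$. Define the subgroups of $G$ $$\mathfrak{R}(R^{H},G)=\Big\langle\bigcup_{\mathfrak{p}\in\mathrm{Ht}^1(R^{H},R^{G})}\mathcal{I}_G(\mathfrak{p})\Big\rangle,\qquad \mathfrak{R}(R,G;H)=\Big\langle\bigcup_{\mathfrak{P}\in\mathrm{Ht}^1(R,R^{G};R^{H})}\mathcal{I}_G(\mathfrak{P})\Big\rangle,$$ where $\mathcal{I}_G(\mathfrak{p})$ refers to the action of $G$ on $R^H$ and $\mathcal{I}_G(\mathfrak{P})$ to the action on $R$. For a subgroup $\Gamma$ of $G$ and a $\Gamma$-invariant subset $S$, $\Gamma\vert_S$ denotes the group of restrictions $\sigma\vert_S$, $\sigma\in\Gamma$. *)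

theory Defs
  imports
    "HOL-Algebra.Algebra"
    "HOL-Analysis.Function_Topology"
    "HOL-Library.Extended_Nat"
begin

section \<open>Affine varieties and affine algebraic groups\<close>

definition fun_algebra :: "('k, 'm) ring_scheme \<Rightarrow> 'x set \<Rightarrow> ('k, 'x \<Rightarrow> 'k) module" where
  "fun_algebra K V =
     \<lparr>carrier = V \<rightarrow>\<^sub>E carrier K,
      monoid.mult = (\<lambda>f g. \<lambda>x\<in>V. f x \<otimes>\<^bsub>K\<^esub> g x),
      monoid.one = (\<lambda>x\<in>V. \<one>\<^bsub>K\<^esub>),
      ring.zero = (\<lambda>x\<in>V. \<zero>\<^bsub>K\<^esub>),
      ring.add = (\<lambda>f g. \<lambda>x\<in>V. f x \<oplus>\<^bsub>K\<^esub> g x),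
      module.smult = (\<lambda>c f. \<lambda>x\<in>V. c \<otimes>\<^bsub>K\<^esub> f x)\<rparr>"

text \<open>The library's \<open>subalgebra\<close> concerns a ring containing the scalars; here the
  scalars act through \<open>smult\<close>.\<close>

definition smult_subalgebra ::
    "('k, 'm) ring_scheme \<Rightarrow> ('k, 'r) module \<Rightarrow> 'r set \<Rightarrow> bool" where
  "smult_subalgebra K M B \<longleftrightarrow>
     subring B M \<and> (\<forall>c\<in>carrier K. \<forall>b\<in>B. c \<odot>\<^bsub>M\<^esub> b \<in> B)"

definition alg_generated ::
    "('k, 'm) ring_scheme \<Rightarrow> ('k, 'r) module \<Rightarrow> 'r set \<Rightarrow> 'r set" where
  "alg_generated K M S = \<Inter>{B. smult_subalgebra K M B \<and> S \<subseteq> B}"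

text \<open>An affine variety is a set \<open>V\<close> of points together with a finitely generated algebra
  \<open>A = K[V]\<close> of \<open>K\<close>-valued functions on \<open>V\<close> such that evaluation identifies \<open>V\<close> with the set of
  all \<open>K\<close>-algebra homomorphisms from \<open>A\<close> to \<open>K\<close>.\<close>

locale affine_variety = algebraically_closed K for K (structure) +
  fixes V :: "'x set" and A :: "('x \<Rightarrow> 'a) set"
  assumes coord_subalgebra: "smult_subalgebra K (fun_algebra K V) A"
    and coord_fin_gen: "\<exists>S. finite S \<and> S \<subseteq> A \<and> alg_generated K (fun_algebra K V) S = A"
    and coord_separates: "\<lbrakk>x \<in> V; y \<in> V; x \<noteq> y\<rbrakk> \<Longrightarrow> \<exists>f\<in>A. f x \<noteq> f y"
    and coord_hom_is_eval:
      "\<lbrakk>\<chi> \<in> ring_hom ((fun_algebra K V)\<lparr>carrier := A\<rparr>) K;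
        \<And>c f. \<lbrakk>c \<in> carrier K; f \<in> A\<rbrakk> \<Longrightarrow> \<chi> (c \<odot>\<^bsub>fun_algebra K V\<^esub> f) = c \<otimes> \<chi> f\<rbrakk>
       \<Longrightarrow> \<exists>x\<in>V. \<forall>f\<in>A. \<chi> f = f x"

text \<open>Since the coordinate ring of \<open>G \<times> G\<close> is \<open>A \<otimes> A\<close>, the assumption \<open>mult_morphism\<close> says that
  multiplication is a morphism of varieties.\<close>

locale affine_algebraic_group =
  affine_variety K "carrier G" A + G: group G
  for K (structure) and G and A +
  assumes mult_morphism:
      "f \<in> A \<Longrightarrow>
       \<exists>(n::nat) p q. (\<forall>i<n. p i \<in> A \<and> q i \<in> A) \<and>
         (\<forall>x\<in>carrier G. \<forall>y\<in>carrier G.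
            f (x \<otimes>\<^bsub>G\<^esub> y) = (\<Oplus>\<^bsub>K\<^esub>i\<in>{..<n}. p i x \<otimes> q i y))"
    and inv_morphism: "f \<in> A \<Longrightarrow> (\<lambda>x\<in>carrier G. f (inv\<^bsub>G\<^esub> x)) \<in> A"

text \<open>The principal open sets form a base of the Zariski topology.\<close>

definition zariski ::
    "('k, 'm) ring_scheme \<Rightarrow> 'x set \<Rightarrow> ('x \<Rightarrow> 'k) set \<Rightarrow> 'x topology" where
  "zariski K V A = topology_generated_by ((\<lambda>f. {x \<in> V. f x \<noteq> \<zero>\<^bsub>K\<^esub>}) ` A)"

lemma (in affine_variety) closedin_zariski_iff:
  "closedin (zariski K V A) Z \<longleftrightarrow> (\<exists>S\<subseteq>A. Z = {x \<in> V. \<forall>f\<in>S. f x = \<zero>})"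
proof -
  define U where "U = (\<lambda>S. {x \<in> V. \<exists>f\<in>S. f x \<noteq> \<zero>})"
  have sub: "subring A (fun_algebra K V)"
    using coord_subalgebra by (simp add: smult_subalgebra_def)
  have ext: "f x \<in> carrier K" if "f \<in> A" "x \<in> V" for f x
    using subringE(1)[OF sub] that by (auto simp: fun_algebra_def)
  have one: "(\<lambda>x\<in>V. \<one>) \<in> A"
    using subringE(3)[OF sub] by (simp add: fun_algebra_def)
  have mult: "(\<lambda>x\<in>V. f x \<otimes> g x) \<in> A" if "f \<in> A" "g \<in> A" for f g
    using subringE(6)[OF sub that] by (simp add: fun_algebra_def)
  have inter: "\<exists>S\<subseteq>A. U S1 \<inter> U S2 = U S" if "S1 \<subseteq> A" "S2 \<subseteq> A" for S1 S2
  proof (intro exI conjI)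
    let ?S = "(\<lambda>(f, g). \<lambda>x\<in>V. f x \<otimes> g x) ` (S1 \<times> S2)"
    show "?S \<subseteq> A"
      using that mult by auto
    have nz: "f x \<otimes> g x \<noteq> \<zero> \<longleftrightarrow> f x \<noteq> \<zero> \<and> g x \<noteq> \<zero>"
      if "f \<in> S1" "g \<in> S2" "x \<in> V" for f g x
      using that ext[of f x] ext[of g x] \<open>S1 \<subseteq> A\<close> \<open>S2 \<subseteq> A\<close> integral_iff by blast
    have "U ?S = {x \<in> V. \<exists>f\<in>S1. \<exists>g\<in>S2. f x \<otimes> g x \<noteq> \<zero>}"
      unfolding U_def by (intro Collect_cong conj_cong refl) simp
    also have "\<dots> = {x \<in> V. \<exists>f\<in>S1. \<exists>g\<in>S2. f x \<noteq> \<zero> \<and> g x \<noteq> \<zero>}"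
      by (intro Collect_cong conj_cong refl bex_cong nz)
    also have "\<dots> = U S1 \<inter> U S2"
      unfolding U_def by blast
    finally show "U S1 \<inter> U S2 = U ?S" ..
  qed
  have gen: "generate_topology_on ((\<lambda>f. {x \<in> V. f x \<noteq> \<zero>}) ` A) W \<longleftrightarrow> (\<exists>S\<subseteq>A. W = U S)" for W
  proof
    assume "generate_topology_on ((\<lambda>f. {x \<in> V. f x \<noteq> \<zero>}) ` A) W"
    then show "\<exists>S\<subseteq>A. W = U S"
    proof induction
      case Empty
      show ?case by (intro exI[of _ "{}"]) (simp add: U_def)
    next
      case (Int a b)
      then show ?case using inter by blast
    next
      case (UN F)
      then obtain S where "\<And>W. W \<in> F \<Longrightarrow> S W \<subseteq> A \<and> W = U (S W)" by metis
      then have "\<Union>(S ` F) \<subseteq> A \<and> \<Union>F = (\<Union>W\<in>F. U (S W))" by blast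
      moreover have "(\<Union>W\<in>F. U (S W)) = U (\<Union>(S ` F))" by (auto simp: U_def)
      ultimately show ?case by metis
    next
      case (Basis s)
      then obtain f where "f \<in> A" "s = {x \<in> V. f x \<noteq> \<zero>}" by blast
      then show ?case by (intro exI[of _ "{f}"]) (simp add: U_def)
    qed
  next
    assume "\<exists>S\<subseteq>A. W = U S"
    then obtain S where "S \<subseteq> A" and W: "W = \<Union>((\<lambda>f. {x \<in> V. f x \<noteq> \<zero>}) ` S)"
      by (auto simp: U_def)
    then show "generate_topology_on ((\<lambda>f. {x \<in> V. f x \<noteq> \<zero>}) ` A) W"
      unfolding W by (intro generate_topology_on.UN generate_topology_on.Basis) auto
  qed
  have top: "topspace (zariski K V A) = V"
    using one one_not_zero by (force simp: zariski_def topology_generated_by_topspace)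
  have "closedin (zariski K V A) Z \<longleftrightarrow> Z \<subseteq> V \<and> (\<exists>S\<subseteq>A. V - Z = U S)"
    by (simp add: closedin_def top) (simp add: zariski_def openin_topology_generated_by_iff gen)
  moreover have "Z \<subseteq> V \<and> V - Z = U S \<longleftrightarrow> Z = {x \<in> V. \<forall>f\<in>S. f x = \<zero>}" for S
    unfolding U_def by blast
  ultimately show ?thesis by blast
qed

definition restrict_coord :: "('x \<Rightarrow> 'k) set \<Rightarrow> 'x set \<Rightarrow> ('x \<Rightarrow> 'k) set" where
  "restrict_coord A Y = (\<lambda>f. restrict f Y) ` A"

definition closed_subgroup ::
    "('k, 'm) ring_scheme \<Rightarrow> ('g, 'n) monoid_scheme \<Rightarrow> ('g \<Rightarrow> 'k) set \<Rightarrow> 'g set \<Rightarrow> bool" where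
  "closed_subgroup K G A H \<longleftrightarrow> subgroup H G \<and> closedin (zariski K (carrier G) A) H"

definition identity_component ::
    "('k, 'm) ring_scheme \<Rightarrow> ('g, 'n) monoid_scheme \<Rightarrow> ('g \<Rightarrow> 'k) set \<Rightarrow> 'g set" where
  "identity_component K G A = connected_component_of_set (zariski K (carrier G) A) \<one>\<^bsub>G\<^esub>"

definition centralizer :: "('g, 'n) monoid_scheme \<Rightarrow> 'g set \<Rightarrow> 'g set" where
  "centralizer G S = {g \<in> carrier G. \<forall>s\<in>S. g \<otimes>\<^bsub>G\<^esub> s = s \<otimes>\<^bsub>G\<^esub> g}"


subsection \<open>Unipotent and reductive groups\<close>

text \<open>\<open>rtrans_diff K G g\<close> is the operator \<open>\<rho>(g) - id\<close> on the coordinate ring, where \<open>\<rho>(g)\<close> is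
  right translation by \<open>g\<close>. As \<open>\<rho>(g)\<close> is locally finite, it is unipotent iff
  \<open>\<rho>(g) - id\<close> is locally nilpotent.\<close>

definition rtrans_diff ::
    "('k, 'm) ring_scheme \<Rightarrow> ('g, 'n) monoid_scheme \<Rightarrow> 'g \<Rightarrow> ('g \<Rightarrow> 'k) \<Rightarrow> ('g \<Rightarrow> 'k)" where
  "rtrans_diff K G g f = (\<lambda>x\<in>carrier G. f (x \<otimes>\<^bsub>G\<^esub> g) \<ominus>\<^bsub>K\<^esub> f x)"

definition unipotent_elem ::
    "('k, 'm) ring_scheme \<Rightarrow> ('g, 'n) monoid_scheme \<Rightarrow> ('g \<Rightarrow> 'k) set \<Rightarrow> 'g \<Rightarrow> bool" where
  "unipotent_elem K G A g \<longleftrightarrow>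
     g \<in> carrier G \<and>
     (\<forall>f\<in>A. \<exists>n::nat. (rtrans_diff K G g ^^ n) f = (\<lambda>x\<in>carrier G. \<zero>\<^bsub>K\<^esub>))"

definition unipotent_radical ::
    "('k, 'm) ring_scheme \<Rightarrow> ('g, 'n) monoid_scheme \<Rightarrow> ('g \<Rightarrow> 'k) set \<Rightarrow> 'g set" where
  "unipotent_radical K G A =
     generate G (\<Union>{U. closed_subgroup K G A U \<and> U \<lhd> G \<and>
                       connectedin (zariski K (carrier G) A) U \<and>
                       (\<forall>u\<in>U. unipotent_elem K G A u)})"

definition reductive ::
    "('k, 'm) ring_scheme \<Rightarrow> ('g, 'n) monoid_scheme \<Rightarrow> ('g \<Rightarrow> 'k) set \<Rightarrow> bool" where
  "reductive K G A \<longleftrightarrow> unipotent_radical K G A = {\<one>\<^bsub>G\<^esub>}"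


subsection \<open>Tori\<close>

definition alg_group_iso ::
    "('g, 'n) monoid_scheme \<Rightarrow> ('g \<Rightarrow> 'k) set \<Rightarrow> ('h, 'p) monoid_scheme \<Rightarrow> ('h \<Rightarrow> 'k) set
     \<Rightarrow> ('g \<Rightarrow> 'h) \<Rightarrow> bool" where
  "alg_group_iso G A H B \<psi> \<longleftrightarrow>
     \<psi> \<in> iso G H \<and> (\<lambda>f. \<lambda>x\<in>carrier G. f (\<psi> x)) ` B = A"

definition Gm_power :: "('k, 'm) ring_scheme \<Rightarrow> nat \<Rightarrow> (nat \<Rightarrow> 'k) monoid" where
  "Gm_power K n = product_group {..<n} (\<lambda>_. mult_of K)"

definition Gm_power_coord :: "('k, 'm) ring_scheme \<Rightarrow> nat \<Rightarrow> ((nat \<Rightarrow> 'k) \<Rightarrow> 'k) set" where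
  "Gm_power_coord K n =
     alg_generated K (fun_algebra K (carrier (Gm_power K n)))
       (\<Union>i<n. {\<lambda>x\<in>carrier (Gm_power K n). x i,
                 \<lambda>x\<in>carrier (Gm_power K n). inv\<^bsub>K\<^esub> (x i)})"

definition algebraic_torus ::
    "('k, 'm) ring_scheme \<Rightarrow> ('g, 'n) monoid_scheme \<Rightarrow> ('g \<Rightarrow> 'k) set \<Rightarrow> bool" where
  "algebraic_torus K G A \<longleftrightarrow>
     (\<exists>n \<psi>. alg_group_iso G A (Gm_power K n) (Gm_power_coord K n) \<psi>)"


section \<open>Commutative rings\<close>

definition nonzerodivisors :: "('r, 'm) ring_scheme \<Rightarrow> 'r set" where
  "nonzerodivisors A =
     {b \<in> carrier A. \<forall>x\<in>carrier A. b \<otimes>\<^bsub>A\<^esub> x = \<zero>\<^bsub>A\<^esub> \<longrightarrow> x = \<zero>\<^bsub>A\<^esub>}"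

definition fraction :: "('r, 'm) ring_scheme \<Rightarrow> 'r \<Rightarrow> 'r \<Rightarrow> ('r \<times> 'r) set" where
  "fraction A a b =
     {(c, d). c \<in> carrier A \<and> d \<in> nonzerodivisors A \<and> a \<otimes>\<^bsub>A\<^esub> d = c \<otimes>\<^bsub>A\<^esub> b}"

definition total_quotient :: "('r, 'm) ring_scheme \<Rightarrow> ('r \<times> 'r) set ring" where
  "total_quotient A =
     \<lparr>carrier = {fraction A a b | a b. a \<in> carrier A \<and> b \<in> nonzerodivisors A},
      monoid.mult = (\<lambda>x y. \<Union>(a, b)\<in>x. \<Union>(c, d)\<in>y. fraction A (a \<otimes>\<^bsub>A\<^esub> c) (b \<otimes>\<^bsub>A\<^esub> d)),
      monoid.one = fraction A \<one>\<^bsub>A\<^esub> \<one>\<^bsub>A\<^esub>,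
      ring.zero = fraction A \<zero>\<^bsub>A\<^esub> \<one>\<^bsub>A\<^esub>,
      ring.add = (\<lambda>x y. \<Union>(a, b)\<in>x. \<Union>(c, d)\<in>y.
               fraction A (a \<otimes>\<^bsub>A\<^esub> d \<oplus>\<^bsub>A\<^esub> c \<otimes>\<^bsub>A\<^esub> b) (b \<otimes>\<^bsub>A\<^esub> d))\<rparr>"

text \<open>For a subring \<open>B\<close> of \<open>A\<close> whose nonzerodivisors remain nonzerodivisors in \<open>A\<close> (for instance
  if \<open>A\<close> is a domain), this is the canonical embedding of the total quotient ring of \<open>B\<close> into that
  of \<open>A\<close>.\<close>

definition total_quotient_embed ::
    "('r, 'm) ring_scheme \<Rightarrow> ('r \<times> 'r) set \<Rightarrow> ('r \<times> 'r) set" where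
  "total_quotient_embed A x = (\<Union>(a, b)\<in>x. fraction A a b)"

text \<open>The valuations are normalised; their value at zero is irrelevant.\<close>

definition discrete_valuation :: "('f, 'm) ring_scheme \<Rightarrow> ('f \<Rightarrow> int) \<Rightarrow> bool" where
  "discrete_valuation F v \<longleftrightarrow>
     (\<forall>x\<in>carrier F - {\<zero>\<^bsub>F\<^esub>}. \<forall>y\<in>carrier F - {\<zero>\<^bsub>F\<^esub>}.
        v (x \<otimes>\<^bsub>F\<^esub> y) = v x + v y \<and>
        (x \<oplus>\<^bsub>F\<^esub> y \<noteq> \<zero>\<^bsub>F\<^esub> \<longrightarrow> min (v x) (v y) \<le> v (x \<oplus>\<^bsub>F\<^esub> y))) \<and>
     v ` (carrier F - {\<zero>\<^bsub>F\<^esub>}) = UNIV"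

text \<open>A Krull domain is the intersection of a family, of finite character, of discrete valuation
  rings of its field of fractions. The family may be empty, so that fields are Krull domains.\<close>

definition krull_domain :: "('r, 'm) ring_scheme \<Rightarrow> bool" where
  "krull_domain R \<longleftrightarrow>
     domain R \<and>
     (\<exists>V. (\<forall>v\<in>V. discrete_valuation (total_quotient R) v) \<and>
          (\<forall>x\<in>carrier (total_quotient R) - {\<zero>\<^bsub>total_quotient R\<^esub>}. finite {v \<in> V. v x \<noteq> 0}) \<and>
          (\<lambda>r. fraction R r \<one>\<^bsub>R\<^esub>) ` carrier R =
            {x \<in> carrier (total_quotient R). x = \<zero>\<^bsub>total_quotient R\<^esub> \<or> (\<forall>v\<in>V. 0 \<le> v x)})"

definition Spec :: "('r, 'm) ring_scheme \<Rightarrow> 'r set set" where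
  "Spec A = {P. primeideal P A}"

definition height :: "('r, 'm) ring_scheme \<Rightarrow> 'r set \<Rightarrow> enat" where
  "height A P =
     Sup {enat n | n. \<exists>c. c n = P \<and> (\<forall>i\<le>n. c i \<in> Spec A) \<and> (\<forall>i<n. c i \<subset> c (Suc i))}"


section \<open>Group actions on rings\<close>

text \<open>The action \<open>(Spec R, G)\<close> is given by \<open>\<phi>\<close>, where \<open>\<phi> g\<close> is the automorphism of \<open>R\<close> attached
  to \<open>g\<close>. The assumption \<open>rational\<close> says that every element of \<open>R\<close> lies in a finite-dimensional
  \<open>G\<close>-stable subspace, with basis \<open>v 0, \<dots>, v (n - 1)\<close>, on which \<open>G\<close> acts by a matrix
  of regular functions on \<open>G\<close>.\<close>

locale regular_action =
  affine_algebraic_group K G A + R: algebra K R + action: group_action G "carrier R" \<phi>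
  for K (structure) and G and A and R and \<phi> +
  assumes ring_automorphism: "g \<in> carrier G \<Longrightarrow> \<phi> g \<in> ring_hom R R"
    and scalar_linear:
      "\<lbrakk>g \<in> carrier G; c \<in> carrier K; r \<in> carrier R\<rbrakk>
       \<Longrightarrow> \<phi> g (c \<odot>\<^bsub>R\<^esub> r) = c \<odot>\<^bsub>R\<^esub> \<phi> g r"
    and rational:
      "r \<in> carrier R \<Longrightarrow>
       \<exists>(n::nat) v m.
         (\<forall>i<n. v i \<in> carrier R) \<and>
         (\<forall>c. (\<forall>i<n. c i \<in> carrier K) \<and> (\<Oplus>\<^bsub>R\<^esub>i\<in>{..<n}. c i \<odot>\<^bsub>R\<^esub> v i) = \<zero>\<^bsub>R\<^esub>
              \<longrightarrow> (\<forall>i<n. c i = \<zero>)) \<and>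
         (\<exists>c. (\<forall>i<n. c i \<in> carrier K) \<and> r = (\<Oplus>\<^bsub>R\<^esub>i\<in>{..<n}. c i \<odot>\<^bsub>R\<^esub> v i)) \<and>
         (\<forall>i<n. \<forall>j<n. m i j \<in> A) \<and>
         (\<forall>g\<in>carrier G. \<forall>j<n. \<phi> g (v j) = (\<Oplus>\<^bsub>R\<^esub>i\<in>{..<n}. m i j g \<odot>\<^bsub>R\<^esub> v i))"

locale effective_regular_action = regular_action K G A R \<phi>
  for K (structure) and G and A and R and \<phi> +
  assumes effective: "finite (kernel G (BijGroup (carrier R)) \<phi>)"

definition fixed_ring ::
    "('g \<Rightarrow> 'r \<Rightarrow> 'r) \<Rightarrow> 'g set \<Rightarrow> ('r, 'm) ring_scheme \<Rightarrow> ('r, 'm) ring_scheme" where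
  "fixed_ring \<phi> H R = R\<lparr>carrier := {r \<in> carrier R. \<forall>g\<in>H. \<phi> g r = r}\<rparr>"

text \<open>The induced action on fractions: the image of the class of \<open>a / b\<close> under an automorphism is
  the class of \<open>g a / g b\<close>.\<close>

definition frac_action ::
    "('g \<Rightarrow> 'r \<Rightarrow> 'r) \<Rightarrow> 'g \<Rightarrow> ('r \<times> 'r) set \<Rightarrow> ('r \<times> 'r) set" where
  "frac_action \<phi> g x = map_prod (\<phi> g) (\<phi> g) ` x"

definition inertia ::
    "('g, 'n) monoid_scheme \<Rightarrow> ('g \<Rightarrow> 'r \<Rightarrow> 'r) \<Rightarrow> ('r, 'm) ring_scheme \<Rightarrow> 'r set \<Rightarrow> 'g set" where
  "inertia G \<phi> A P = {g \<in> carrier G. \<forall>x\<in>carrier A. \<phi> g x \<ominus>\<^bsub>A\<^esub> x \<in> P}"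

definition Ht1_fixed ::
    "('g, 'n) monoid_scheme \<Rightarrow> ('g \<Rightarrow> 'r \<Rightarrow> 'r) \<Rightarrow> ('r, 'm) ring_scheme \<Rightarrow> 'g set \<Rightarrow> 'r set set" where
  "Ht1_fixed G \<phi> R H =
     (let RH = fixed_ring \<phi> H R; RG = fixed_ring \<phi> (carrier G) R in
      {P \<in> Spec RH. height RH P = 1 \<and> height RG (P \<inter> carrier RG) = 1})"

definition Ht1_over ::
    "('g, 'n) monoid_scheme \<Rightarrow> ('g \<Rightarrow> 'r \<Rightarrow> 'r) \<Rightarrow> ('r, 'm) ring_scheme \<Rightarrow> 'g set \<Rightarrow> 'r set set" where
  "Ht1_over G \<phi> R H =
     (let RH = fixed_ring \<phi> H R; RG = fixed_ring \<phi> (carrier G) R in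
      {P \<in> Spec R. height R P = 1 \<and> height RH (P \<inter> carrier RH) = 1 \<and>
                    height RG (P \<inter> carrier RG) = 1})"

text \<open>\<open>refl_fixed G \<phi> R H\<close> is \<open>\<RR>(R\<^sup>H, G)\<close>, and \<open>refl_over G \<phi> R H\<close> is \<open>\<RR>(R, G; H)\<close>.\<close>

definition refl_fixed ::
    "('g, 'n) monoid_scheme \<Rightarrow> ('g \<Rightarrow> 'r \<Rightarrow> 'r) \<Rightarrow> ('r, 'm) ring_scheme \<Rightarrow> 'g set \<Rightarrow> 'g set" where
  "refl_fixed G \<phi> R H =
     generate G (\<Union>P\<in>Ht1_fixed G \<phi> R H. inertia G \<phi> (fixed_ring \<phi> H R) P)"

definition refl_over ::
    "('g, 'n) monoid_scheme \<Rightarrow> ('g \<Rightarrow> 'r \<Rightarrow> 'r) \<Rightarrow> ('r, 'm) ring_scheme \<Rightarrow> 'g set \<Rightarrow> 'g set" where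
  "refl_over G \<phi> R H = generate G (\<Union>P\<in>Ht1_over G \<phi> R H. inertia G \<phi> R P)"

definition restrict_group ::
    "('g \<Rightarrow> 'r \<Rightarrow> 'r) \<Rightarrow> 'g set \<Rightarrow> 'r set \<Rightarrow> ('r \<Rightarrow> 'r) set" where
  "restrict_group \<phi> \<Gamma> S = (\<lambda>g. restrict (\<phi> g) S) ` \<Gamma>"

end

theory Submission
  imports Defs
begin

text \<open>Throughout, \<open>R\<^sup>T\<close> is the ring of \<open>T\<close>-invariants. If \<open>P\<close> is a prime of \<open>R\<close> of height one whose
  contraction \<open>p\<close> to \<open>R\<^sup>T\<close> has height one, then an element of \<open>G\<close> that acts trivially on \<open>R / P\<close> acts
  trivially on \<open>R\<^sup>T / p\<close>. This gives one inclusion. For the other one, let \<open>g\<close> act trivially on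
  \<open>R\<^sup>T / p\<close>, where \<open>p\<close> has height one. It suffices to find a prime \<open>P\<close> of height one over \<open>p\<close> and
  \<open>t \<in> T\<close> such that \<open>gt\<close> acts trivially on \<open>R / P\<close> (\<open>inertia_lifts\<close>): as \<open>t\<close> acts trivially on
  \<open>R\<^sup>T\<close>, the elements \<open>g\<close> and \<open>gt\<close> have the same restriction to \<open>R\<^sup>T\<close>.

  The valuations that define \<open>R\<close> also define \<open>R\<^sup>T\<close>. They give the two facts on primes of height one
  on which the proof rests: there is a prime \<open>P\<close> of height one over \<open>p\<close>
  (\<open>ex_height_one_prime_over\<close>), and the local ring of \<open>R\<^sup>T\<close> at \<open>p\<close> is a valuation ring
  (\<open>height_one_imp_valuation_ring\<close>). Both come from an essential valuation, one that cannot be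
  dropped from the valuations that decide divisibility by a given element
  (\<open>ex_essential_valuation\<close>).

  Now let \<open>P\<close> be as found. As a module over the torus, \<open>R\<close> is the sum of its weight spaces
  (\<open>weight_decomposition\<close>), and \<open>g\<close> preserves each of them because \<open>T\<close> is central. Two nonzero vectors
  of the same weight have a \<open>T\<close>-invariant quotient, which is a fraction of elements of \<open>R\<^sup>T\<close> by the
  hypothesis on fraction fields. Thus \<open>g\<close> multiplies a weight vector \<open>r \<notin> P\<close> by a fraction \<open>w / h\<close> of
  invariants, and the valuation ring above allows \<open>h \<notin> p\<close>. Modulo \<open>P\<close> the \<open>k\<close>-th power of \<open>g\<close>
  multiplies \<open>r\<close> by the \<open>k\<close>-th power of \<open>w / h\<close>, since \<open>g\<close> is trivial on \<open>R\<^sup>T / p\<close>. The action is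
  locally finite, so \<open>w / h\<close> is algebraic over the algebraically closed field \<open>K\<close> and therefore is a
  nonzero scalar modulo \<open>P\<close> (\<open>ex_eigenvalue_mod\<close>).

  This scalar depends only on the weight of \<open>r\<close> (\<open>eigenvalue_mod_unique\<close>) and is multiplicative in
  it. As \<open>K\<^sup>*\<close> is divisible, it extends to a homomorphism on all characters of \<open>T\<close>, that is, to an
  element of \<open>T\<close> (\<open>ex_point_with_monomial_values\<close>). Multiplying \<open>g\<close> by the inverse of this element
  makes all eigenvalues one, so that the product acts trivially on \<open>R / P\<close>
  (\<open>ex_torus_element_correcting\<close>).\<close>

section \<open>Krull families of valuations\<close>

text \<open>The defining valuations of a Krull domain, restricted to the ring itself. That the ring is the
  intersection of the valuation rings becomes the divisibility criterion \<open>val_le_imp_divides\<close>. In this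
  form the same family \<open>V\<close> serves every subring that is closed under exact division, which is how
  the argument passes between \<open>R\<close> and \<open>R\<^sup>T\<close>. Values at zero carry no meaning.\<close>

locale krull_family = domain R for R (structure) +
  fixes V :: "('a \<Rightarrow> int) set"
  assumes val_nonneg: "\<lbrakk>v \<in> V; x \<in> carrier R - {\<zero>}\<rbrakk> \<Longrightarrow> 0 \<le> v x"
    and val_mult: "\<lbrakk>v \<in> V; x \<in> carrier R - {\<zero>}; y \<in> carrier R - {\<zero>}\<rbrakk> \<Longrightarrow> v (x \<otimes> y) = v x + v y"
    and val_add: "\<lbrakk>v \<in> V; x \<in> carrier R - {\<zero>}; y \<in> carrier R - {\<zero>}; x \<oplus> y \<noteq> \<zero>\<rbrakk>
      \<Longrightarrow> min (v x) (v y) \<le> v (x \<oplus> y)"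
    and finite_support: "x \<in> carrier R - {\<zero>} \<Longrightarrow> finite {v \<in> V. v x \<noteq> 0}"
    and val_le_imp_divides:
      "\<lbrakk>x \<in> carrier R - {\<zero>}; y \<in> carrier R - {\<zero>}; \<And>v. v \<in> V \<Longrightarrow> v y \<le> v x\<rbrakk> \<Longrightarrow> y divides x"
begin

lemma mult_nonzero: "\<lbrakk>x \<in> carrier R - {\<zero>}; y \<in> carrier R - {\<zero>}\<rbrakk> \<Longrightarrow> x \<otimes> y \<in> carrier R - {\<zero>}"
  using integral by auto

lemma pow_nonzero: "x \<in> carrier R - {\<zero>} \<Longrightarrow> x [^] (n::nat) \<in> carrier R - {\<zero>}"
  by (induction n) (use integral in auto)

lemma val_one: "v \<in> V \<Longrightarrow> v \<one> = 0"
  using val_mult[of v \<one> \<one>] by simp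

lemma val_pow: "\<lbrakk>v \<in> V; x \<in> carrier R - {\<zero>}\<rbrakk> \<Longrightarrow> v (x [^] (n::nat)) = int n * v x"
proof (induction n)
  case (Suc n)
  then show ?case using val_mult[of v "x [^] n" x] pow_nonzero[of x n] by (simp add: algebra_simps)
qed (simp add: val_one)

text \<open>One factor \<open>f\<close> is split off at a time: the quotient of \<open>x\<close> by \<open>f\<close> satisfies the hypothesis with
  \<open>k\<close> lowered by one.\<close>

lemma dominated_pow_divides:
  assumes f: "f \<in> carrier R - {\<zero>}" and W: "W \<subseteq> V"
    and dom: "\<And>x. \<lbrakk>x \<in> carrier R - {\<zero>}; \<And>w. w \<in> W \<Longrightarrow> w f \<le> w x\<rbrakk> \<Longrightarrow> f divides x"
  shows "\<lbrakk>x \<in> carrier R - {\<zero>}; \<And>w. w \<in> W \<Longrightarrow> int k * w f \<le> w x\<rbrakk> \<Longrightarrow> f [^] k divides x"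
proof (induction k arbitrary: x)
  case 0
  then show ?case unfolding factor_def by (intro bexI[of _ x]) auto
next
  case (Suc k)
  have "w f \<le> w x" if "w \<in> W" for w
  proof -
    have "0 \<le> w f" using val_nonneg[OF subsetD[OF W that] f] .
    then have "0 \<le> int k * w f" by simp
    moreover have "w f + int k * w f \<le> w x" using Suc.prems(2)[OF that] by (simp add: distrib_right)
    ultimately show ?thesis by linarith
  qed
  then obtain q where q: "q \<in> carrier R" "x = f \<otimes> q"
    using dom[OF Suc.prems(1)] unfolding factor_def by blast
  then have q0: "q \<in> carrier R - {\<zero>}" using Suc.prems(1) f by auto
  have "int k * w f \<le> w q" if "w \<in> W" for w
    using Suc.prems(2)[OF that] val_mult[OF subsetD[OF W that] f q0] q(2) by (simp add: distrib_right)
  then obtain r where r: "r \<in> carrier R" "q = f [^] k \<otimes> r"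
    using Suc.IH[OF q0] unfolding factor_def by blast
  then have "x = f [^] Suc k \<otimes> r" using q f by (simp add: m_ac)
  then show ?case using r(1) unfolding factor_def by blast
qed

text \<open>The valuations that do not vanish at \<open>f\<close> are finitely many and decide divisibility by \<open>f\<close>. In a
  subfamily of least cardinality that still does so, each \<open>w\<close> is indispensable, and \<open>b\<close> is an
  element that only \<open>w\<close> recognises as not divisible by \<open>f\<close>.\<close>

lemma ex_irredundant_family:
  assumes f: "f \<in> carrier R - {\<zero>}"
  obtains W where "W \<subseteq> V" "finite W"
    "\<And>x. \<lbrakk>x \<in> carrier R - {\<zero>}; \<And>w. w \<in> W \<Longrightarrow> w f \<le> w x\<rbrakk> \<Longrightarrow> f divides x"
    "\<And>w. w \<in> W \<Longrightarrow> \<exists>b\<in>carrier R - {\<zero>}. w b < w f \<and> (\<forall>w'\<in>W - {w}. w' f \<le> w' b)"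
proof -
  define D where "D W \<longleftrightarrow> W \<subseteq> V \<and> finite W \<and>
    (\<forall>x\<in>carrier R - {\<zero>}. (\<forall>w\<in>W. w f \<le> w x) \<longrightarrow> f divides x)" for W
  have "D {v \<in> V. v f \<noteq> 0}"
    unfolding D_def
  proof (intro conjI ballI impI)
    fix x assume x: "x \<in> carrier R - {\<zero>}" and le: "\<forall>w\<in>{v \<in> V. v f \<noteq> 0}. w f \<le> w x"
    have "v f \<le> v x" if "v \<in> V" for v
      using le that val_nonneg[OF that x] by (cases "v f = 0") auto
    then show "f divides x" using val_le_imp_divides x f by blast
  qed (use finite_support f in auto)
  then obtain W where W: "D W" and min: "\<And>W'. D W' \<Longrightarrow> card W \<le> card W'"
    using ex_has_least_nat[of D _ card] by blast
  show thesis
  proof (rule that)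
    fix w assume w: "w \<in> W"
    have "card (W - {w}) < card W" using W w unfolding D_def by (meson card_Diff1_less)
    then have "\<not> D (W - {w})" using min by (meson leD)
    then obtain b where b: "b \<in> carrier R - {\<zero>}" "\<forall>w'\<in>W - {w}. w' f \<le> w' b" "\<not> f divides b"
      using W unfolding D_def by blast
    then have "w b < w f" using W w unfolding D_def by (metis Diff_iff linorder_not_less singletonD)
    then show "\<exists>b\<in>carrier R - {\<zero>}. w b < w f \<and> (\<forall>w'\<in>W - {w}. w' f \<le> w' b)" using b by blast
  qed (use W in \<open>auto simp: D_def\<close>)
qed

text \<open>Localising at \<open>M\<close> leaves \<open>f\<close> a nonunit, so some valuation \<open>w\<close> of an irredundant family for \<open>f\<close>
  is nonnegative on the localisation: otherwise a product of powers of elements of \<open>M\<close>, one for each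
  \<open>w\<close>, would be divisible by \<open>f\<close>. Irredundancy gives a fraction \<open>b / f\<close> whose only pole in the family
  is \<open>w\<close>. Multiplying by its powers clears the value of \<open>x\<close> at \<open>w\<close> without creating other poles.
  The last conclusion says that fractions with nonnegative value at \<open>w\<close> have a denominator of
  value zero, that is, \<open>w\<close> is the valuation of the local ring at its center.\<close>

theorem ex_essential_valuation:
  assumes f: "f \<in> carrier R - {\<zero>}"
    and M: "M \<subseteq> carrier R - {\<zero>}" "\<one> \<in> M" "\<And>x y. \<lbrakk>x \<in> M; y \<in> M\<rbrakk> \<Longrightarrow> x \<otimes> y \<in> M"
    and ndvd: "\<And>x. x \<in> M \<Longrightarrow> \<not> f divides x"
  obtains w where "w \<in> V" "0 < w f" "\<And>x. x \<in> M \<Longrightarrow> w x = 0"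
    "\<And>x y. \<lbrakk>x \<in> carrier R - {\<zero>}; y \<in> carrier R - {\<zero>}; w x \<le> w y\<rbrakk>
      \<Longrightarrow> \<exists>x'\<in>carrier R - {\<zero>}. \<exists>y'\<in>carrier R. w x' = 0 \<and> x \<otimes> y' = x' \<otimes> y"
proof -
  obtain W where W: "W \<subseteq> V" "finite W"
    and dom: "\<And>x. \<lbrakk>x \<in> carrier R - {\<zero>}; \<And>w. w \<in> W \<Longrightarrow> w f \<le> w x\<rbrakk> \<Longrightarrow> f divides x"
    and irr: "\<And>w. w \<in> W \<Longrightarrow> \<exists>b\<in>carrier R - {\<zero>}. w b < w f \<and> (\<forall>w'\<in>W - {w}. w' f \<le> w' b)"
    using ex_irredundant_family[OF f] by blast
  have "\<exists>w\<in>W. \<forall>x\<in>M. w x = 0"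
  proof (rule ccontr)
    assume "\<not> ?thesis"
    then have ex: "\<exists>x\<in>M. 0 < w x" if "w \<in> W" for w
      using that W(1) M(1) val_nonneg by (metis linorder_not_less order_antisym subset_iff)
    have "\<exists>m\<in>M. \<forall>w\<in>U. w f \<le> w m" if "U \<subseteq> W" for U
      using finite_subset[OF that W(2)] that
    proof (induction rule: finite_induct)
      case empty
      then show ?case using M(2) by blast
    next
      case (insert u U)
      then obtain m where m: "m \<in> M" "\<forall>w\<in>U. w f \<le> w m" by auto
      obtain x where x: "x \<in> M" "0 < u x" using ex insert.prems by auto
      define n where "n = nat (u f)"
      have xn: "x [^] k \<in> M" for k :: nat by (induction k) (use x M in auto)
      have "w f \<le> w (m \<otimes> x [^] n)" if w: "w \<in> insert u U" for w
      proof -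
        have wV: "w \<in> V" using w insert.prems W by auto
        have nz: "m \<in> carrier R - {\<zero>}" "x \<in> carrier R - {\<zero>}" using m(1) x(1) M(1) by blast+
        have nn: "0 \<le> w m" "0 \<le> w x" using val_nonneg[OF wV] nz by auto
        have eq: "w (m \<otimes> x [^] n) = w m + int n * w x"
          using val_mult[OF wV nz(1) pow_nonzero[OF nz(2)]] val_pow[OF wV nz(2)] by simp
        show ?thesis
        proof (cases "w = u")
          case True
          have "int n * 1 \<le> int n * w x" using x True by (intro mult_left_mono) auto
          then show ?thesis using eq nn True val_nonneg[OF wV f] by (simp add: n_def)
        next
          case False
          then have "w f \<le> w m" using w m by auto
          moreover have "0 \<le> int n * w x" using nn by simp
          ultimately show ?thesis using eq by simp
        qed
      qed
      then show ?case using M(3) m(1) xn by blast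
    qed
    then obtain m where "m \<in> M" "\<forall>w\<in>W. w f \<le> w m" by blast
    then show False using dom[of m] ndvd[of m] M(1) by blast
  qed
  then obtain w where w: "w \<in> W" and wM: "\<And>x. x \<in> M \<Longrightarrow> w x = 0" by blast
  then have wV: "w \<in> V" using W by blast
  obtain b where b: "b \<in> carrier R - {\<zero>}" "w b < w f" "\<forall>w'\<in>W - {w}. w' f \<le> w' b"
    using irr[OF w] by blast
  have pos: "0 < w f" using b val_nonneg[OF wV b(1)] by linarith
  show thesis
  proof (rule that[OF wV pos wM])
    fix x y assume x: "x \<in> carrier R - {\<zero>}" and y: "y \<in> carrier R - {\<zero>}" and le: "w x \<le> w y"
    define l where "l = nat (w x)"
    define k where "k = nat (w f - w b) - 1"
    have l: "int l = w x" using val_nonneg[OF wV x] by (simp add: l_def)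
    have k: "int (Suc k) = w f - w b" using b(2) by (simp add: k_def)
    \<comment> \<open>Since \<open>k + 1 = w f - w b\<close>, the fraction \<open>z = x^k (b / f)^l\<close> has value \<open>- w x\<close> at \<open>w\<close>; the
      new numerator and denominator are \<open>y z\<close> and \<open>x z\<close>.\<close>
    have div: "f [^] l divides (x [^] k \<otimes> u) \<otimes> b [^] l" if u: "u \<in> carrier R - {\<zero>}" "w x \<le> w u" for u
    proof (rule dominated_pow_divides[OF f W(1) dom])
      show "x [^] k \<otimes> u \<otimes> b [^] l \<in> carrier R - {\<zero>}"
        using mult_nonzero[OF mult_nonzero[OF pow_nonzero[OF x] u(1)] pow_nonzero[OF b(1)]] .
      fix w' assume w': "w' \<in> W"
      then have V: "w' \<in> V" using W by blast
      have nn: "0 \<le> w' x" "0 \<le> w' u" using val_nonneg[OF V] x u by auto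
      have eq: "w' (x [^] k \<otimes> u \<otimes> b [^] l) = int k * w' x + w' u + int l * w' b"
        using val_mult[OF V mult_nonzero[OF pow_nonzero[OF x] u(1)] pow_nonzero[OF b(1)], of k l]
          val_mult[OF V pow_nonzero[OF x] u(1), of k] val_pow[OF V x, of k] val_pow[OF V b(1), of l]
        by simp
      show "int l * w' f \<le> w' (x [^] k \<otimes> u \<otimes> b [^] l)"
      proof (cases "w' = w")
        case True
        have "int l * w f = int l * w b + int l * int (Suc k)"
            unfolding k by (simp add: right_diff_distrib)
        also have "\<dots> = int l * w b + int k * w x + w x" unfolding l[symmetric] by (simp add: algebra_simps)
        also have "\<dots> \<le> int l * w b + int k * w x + w u" using u by simp
        finally show ?thesis using eq True by simp
      next
        case False
        then have "int l * w' f \<le> int l * w' b" using b w' by (intro mult_left_mono) auto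
        moreover have "0 \<le> int k * w' x" using nn by simp
        ultimately show ?thesis using eq nn by linarith
      qed
    qed
    obtain x' where x': "x' \<in> carrier R" "(x [^] k \<otimes> x) \<otimes> b [^] l = f [^] l \<otimes> x'"
      using div[OF x] by (auto simp: factor_def)
    obtain y' where y': "y' \<in> carrier R" "(x [^] k \<otimes> y) \<otimes> b [^] l = f [^] l \<otimes> y'"
      using div[OF y le] by (auto simp: factor_def)
    have fl: "f [^] l \<in> carrier R - {\<zero>}" and bl: "b [^] l \<in> carrier R - {\<zero>}"
      and xk: "x [^] k \<in> carrier R - {\<zero>}" using pow_nonzero f b x by auto
    have "(x [^] k \<otimes> x) \<otimes> b [^] l \<in> carrier R - {\<zero>}"
      using mult_nonzero[OF mult_nonzero[OF xk x] bl] .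
    then have x'0: "x' \<in> carrier R - {\<zero>}" using x' fl by auto
    have "int l * w f + w x' = int k * w x + w x + int l * w b"
      using arg_cong[OF x'(2), of w] val_mult[OF wV mult_nonzero[OF xk x] bl] val_mult[OF wV xk x]
        val_mult[OF wV fl x'0] val_pow[OF wV f, of l] val_pow[OF wV b(1), of l] val_pow[OF wV x, of k]
      by simp
    also have "\<dots> = int l * int (Suc k) + int l * w b"
      unfolding l[symmetric] by (simp add: algebra_simps)
    also have "\<dots> = int l * w f" unfolding k by (simp add: algebra_simps)
    finally have wx': "w x' = 0" by simp
    have "f [^] l \<otimes> (x \<otimes> y') = x \<otimes> (f [^] l \<otimes> y')"
      using x y' fl by (simp add: m_ac)
    also have "\<dots> = x \<otimes> ((x [^] k \<otimes> y) \<otimes> b [^] l)" by (simp add: y')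
    also have "\<dots> = ((x [^] k \<otimes> x) \<otimes> b [^] l) \<otimes> y"
      using x y bl xk by (simp add: m_ac)
    also have "\<dots> = f [^] l \<otimes> (x' \<otimes> y)" using x' y fl by (simp add: m_ac)
    finally have "x \<otimes> y' = x' \<otimes> y"
      using m_lcancel[of "f [^] l" "x \<otimes> y'" "x' \<otimes> y"] fl x y x' y' by auto
    then show "\<exists>x'\<in>carrier R - {\<zero>}. \<exists>y'\<in>carrier R. w x' = 0 \<and> x \<otimes> y' = x' \<otimes> y"
      using x'0 y' wx' by blast
  qed
qed

definition center :: "('a \<Rightarrow> int) \<Rightarrow> 'a set" where
  "center v = {x \<in> carrier R. x = \<zero> \<or> 0 < v x}"

lemma primeideal_center:
  assumes v: "v \<in> V"
  shows "primeideal (center v) R"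
proof (rule primeidealI2)
  show "additive_subgroup (center v) R"
  proof (unfold additive_subgroup_def, rule add.subgroupI)
    show "center v \<noteq> {}" by (auto simp: center_def)
    fix x assume x: "x \<in> center v"
    have "v (\<ominus> x) = v x" if "x \<noteq> \<zero>"
    proof -
      have "\<ominus> \<one> \<otimes> \<ominus> \<one> = \<one>" by (simp add: l_minus r_minus)
      then have "v (\<ominus> \<one>) = 0" using val_mult[OF v, of "\<ominus> \<one>" "\<ominus> \<one>"] val_one[OF v] by simp
      moreover have "\<ominus> x = \<ominus> \<one> \<otimes> x" using x by (simp add: l_minus center_def)
      ultimately show ?thesis using val_mult[OF v, of "\<ominus> \<one>" x] x that by (simp add: center_def)
    qed
    then show "\<ominus> x \<in> center v" using x by (cases "x = \<zero>") (auto simp: center_def)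
    fix y assume y: "y \<in> center v"
    show "x \<oplus> y \<in> center v"
      using val_add[OF v, of x y] x y by (cases "x = \<zero>"; cases "y = \<zero>"; cases "x \<oplus> y = \<zero>") (auto simp: center_def)
  qed (auto simp: center_def)
  show "x \<otimes> a \<in> center v" if "a \<in> center v" "x \<in> carrier R" for a x
    using that val_mult[OF v, of x a] val_nonneg[OF v, of x]
    by (cases "x = \<zero>"; cases "a = \<zero>") (auto simp: center_def)
  then show "a \<otimes> x \<in> center v" if "a \<in> center v" "x \<in> carrier R" for a x
    using that m_comm[of a x] by (simp add: center_def)
  show "carrier R \<noteq> center v" using val_one[OF v] one_closed one_not_zero unfolding center_def by fastforce
  show "a \<in> center v \<or> b \<in> center v" if "a \<in> carrier R" "b \<in> carrier R" "a \<otimes> b \<in> center v" for a b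
  proof -
    consider "a = \<zero> \<or> b = \<zero>" | "a \<noteq> \<zero>" "b \<noteq> \<zero>" by blast
    then show ?thesis
    proof cases
      case 2
      then have "a \<otimes> b \<noteq> \<zero>" using that integral by blast
      then have "0 < v a + v b" using that 2 val_mult[OF v, of a b] by (simp add: center_def)
      then show ?thesis using that by (auto simp: center_def)
    qed (use that in \<open>auto simp: center_def\<close>)
  qed
qed (rule is_cring)

end

section \<open>Krull domains and primes of height one\<close>

lemma UN_pairs_eqI:
  assumes "(a, b) \<in> S" "(c, d) \<in> U"
    and "\<And>x y u v. \<lbrakk>(x, y) \<in> S; (u, v) \<in> U\<rbrakk> \<Longrightarrow> F x y u v = C"
  shows "(\<Union>(x, y)\<in>S. \<Union>(u, v)\<in>U. F x y u v) = C"
proof -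
  have "S \<noteq> {}" "U \<noteq> {}" using assms(1,2) by auto
  moreover have "(\<Union>(x, y)\<in>S. \<Union>(u, v)\<in>U. F x y u v) = (\<Union>z\<in>S. \<Union>w\<in>U. C)"
    using assms(3) by (intro SUP_cong refl) (auto split: prod.split)
  ultimately show ?thesis by simp
qed

context domain
begin

lemma nonzerodivisors_eq: "nonzerodivisors R = carrier R - {\<zero>}"
  unfolding nonzerodivisors_def using integral one_closed one_not_zero r_null by fastforce

lemma fraction_refl: "\<lbrakk>a \<in> carrier R; b \<in> carrier R - {\<zero>}\<rbrakk> \<Longrightarrow> (a, b) \<in> fraction R a b"
  by (simp add: fraction_def nonzerodivisors_eq)

lemma fraction_eq_iff:
  assumes "a \<in> carrier R" "b \<in> carrier R - {\<zero>}" "c \<in> carrier R" "d \<in> carrier R - {\<zero>}"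
  shows "fraction R a b = fraction R c d \<longleftrightarrow> a \<otimes> d = c \<otimes> b"
proof
  assume "fraction R a b = fraction R c d"
  then have "(c, d) \<in> fraction R a b" using fraction_refl[OF assms(3,4)] by simp
  then show "a \<otimes> d = c \<otimes> b" by (simp add: fraction_def)
next
  have sub: "fraction R a b \<subseteq> fraction R c d"
    if "a \<in> carrier R" "b \<in> carrier R - {\<zero>}" "c \<in> carrier R" "d \<in> carrier R - {\<zero>}" "a \<otimes> d = c \<otimes> b"
    for a b c d
  proof
    fix z assume "z \<in> fraction R a b"
    then obtain x y where z: "z = (x, y)" "x \<in> carrier R" "y \<in> carrier R - {\<zero>}" "a \<otimes> y = x \<otimes> b"
      by (auto simp: fraction_def nonzerodivisors_eq)
    have "b \<otimes> (c \<otimes> y) = (c \<otimes> b) \<otimes> y" using that(1-4) z(2,3) by (simp add: m_ac)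
    also have "\<dots> = d \<otimes> (a \<otimes> y)" unfolding that(5)[symmetric] using that(1-4) z(2,3) by (simp add: m_ac)
    also have "\<dots> = b \<otimes> (x \<otimes> d)" unfolding z(4) using that(1-4) z(2,3) by (simp add: m_ac)
    finally have "c \<otimes> y = x \<otimes> d" using m_lcancel[of b "c \<otimes> y" "x \<otimes> d"] that(1-4) z(2,3) by simp
    then show "z \<in> fraction R c d" using z by (simp add: fraction_def nonzerodivisors_eq)
  qed
  assume "a \<otimes> d = c \<otimes> b"
  then show "fraction R a b = fraction R c d" using sub[of a b c d] sub[of c d a b] assms by auto
qed

lemma total_quotient_mult:
  assumes "a \<in> carrier R" "b \<in> carrier R - {\<zero>}" "c \<in> carrier R" "d \<in> carrier R - {\<zero>}"
  shows "fraction R a b \<otimes>\<^bsub>total_quotient R\<^esub> fraction R c d = fraction R (a \<otimes> c) (b \<otimes> d)"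
proof -
  have "fraction R (x \<otimes> u) (y \<otimes> v) = fraction R (a \<otimes> c) (b \<otimes> d)"
    if "(x, y) \<in> fraction R a b" "(u, v) \<in> fraction R c d" for x y u v
  proof (subst fraction_eq_iff)
    have xy: "x \<in> carrier R" "y \<in> carrier R - {\<zero>}" "a \<otimes> y = x \<otimes> b"
      and uv: "u \<in> carrier R" "v \<in> carrier R - {\<zero>}" "c \<otimes> v = u \<otimes> d"
      using that by (auto simp: fraction_def nonzerodivisors_eq)
    show "x \<otimes> u \<in> carrier R" "y \<otimes> v \<in> carrier R - {\<zero>}" "a \<otimes> c \<in> carrier R"
      "b \<otimes> d \<in> carrier R - {\<zero>}" using assms xy uv integral by auto
    have "(x \<otimes> u) \<otimes> (b \<otimes> d) = (x \<otimes> b) \<otimes> (u \<otimes> d)" using assms xy(1,2) uv(1,2) by (simp add: m_ac)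
    also have "\<dots> = (a \<otimes> y) \<otimes> (c \<otimes> v)" by (simp only: xy(3) uv(3))
    also have "\<dots> = (a \<otimes> c) \<otimes> (y \<otimes> v)" using assms xy(1,2) uv(1,2) by (simp add: m_ac)
    finally show "(x \<otimes> u) \<otimes> (b \<otimes> d) = (a \<otimes> c) \<otimes> (y \<otimes> v)" .
  qed
  from UN_pairs_eqI[OF fraction_refl[OF assms(1,2)] fraction_refl[OF assms(3,4)] this]
  show ?thesis by (simp add: total_quotient_def)
qed

lemma total_quotient_add_integral:
  assumes "a \<in> carrier R" "b \<in> carrier R"
  shows "fraction R a \<one> \<oplus>\<^bsub>total_quotient R\<^esub> fraction R b \<one> = fraction R (a \<oplus> b) \<one>"
proof -
  have "fraction R (x \<otimes> v \<oplus> u \<otimes> y) (y \<otimes> v) = fraction R (a \<oplus> b) \<one>"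
    if "(x, y) \<in> fraction R a \<one>" "(u, v) \<in> fraction R b \<one>" for x y u v
  proof (subst fraction_eq_iff)
    have xy: "x \<in> carrier R" "y \<in> carrier R - {\<zero>}" "x = a \<otimes> y"
      and uv: "u \<in> carrier R" "v \<in> carrier R - {\<zero>}" "u = b \<otimes> v"
      using that by (auto simp: fraction_def nonzerodivisors_eq)
    show "x \<otimes> v \<oplus> u \<otimes> y \<in> carrier R" "y \<otimes> v \<in> carrier R - {\<zero>}" "a \<oplus> b \<in> carrier R"
      "\<one> \<in> carrier R - {\<zero>}" using assms xy uv integral by auto
    show "(x \<otimes> v \<oplus> u \<otimes> y) \<otimes> \<one> = (a \<oplus> b) \<otimes> (y \<otimes> v)"
      using assms xy uv by (simp add: l_distr r_distr m_ac)
  qed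
  from UN_pairs_eqI[OF fraction_refl[of a \<one>] fraction_refl[of b \<one>] this]
  show ?thesis using assms by (simp add: total_quotient_def)
qed

end

text \<open>The quotient of \<open>x\<close> by \<open>y\<close> has value \<open>v x - v y\<close>, so if all these are nonnegative it lies in the
  intersection of the valuation rings, which is \<open>R\<close>.\<close>

lemma krull_domain_imp_krull_family:
  fixes R (structure)
  assumes "krull_domain R"
  shows "\<exists>V. krull_family R V"
proof -
  interpret domain R using assms[unfolded krull_domain_def] by (rule conjunct1)
  define Q where "Q = total_quotient R"
  define \<iota> where "\<iota> r = fraction R r \<one>\<^bsub>R\<^esub>" for r
  have "\<exists>V. (\<forall>v\<in>V. discrete_valuation Q v) \<and>
      (\<forall>x\<in>carrier Q - {\<zero>\<^bsub>Q\<^esub>}. finite {v \<in> V. v x \<noteq> 0}) \<and>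
      \<iota> ` carrier R = {x \<in> carrier Q. x = \<zero>\<^bsub>Q\<^esub> \<or> (\<forall>v\<in>V. 0 \<le> v x)}"
    unfolding Q_def \<iota>_def using conjunct2[OF assms[unfolded krull_domain_def]] .
  then obtain V where V: "(\<forall>v\<in>V. discrete_valuation Q v) \<and>
      (\<forall>x\<in>carrier Q - {\<zero>\<^bsub>Q\<^esub>}. finite {v \<in> V. v x \<noteq> 0}) \<and>
      \<iota> ` carrier R = {x \<in> carrier Q. x = \<zero>\<^bsub>Q\<^esub> \<or> (\<forall>v\<in>V. 0 \<le> v x)}"
    by (rule exE)
  note dv = V[THEN conjunct1, THEN bspec]
    and fin = V[THEN conjunct2, THEN conjunct1, THEN bspec]
    and int = V[THEN conjunct2, THEN conjunct2]
  have zero: "\<zero>\<^bsub>Q\<^esub> = \<iota> \<zero>" by (simp add: Q_def \<iota>_def total_quotient_def)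
  have frac: "fraction R x y \<in> carrier Q - {\<zero>\<^bsub>Q\<^esub>}" if "x \<in> carrier R - {\<zero>}" "y \<in> carrier R - {\<zero>}" for x y
  proof -
    have "fraction R x y \<noteq> \<iota> \<zero>"
      unfolding \<iota>_def using that by (subst fraction_eq_iff) auto
    moreover have "fraction R x y \<in> carrier Q"
      unfolding Q_def total_quotient_def using that by (auto simp: nonzerodivisors_eq)
    ultimately show ?thesis by (simp add: zero)
  qed
  have emb: "\<iota> x \<in> carrier Q - {\<zero>\<^bsub>Q\<^esub>}" if "x \<in> carrier R - {\<zero>}" for x
    using frac[OF that, of \<one>] by (simp add: \<iota>_def)
  have mult: "v (x \<otimes>\<^bsub>Q\<^esub> y) = v x + v y"
    if "v \<in> V" "x \<in> carrier Q - {\<zero>\<^bsub>Q\<^esub>}" "y \<in> carrier Q - {\<zero>\<^bsub>Q\<^esub>}" for v x y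
    using dv[OF that(1)] that unfolding discrete_valuation_def by blast
  have add: "min (v x) (v y) \<le> v (x \<oplus>\<^bsub>Q\<^esub> y)"
    if "v \<in> V" "x \<in> carrier Q - {\<zero>\<^bsub>Q\<^esub>}" "y \<in> carrier Q - {\<zero>\<^bsub>Q\<^esub>}" "x \<oplus>\<^bsub>Q\<^esub> y \<noteq> \<zero>\<^bsub>Q\<^esub>" for v x y
    using dv[OF that(1)] that unfolding discrete_valuation_def by blast
  have "krull_family R ((\<lambda>v r. v (\<iota> r)) ` V)"
  proof (unfold_locales, goal_cases)
    case (1 v x)
    then have "\<iota> x \<in> \<iota> ` carrier R" "\<iota> x \<noteq> \<zero>\<^bsub>Q\<^esub>" using emb by auto
    then show ?case using 1 unfolding int by auto
  next
    case (2 v x y)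
    then obtain w where w: "w \<in> V" "v = (\<lambda>r. w (\<iota> r))" by blast
    have "\<iota> (x \<otimes> y) = \<iota> x \<otimes>\<^bsub>Q\<^esub> \<iota> y"
      using total_quotient_mult[of x \<one> y \<one>] 2 by (simp add: Q_def \<iota>_def)
    then show ?case using mult[OF w(1) emb emb] 2 w(2) by simp
  next
    case (3 v x y)
    then obtain w where w: "w \<in> V" "v = (\<lambda>r. w (\<iota> r))" by blast
    have eq: "\<iota> (x \<oplus> y) = \<iota> x \<oplus>\<^bsub>Q\<^esub> \<iota> y"
      using total_quotient_add_integral[of x y] 3 by (simp add: Q_def \<iota>_def)
    moreover have "\<iota> (x \<oplus> y) \<noteq> \<zero>\<^bsub>Q\<^esub>" using emb[of "x \<oplus> y"] 3 by simp
    ultimately show ?case using add[OF w(1) emb emb] 3 w(2) by simp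
  next
    case (4 x)
    have "{v \<in> (\<lambda>v r. v (\<iota> r)) ` V. v x \<noteq> 0} \<subseteq> (\<lambda>v r. v (\<iota> r)) ` {v \<in> V. v (\<iota> x) \<noteq> 0}" by auto
    then show ?case using fin[OF emb[OF 4]] finite_subset by blast
  next
    case (5 x y)
    have eq: "\<iota> x = fraction R x y \<otimes>\<^bsub>Q\<^esub> \<iota> y"
      using 5 total_quotient_mult[of x y y \<one>] unfolding \<iota>_def Q_def
      by (subst fraction_eq_iff[of x \<one> "x \<otimes> y" y, THEN iffD2]) auto
    have "0 \<le> v (fraction R x y)" if "v \<in> V" for v
    proof -
      have "v (\<iota> y) \<le> v (\<iota> x)" using 5 that by blast
      then show ?thesis using mult[OF that frac[OF 5(1,2)] emb[OF 5(2)]] eq by simp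
    qed
    then have "fraction R x y \<in> \<iota> ` carrier R" unfolding int using frac[OF 5(1,2)] by blast
    then obtain q where q: "q \<in> carrier R" "fraction R x y = \<iota> q" by blast
    then have "x = q \<otimes> y" using 5 fraction_eq_iff[of x y q \<one>] by (simp add: \<iota>_def)
    then show ?case using q 5 m_comm[of q y] unfolding factor_def by auto
  qed
  then show ?thesis by blast
qed

lemma (in domain) height_eq_1_iff:
  assumes P: "P \<in> Spec R"
  shows "height R P = 1 \<longleftrightarrow> P \<noteq> {\<zero>} \<and> (\<forall>Q\<in>Spec R. Q \<subseteq> P \<longrightarrow> Q = {\<zero>} \<or> Q = P)"
    (is "_ \<longleftrightarrow> ?rhs")
proof -
  define C where "C = {n. \<exists>c. c n = P \<and> (\<forall>i\<le>n. c i \<in> Spec R) \<and> (\<forall>i<n. c i \<subset> c (Suc i))}"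
  have height: "height R P = Sup (enat ` C)"
    unfolding height_def C_def by (rule arg_cong[of _ _ Sup]) auto
  have zero: "{\<zero>} \<in> Spec R" using zeroprimeideal by (simp add: Spec_def)
  have zero_mem: "\<zero> \<in> Q" if "Q \<in> Spec R" for Q
    using that additive_subgroup.zero_closed[OF ideal.axioms(1)[OF primeideal.axioms(1)]]
    by (auto simp: Spec_def)
  show ?thesis
  proof
    assume h: "height R P = 1"
    have "P \<noteq> {\<zero>}"
    proof
      assume P0: "P = {\<zero>}"
      have "n = 0" if n: "n \<in> C" for n
      proof (rule ccontr)
        assume "n \<noteq> 0"
        then obtain m where m: "n = Suc m" using not0_implies_Suc by blast
        obtain c where "c n = P" "\<forall>i\<le>n. c i \<in> Spec R" "\<forall>i<n. c i \<subset> c (Suc i)"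
          using n unfolding C_def by blast
        then have "c m \<subset> {\<zero>}" "\<zero> \<in> c m" using m P0 zero_mem[of "c m"] by auto
        then show False by blast
      qed
      then have "height R P \<le> 0" unfolding height by (auto intro!: Sup_least simp: zero_enat_def)
      then show False using h by simp
    qed
    moreover have "Q = {\<zero>} \<or> Q = P" if Q: "Q \<in> Spec R" "Q \<subseteq> P" for Q
    proof (rule ccontr)
      assume ne: "\<not> ?thesis"
      define c where "c = (\<lambda>i::nat. if i = 0 then {\<zero>} else if i = 1 then Q else P)"
      have "{\<zero>} \<subset> Q" using zero_mem[OF Q(1)] ne by blast
      then have "2 \<in> C" unfolding C_def
        using ne Q P zero by (auto intro!: exI[of _ c] simp: c_def less_Suc_eq numeral_2_eq_2 le_Suc_eq)
      then have "enat 2 \<le> height R P" unfolding height by (intro Sup_upper) auto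
      then show False using h by (simp add: one_enat_def)
    qed
    ultimately show ?rhs by blast
  next
    assume rhs: ?rhs
    have "{\<zero>} \<subset> P" using zero_mem[OF P] rhs by blast
    then have "1 \<in> C" unfolding C_def
      using P zero by (auto intro!: exI[of _ "\<lambda>i. if i = 0 then {\<zero>} else P"] simp: le_Suc_eq)
    then have "enat 1 \<le> height R P" unfolding height by (intro Sup_upper) auto
    moreover have "n \<le> 1" if n: "n \<in> C" for n
    proof (rule ccontr)
      assume "\<not> n \<le> 1"
      then obtain m where m: "n = Suc (Suc m)" by (metis One_nat_def not_less_eq_eq le0 not0_implies_Suc)
      obtain c where c: "c n = P" "\<forall>i\<le>n. c i \<in> Spec R" "\<forall>i<n. c i \<subset> c (Suc i)"
        using n unfolding C_def by blast
      have "c m \<subset> c (Suc m)" "c (Suc m) \<subset> P" "c m \<in> Spec R" "c (Suc m) \<in> Spec R"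
        using c m by auto
      moreover have "c (Suc m) = {\<zero>} \<or> c (Suc m) = P"
        using conjunct2[OF rhs] \<open>c (Suc m) \<in> Spec R\<close> \<open>c (Suc m) \<subset> P\<close> by (simp add: psubset_imp_subset)
      ultimately show False using zero_mem[of "c m"] by auto
    qed
    then have "height R P \<le> 1"
      unfolding height by (auto intro!: Sup_least simp: one_enat_def)
    ultimately show "height R P = 1" by (simp add: one_enat_def)
  qed
qed

lemma (in primeideal) pow_mem_imp_mem: "\<lbrakk>x \<in> carrier R; x [^] (k::nat) \<in> I\<rbrakk> \<Longrightarrow> x \<in> I"
proof (induction k)
  case 0
  then show ?case using one_imp_carrier I_notcarr by simp
next
  case (Suc k)
  then show ?case using I_prime[of "x [^] k" x] by auto
qed

lemma (in ring) subring_a_inv: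
  assumes B: "subring B R" and "y \<in> B"
  shows "\<ominus>\<^bsub>R\<lparr>carrier := B\<rparr>\<^esub> y = \<ominus> y"
proof -
  have "subgroup B (add_monoid R)" using B by (simp add: subring_def)
  then show ?thesis using add.m_inv_consistent[of B y] assms(2) by (simp add: a_inv_def)
qed

lemma (in ring) subring_minus:
  assumes B: "subring B R" and "x \<in> B" "y \<in> B"
  shows "x \<ominus>\<^bsub>R\<lparr>carrier := B\<rparr>\<^esub> y = x \<ominus> y"
  using subring_a_inv[OF B assms(3)] by (simp add: a_minus_def)

lemma (in cring) primeideal_contract:
  assumes B: "subring B R" and P: "primeideal P R"
  shows "primeideal (P \<inter> B) (R\<lparr>carrier := B\<rparr>)"
proof -
  interpret P: primeideal P R by fact
  interpret B: cring "R\<lparr>carrier := B\<rparr>" using subcring_iff[OF subringE(1)[OF B]] B subcringI'[OF B] by blast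
  note sub = subringE[OF B]
  show ?thesis
  proof (rule primeidealI2)
    show "additive_subgroup (P \<inter> B) (R\<lparr>carrier := B\<rparr>)"
    proof (unfold additive_subgroup_def, rule B.add.subgroupI)
      fix a assume a: "a \<in> P \<inter> B"
      then show "\<ominus>\<^bsub>R\<lparr>carrier := B\<rparr>\<^esub> a \<in> P \<inter> B"
        using subring_a_inv[OF B, of a] sub(5) P.a_inv_closed by auto
    next
      show "P \<inter> B \<noteq> {}" using P.zero_closed sub(2) by blast
    qed (use sub P.a_closed in auto)
    show "carrier (R\<lparr>carrier := B\<rparr>) \<noteq> P \<inter> B"
      using P.one_imp_carrier P.I_notcarr sub(3) by auto
    show "a \<in> P \<inter> B \<or> b \<in> P \<inter> B"
      if "a \<in> carrier (R\<lparr>carrier := B\<rparr>)" "b \<in> carrier (R\<lparr>carrier := B\<rparr>)"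
        "a \<otimes>\<^bsub>R\<lparr>carrier := B\<rparr>\<^esub> b \<in> P \<inter> B" for a b
      using that P.I_prime[of a b] sub(1) by auto
    show "x \<otimes>\<^bsub>R\<lparr>carrier := B\<rparr>\<^esub> a \<in> P \<inter> B" "a \<otimes>\<^bsub>R\<lparr>carrier := B\<rparr>\<^esub> x \<in> P \<inter> B"
      if "a \<in> P \<inter> B" "x \<in> carrier (R\<lparr>carrier := B\<rparr>)" for a x
      using that sub(1) P.I_l_closed[of a x] P.I_r_closed[of a x] sub(6)[of a x] sub(6)[of x a] by auto
  qed (rule B.is_cring)
qed

context krull_family
begin

text \<open>The divisibility criterion survives because a quotient formed in \<open>R\<close> of two elements of \<open>B\<close> lies
  in \<open>B\<close>.\<close>

lemma krull_family_subring:
  assumes B: "subring B R"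
    and sat: "\<And>y q. \<lbrakk>y \<in> B - {\<zero>}; q \<in> carrier R; y \<otimes> q \<in> B\<rbrakk> \<Longrightarrow> q \<in> B"
  shows "krull_family (R\<lparr>carrier := B\<rparr>) V"
proof -
  interpret B: domain "R\<lparr>carrier := B\<rparr>" using subring_is_domain[OF B] .
  note sub = subringE(1)[OF B]
  show ?thesis
  proof (unfold_locales, goal_cases)
    case (1 v x)
    then show ?case using val_nonneg[of v x] sub by auto
  next
    case (2 v x y)
    then show ?case using val_mult[of v x y] sub by auto
  next
    case (3 v x y)
    then show ?case using val_add[of v x y] sub by auto
  next
    case (4 x)
    then show ?case using finite_support[of x] sub by auto
  next
    case (5 x y)
    then have xy: "x \<in> carrier R - {\<zero>}" "y \<in> carrier R - {\<zero>}" using sub by auto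
    have "y divides x" using val_le_imp_divides[OF xy] 5(3) .
    then obtain q where "q \<in> carrier R" "x = y \<otimes> q" unfolding factor_def by blast
    then show ?case using sat[of y q] 5 unfolding factor_def by auto
  qed
qed

text \<open>The localisation at a prime \<open>p\<close> of height one is a valuation ring. Take an essential valuation for
  the complement of \<open>p\<close> and a nonzero element of \<open>p\<close>. Its center is a nonzero prime inside \<open>p\<close>, hence
  equal to \<open>p\<close>, so elements of value zero lie outside \<open>p\<close>.\<close>

lemma height_one_imp_valuation_ring:
  assumes p: "p \<in> Spec R" "height R p = 1"
    and ab: "a \<in> carrier R - {\<zero>}" "b \<in> carrier R - {\<zero>}"
  shows "\<exists>a'\<in>carrier R. \<exists>b'\<in>carrier R. a \<otimes> b' = a' \<otimes> b \<and> (a' \<notin> p \<or> b' \<notin> p)"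
proof -
  interpret p: primeideal p R using p by (simp add: Spec_def)
  have min: "p \<noteq> {\<zero>}" "\<And>Q. Q \<in> Spec R \<Longrightarrow> Q \<subseteq> p \<Longrightarrow> Q = {\<zero>} \<or> Q = p"
    using height_eq_1_iff[OF p(1)] p(2) by auto
  obtain f where f: "f \<in> p" "f \<noteq> \<zero>" using min(1) p.zero_closed by blast
  have fR: "f \<in> carrier R - {\<zero>}" using f p.Icarr by blast
  obtain w where w: "w \<in> V" "0 < w f" "\<And>x. x \<in> carrier R - p \<Longrightarrow> w x = 0"
    and dom: "\<And>x y. \<lbrakk>x \<in> carrier R - {\<zero>}; y \<in> carrier R - {\<zero>}; w x \<le> w y\<rbrakk>
      \<Longrightarrow> \<exists>x'\<in>carrier R - {\<zero>}. \<exists>y'\<in>carrier R. w x' = 0 \<and> x \<otimes> y' = x' \<otimes> y"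
  proof (rule ex_essential_valuation[OF fR, of "carrier R - p"])
    show "carrier R - p \<subseteq> carrier R - {\<zero>}" using p.zero_closed by blast
    show "\<one> \<in> carrier R - p" using p.one_imp_carrier p.I_notcarr by blast
    show "x \<otimes> y \<in> carrier R - p" if "x \<in> carrier R - p" "y \<in> carrier R - p" for x y
      using that p.I_prime by blast
    show "\<not> f divides x" if "x \<in> carrier R - p" for x
      using that f p.I_r_closed unfolding factor_def by blast
  qed blast
  have "center w \<subseteq> p"
  proof
    fix x assume x: "x \<in> center w"
    show "x \<in> p"
    proof (rule ccontr)
      assume "x \<notin> p"
      then have "w x = 0" "x \<noteq> \<zero>" using w(3)[of x] x p.zero_closed by (auto simp: center_def)
      then show False using x by (simp add: center_def)
    qed
  qed
  moreover have "center w \<noteq> {\<zero>}" using w(2) fR by (auto simp: center_def)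
  ultimately have cp: "center w = p" using min(2)[of "center w"] primeideal_center[OF w(1)] by (auto simp: Spec_def)
  have np: "x \<notin> p" if "x \<in> carrier R - {\<zero>}" "w x = 0" for x
    unfolding cp[symmetric] using that by (simp add: center_def)
  show ?thesis
  proof (cases "w a \<le> w b")
    case True
    then obtain a' b' where *: "a' \<in> carrier R - {\<zero>}" "b' \<in> carrier R" "w a' = 0" "a \<otimes> b' = a' \<otimes> b"
      using dom[OF ab] by blast
    then show ?thesis using np[OF *(1,3)] by blast
  next
    case False
    then obtain b' a' where *: "b' \<in> carrier R - {\<zero>}" "a' \<in> carrier R" "w b' = 0" "b \<otimes> a' = b' \<otimes> a"
      using dom[OF ab(2,1)] by auto
    then have "a \<otimes> b' = a' \<otimes> b" using ab m_comm[of a b'] m_comm[of a' b] by simp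
    then show ?thesis using np[OF *(1,3)] * by blast
  qed
qed

text \<open>An element \<open>f\<close> of \<open>p\<close> divides no element of \<open>B - p\<close>, even in \<open>R\<close>, because \<open>B\<close> is closed under
  exact division. An essential valuation of \<open>R\<close> for \<open>f\<close> and \<open>B - p\<close> has as center a prime of \<open>R\<close>
  whose contraction is nonzero and inside \<open>p\<close>, hence is \<open>p\<close>. The center has height one because all
  its nonzero elements divide a power of one another up to elements outside it.\<close>

theorem ex_height_one_prime_over:
  assumes B: "subring B R"
    and sat: "\<And>y q. \<lbrakk>y \<in> B - {\<zero>}; q \<in> carrier R; y \<otimes> q \<in> B\<rbrakk> \<Longrightarrow> q \<in> B"
    and p: "p \<in> Spec (R\<lparr>carrier := B\<rparr>)" "height (R\<lparr>carrier := B\<rparr>) p = 1"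
  obtains P where "P \<in> Spec R" "height R P = 1" "P \<inter> B = p"
proof -
  interpret B: domain "R\<lparr>carrier := B\<rparr>" using subring_is_domain[OF B] .
  interpret p: primeideal p "R\<lparr>carrier := B\<rparr>" using p by (simp add: Spec_def)
  have min: "p \<noteq> {\<zero>}" "\<And>Q. Q \<in> Spec (R\<lparr>carrier := B\<rparr>) \<Longrightarrow> Q \<subseteq> p \<Longrightarrow> Q = {\<zero>} \<or> Q = p"
    using B.height_eq_1_iff[OF p(1)] p(2) by auto
  have pB: "p \<subseteq> B" using p.Icarr by auto
  note BR = subringE(1)[OF B]
  obtain f where f: "f \<in> p" "f \<noteq> \<zero>" using min(1) p.zero_closed by auto
  have fR: "f \<in> carrier R - {\<zero>}" using f pB BR by blast
  obtain w where w: "w \<in> V" "0 < w f" "\<And>x. x \<in> B - p \<Longrightarrow> w x = 0"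
    and dom: "\<And>x y. \<lbrakk>x \<in> carrier R - {\<zero>}; y \<in> carrier R - {\<zero>}; w x \<le> w y\<rbrakk>
      \<Longrightarrow> \<exists>x'\<in>carrier R - {\<zero>}. \<exists>y'\<in>carrier R. w x' = 0 \<and> x \<otimes> y' = x' \<otimes> y"
  proof (rule ex_essential_valuation[OF fR, of "B - p"])
    show "B - p \<subseteq> carrier R - {\<zero>}" using p.zero_closed BR by auto
    show "\<one> \<in> B - p" using p.one_imp_carrier p.I_notcarr subringE(3)[OF B] by auto
    show "x \<otimes> y \<in> B - p" if "x \<in> B - p" "y \<in> B - p" for x y
      using that p.I_prime[of x y] subringE(6)[OF B] by auto
    show "\<not> f divides x" if x: "x \<in> B - p" for x
    proof
      assume "f divides x"
      then obtain q where q: "q \<in> carrier R" "x = f \<otimes> q" unfolding factor_def by blast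
      then have "q \<in> B" using sat[of f q] f pB x by auto
      then show False using p.I_r_closed[of f q] f q x by auto
    qed
  qed blast
  have cp: "primeideal (center w) R" using primeideal_center[OF w(1)] .
  interpret P: primeideal "center w" R by (rule cp)
  have spec: "center w \<in> Spec R" using cp by (simp add: Spec_def)
  have fP: "f \<in> center w" unfolding center_def using w(2) fR by blast
  have "center w \<inter> B \<subseteq> p"
  proof
    fix x assume x: "x \<in> center w \<inter> B"
    show "x \<in> p"
    proof (rule ccontr)
      assume "x \<notin> p"
      then have wx: "w x = 0" using w(3)[of x] x by blast
      have "\<zero> \<in> p" using p.zero_closed by simp
      then have "x \<noteq> \<zero>" using \<open>x \<notin> p\<close> by blast
      then have "0 < w x" using x unfolding center_def by blast
      then show False using wx by linarith
    qed
  qed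
  moreover have "center w \<inter> B \<noteq> {\<zero>}" using fP f pB by blast
  moreover have "center w \<inter> B \<in> Spec (R\<lparr>carrier := B\<rparr>)"
    using primeideal_contract[OF B cp] by (simp add: Spec_def)
  ultimately have contr: "center w \<inter> B = p" using min(2)[of "center w \<inter> B"] by blast
  have "Q = {\<zero>} \<or> Q = center w" if Q: "Q \<in> Spec R" "Q \<subseteq> center w" for Q
  proof (cases "Q = {\<zero>}")
    case False
    interpret Q: primeideal Q R using Q by (simp add: Spec_def)
    obtain y where y: "y \<in> Q" "y \<noteq> \<zero>" using False Q.zero_closed by blast
    have yR: "y \<in> carrier R - {\<zero>}" using y Q.Icarr by blast
    have wy: "0 < w y" using y Q(2) unfolding center_def by blast
    \<comment> \<open>A power of \<open>z\<close> dominates \<open>y\<close> at \<open>w\<close>, hence is a multiple of \<open>y\<close> up to a denominator outside \<open>Q\<close>.\<close>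
    have "z \<in> Q" if z: "z \<in> center w" for z
    proof (cases "z = \<zero>")
      case False
      then have zR: "z \<in> carrier R - {\<zero>}" and wz: "0 < w z" using z unfolding center_def by blast+
      define k where "k = nat (w y)"
      have "int k * 1 \<le> int k * w z" using wz by (intro mult_left_mono) auto
      then have "w y \<le> w (z [^] k)" using val_pow[OF w(1) zR, of k] wy by (simp add: k_def)
      then obtain x' y' where *: "x' \<in> carrier R - {\<zero>}" "y' \<in> carrier R" "w x' = 0" "y \<otimes> y' = x' \<otimes> z [^] k"
        using dom[OF yR pow_nonzero[OF zR]] by blast
      have "x' \<notin> center w" unfolding center_def using *(1,3) by simp
      then have "x' \<notin> Q" using Q(2) by blast
      moreover have "x' \<otimes> z [^] k \<in> Q" using Q.I_r_closed[OF y(1) *(2)] *(4) by simp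
      ultimately have "z [^] k \<in> Q" using Q.I_prime[of x' "z [^] k"] * zR by auto
      then show "z \<in> Q" using Q.pow_mem_imp_mem zR by blast
    qed (use Q.zero_closed in simp)
    then show ?thesis using Q(2) by blast
  qed simp
  then have "height R (center w) = 1"
    using height_eq_1_iff[OF spec] fP f by auto
  then show thesis using that spec contr by blast
qed

end

section \<open>Linear relations over algebraically closed fields\<close>

lemma (in algebraically_closed) ex_root:
  assumes "set cs \<subseteq> carrier L" "c \<in> carrier L - {\<zero>}" "cs \<noteq> []"
  shows "\<exists>x\<in>carrier L. eval (c # cs) x = \<zero>"
proof -
  have p: "c # cs \<in> carrier (poly_ring L)"
    using assms by (auto simp: sym[OF univ_poly_carrier] polynomial_def)
  then have "size (roots (c # cs)) = degree (c # cs)"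
    using roots_over_carrier[OF p] by (simp add: splitted_def)
  then have "roots (c # cs) \<noteq> {#}" using assms(3) by auto
  then obtain x where "x \<in># roots (c # cs)" by blast
  then have "is_root (c # cs) x" using roots_mem_iff_is_root[OF p] by simp
  then show ?thesis by (auto simp: is_root_def)
qed

lemma (in algebraically_closed) ex_nth_root:
  assumes "a \<in> carrier L" "0 < n"
  shows "\<exists>x\<in>carrier L. x [^] (n::nat) = a"
proof -
  obtain m where n: "n = Suc m" using assms(2) gr0_conv_Suc by blast
  have "\<exists>x\<in>carrier L. eval (\<one> # (replicate m \<zero> @ [\<ominus> a])) x = \<zero>"
    by (rule ex_root) (use assms in auto)
  then obtain x where x: "x \<in> carrier L" "eval (monom \<one> m @ [\<ominus> a]) x = \<zero>"
    by (auto simp: monom_def)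
  then have "x [^] n \<oplus> \<ominus> a = \<zero>"
    using eval_append_aux[of "monom \<one> m" "\<ominus> a" x] eval_monom[of \<one> x m] assms n
      monom_in_carrier[of \<one> m] by simp
  then have "x [^] n = a" using x assms by (metis a_inv_closed minus_equality minus_minus nat_pow_closed)
  then show ?thesis using x by blast
qed

text \<open>Gaussian elimination by induction on \<open>n\<close>: a pivot vector \<open>u j\<close> with a nonzero last coordinate
  clears the last coordinate of all others.\<close>

lemma (in module) ex_linear_dependence:
  assumes field: "field R"
    and v: "\<And>i. i < n \<Longrightarrow> v i \<in> carrier M"
  shows "\<lbrakk>finite I; n < card I;
      \<And>k. k \<in> I \<Longrightarrow> (\<forall>i<n. x k i \<in> carrier R) \<and> u k = (\<Oplus>\<^bsub>M\<^esub>i\<in>{..<n}. x k i \<odot>\<^bsub>M\<^esub> v i)\<rbrakk>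
    \<Longrightarrow> \<exists>c. (\<forall>k\<in>I. c k \<in> carrier R) \<and> (\<exists>k\<in>I. c k \<noteq> \<zero>) \<and> (\<Oplus>\<^bsub>M\<^esub>k\<in>I. c k \<odot>\<^bsub>M\<^esub> u k) = \<zero>\<^bsub>M\<^esub>"
  using v
proof (induction n arbitrary: I x u)
  case 0
  interpret field R by fact
  have "(\<Oplus>\<^bsub>M\<^esub>k\<in>I. \<one> \<odot>\<^bsub>M\<^esub> u k) = (\<Oplus>\<^bsub>M\<^esub>k\<in>I. \<zero>\<^bsub>M\<^esub>)"
    by (rule M.finsum_cong') (use 0 in auto)
  moreover have "I \<noteq> {}" using 0 by auto
  ultimately show ?case by (intro exI[of _ "\<lambda>_. \<one>"]) auto
next
  case (Suc n)
  interpret field R by fact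
  have v: "v \<in> {..<n} \<rightarrow> carrier M" "v n \<in> carrier M" using Suc.prems(4) by auto
  have x: "\<And>k i. k \<in> I \<Longrightarrow> i \<le> n \<Longrightarrow> x k i \<in> carrier R" using Suc.prems(3) by auto
  have sum: "(\<Oplus>\<^bsub>M\<^esub>i\<in>{..<n}. y i \<odot>\<^bsub>M\<^esub> v i) \<in> carrier M" if "\<And>i. i < n \<Longrightarrow> y i \<in> carrier R" for y
    using that v by (intro M.finsum_closed) auto
  have uS: "u k = x k n \<odot>\<^bsub>M\<^esub> v n \<oplus>\<^bsub>M\<^esub> (\<Oplus>\<^bsub>M\<^esub>i\<in>{..<n}. x k i \<odot>\<^bsub>M\<^esub> v i)" if "k \<in> I" for k
    using Suc.prems(3)[OF that] v by (simp add: lessThan_Suc M.finsum_insert Pi_iff)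
  have uM: "u k \<in> carrier M" if "k \<in> I" for k
    unfolding uS[OF that] using x[OF that] v sum[of "x k"] by simp
  show ?case
  proof (cases "\<forall>k\<in>I. x k n = \<zero>")
    case True
    have "(\<forall>i<n. x k i \<in> carrier R) \<and> u k = (\<Oplus>\<^bsub>M\<^esub>i\<in>{..<n}. x k i \<odot>\<^bsub>M\<^esub> v i)" if "k \<in> I" for k
      using uS[OF that] that True x[OF that] v sum[of "x k"] by simp
    then show ?thesis using Suc.IH[of I x u] Suc.prems by auto
  next
    case False
    then obtain j where j: "j \<in> I" "x j n \<noteq> \<zero>" by blast
    define t where "t k = \<ominus> (x k n \<otimes> inv (x j n))" for k
    define u' where "u' k = u k \<oplus>\<^bsub>M\<^esub> t k \<odot>\<^bsub>M\<^esub> u j" for k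
    define x' where "x' k i = x k i \<oplus> t k \<otimes> x j i" for k i
    have ij: "inv (x j n) \<in> carrier R" "inv (x j n) \<otimes> x j n = \<one>"
      using j x[OF j(1), of n] field_Units by auto
    have t: "t k \<in> carrier R" if "k \<in> I" for k using x[OF that, of n] ij by (simp add: t_def)
    have x'R: "x' k i \<in> carrier R" if "k \<in> I" "i \<le> n" for k i
      using x[OF that] x[OF j(1) that(2)] t[OF that(1)] by (simp add: x'_def)
    have x'0: "x' k n = \<zero>" if "k \<in> I" for k
    proof -
      have "t k \<otimes> x j n = \<ominus> (x k n \<otimes> (inv (x j n) \<otimes> x j n))"
        unfolding t_def using x[OF that, of n] x[OF j(1), of n] ij by (simp add: l_minus m_assoc)
      then show ?thesis unfolding x'_def using x[OF that, of n] ij by (simp add: R.r_neg)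
    qed
    have "u' k = (\<Oplus>\<^bsub>M\<^esub>i\<in>{..<n}. x' k i \<odot>\<^bsub>M\<^esub> v i)" if k: "k \<in> I" for k
    proof -
      have "u' k = (\<Oplus>\<^bsub>M\<^esub>i\<in>{..<Suc n}. x k i \<odot>\<^bsub>M\<^esub> v i) \<oplus>\<^bsub>M\<^esub> t k \<odot>\<^bsub>M\<^esub> (\<Oplus>\<^bsub>M\<^esub>i\<in>{..<Suc n}. x j i \<odot>\<^bsub>M\<^esub> v i)"
        unfolding u'_def using Suc.prems(3)[OF k] Suc.prems(3)[OF j(1)] by simp
      also have "\<dots> = (\<Oplus>\<^bsub>M\<^esub>i\<in>{..<Suc n}. x k i \<odot>\<^bsub>M\<^esub> v i) \<oplus>\<^bsub>M\<^esub> (\<Oplus>\<^bsub>M\<^esub>i\<in>{..<Suc n}. t k \<odot>\<^bsub>M\<^esub> (x j i \<odot>\<^bsub>M\<^esub> v i))"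
        using x[OF j(1)] Suc.prems(4) t[OF k] by (subst finsum_smult_ldistr) auto
      also have "\<dots> = (\<Oplus>\<^bsub>M\<^esub>i\<in>{..<Suc n}. x k i \<odot>\<^bsub>M\<^esub> v i \<oplus>\<^bsub>M\<^esub> t k \<odot>\<^bsub>M\<^esub> (x j i \<odot>\<^bsub>M\<^esub> v i))"
        using x[OF j(1)] x[OF k] Suc.prems(4) t[OF k] by (subst M.finsum_addf) auto
      also have "\<dots> = (\<Oplus>\<^bsub>M\<^esub>i\<in>{..<Suc n}. x' k i \<odot>\<^bsub>M\<^esub> v i)"
        using x[OF j(1)] x[OF k] Suc.prems(4) t[OF k]
        by (intro M.finsum_cong') (auto simp: x'_def smult_l_distr smult_assoc1)
      also have "\<dots> = x' k n \<odot>\<^bsub>M\<^esub> v n \<oplus>\<^bsub>M\<^esub> (\<Oplus>\<^bsub>M\<^esub>i\<in>{..<n}. x' k i \<odot>\<^bsub>M\<^esub> v i)"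
        using x'R[OF k] v by (simp add: lessThan_Suc M.finsum_insert Pi_iff)
      also have "\<dots> = (\<Oplus>\<^bsub>M\<^esub>i\<in>{..<n}. x' k i \<odot>\<^bsub>M\<^esub> v i)"
        using x'0[OF k] v sum[of "x' k"] x'R[OF k] by simp
      finally show ?thesis .
    qed
    then have "\<exists>c. (\<forall>k\<in>I - {j}. c k \<in> carrier R) \<and> (\<exists>k\<in>I - {j}. c k \<noteq> \<zero>) \<and>
        (\<Oplus>\<^bsub>M\<^esub>k\<in>I - {j}. c k \<odot>\<^bsub>M\<^esub> u' k) = \<zero>\<^bsub>M\<^esub>"
      using Suc.prems j x'R by (intro Suc.IH[of "I - {j}" x' u']) auto
    then obtain c where c: "\<And>k. k \<in> I - {j} \<Longrightarrow> c k \<in> carrier R" "\<exists>k\<in>I - {j}. c k \<noteq> \<zero>"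
      and c0: "(\<Oplus>\<^bsub>M\<^esub>k\<in>I - {j}. c k \<odot>\<^bsub>M\<^esub> u' k) = \<zero>\<^bsub>M\<^esub>" by blast
    define s where "s = (\<Oplus>k\<in>I - {j}. c k \<otimes> t k)"
    have sR: "s \<in> carrier R" unfolding s_def using c t by (intro R.finsum_closed) auto
    have lsum: "(\<Oplus>\<^bsub>M\<^esub>k\<in>J. y k \<odot>\<^bsub>M\<^esub> a) = (\<Oplus>k\<in>J. y k) \<odot>\<^bsub>M\<^esub> a"
      if "finite J" "a \<in> carrier M" "\<And>k. k \<in> J \<Longrightarrow> y k \<in> carrier R" for J y a
      using that
    proof (induction J rule: finite_induct)
      case (insert i J)
      then show ?case by (simp add: M.finsum_insert R.finsum_insert Pi_iff smult_l_distr R.finsum_closed)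
    qed simp
    have fin: "finite (I - {j})" using Suc.prems(1) by simp
    have "\<zero>\<^bsub>M\<^esub> = (\<Oplus>\<^bsub>M\<^esub>k\<in>I - {j}. c k \<odot>\<^bsub>M\<^esub> u k \<oplus>\<^bsub>M\<^esub> (c k \<otimes> t k) \<odot>\<^bsub>M\<^esub> u j)"
      unfolding c0[symmetric] using c t uM j
      by (intro M.finsum_cong') (auto simp: u'_def smult_r_distr smult_assoc1)
    also have "\<dots> = (\<Oplus>\<^bsub>M\<^esub>k\<in>I - {j}. c k \<odot>\<^bsub>M\<^esub> u k) \<oplus>\<^bsub>M\<^esub> (\<Oplus>\<^bsub>M\<^esub>k\<in>I - {j}. (c k \<otimes> t k) \<odot>\<^bsub>M\<^esub> u j)"
      using c t uM j by (intro M.finsum_addf) auto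
    also have "(\<Oplus>\<^bsub>M\<^esub>k\<in>I - {j}. (c k \<otimes> t k) \<odot>\<^bsub>M\<^esub> u j) = s \<odot>\<^bsub>M\<^esub> u j"
      unfolding s_def using lsum[OF fin uM[OF j(1)], of "\<lambda>k. c k \<otimes> t k"] c t by auto
    also have "(\<Oplus>\<^bsub>M\<^esub>k\<in>I - {j}. c k \<odot>\<^bsub>M\<^esub> u k) = (\<Oplus>\<^bsub>M\<^esub>k\<in>I - {j}. (c(j := s)) k \<odot>\<^bsub>M\<^esub> u k)"
      using c uM by (intro M.finsum_cong') auto
    also have "\<dots> \<oplus>\<^bsub>M\<^esub> s \<odot>\<^bsub>M\<^esub> u j = (\<Oplus>\<^bsub>M\<^esub>k\<in>insert j (I - {j}). (c(j := s)) k \<odot>\<^bsub>M\<^esub> u k)"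
      using fin c uM j sR by (subst M.finsum_insert) (auto intro!: M.a_comm M.finsum_closed)
    finally have "(\<Oplus>\<^bsub>M\<^esub>k\<in>I. (c(j := s)) k \<odot>\<^bsub>M\<^esub> u k) = \<zero>\<^bsub>M\<^esub>" using j by (simp add: insert_absorb)
    then show ?thesis using c sR by (intro exI[of _ "c(j := s)"]) auto
  qed
qed

text \<open>A list of scalars stands for a polynomial, leading coefficient first. If \<open>u k\<close> is the \<open>k\<close>-th iterate
  of a linear operator at a vector, \<open>lincomb\<close> is the polynomial in that operator applied to the vector.\<close>

primrec lincomb :: "('k, 'r, 'm) module_scheme \<Rightarrow> 'k list \<Rightarrow> (nat \<Rightarrow> 'r) \<Rightarrow> 'r" where
  "lincomb M [] u = \<zero>\<^bsub>M\<^esub>"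
| "lincomb M (c # cs) u = c \<odot>\<^bsub>M\<^esub> u (length cs) \<oplus>\<^bsub>M\<^esub> lincomb M cs u"

text \<open>The homogenisation of degree \<open>length cs - 1\<close> of the polynomial \<open>cs\<close> at \<open>(g, h)\<close>. It is the value
  of \<open>cs\<close> at the fraction \<open>g / h\<close> with denominators cleared.\<close>

primrec homogeneous_eval :: "('k, 'r, 'm) module_scheme \<Rightarrow> 'k list \<Rightarrow> 'r \<Rightarrow> 'r \<Rightarrow> 'r" where
  "homogeneous_eval M [] g h = \<zero>\<^bsub>M\<^esub>"
| "homogeneous_eval M (c # cs) g h = c \<odot>\<^bsub>M\<^esub> g [^]\<^bsub>M\<^esub> length cs \<oplus>\<^bsub>M\<^esub> h \<otimes>\<^bsub>M\<^esub> homogeneous_eval M cs g h"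

context algebra
begin

lemma smult_assoc3: "\<lbrakk>a \<in> carrier R; x \<in> carrier M; y \<in> carrier M\<rbrakk> \<Longrightarrow> x \<otimes>\<^bsub>M\<^esub> (a \<odot>\<^bsub>M\<^esub> y) = a \<odot>\<^bsub>M\<^esub> (x \<otimes>\<^bsub>M\<^esub> y)"
  using smult_assoc2[of a y x] by (simp add: m_comm)

lemma lincomb_closed: "\<lbrakk>set cs \<subseteq> carrier R; \<And>k. u k \<in> carrier M\<rbrakk> \<Longrightarrow> lincomb M cs u \<in> carrier M"
  by (induction cs) auto

lemma lincomb_snoc:
  "\<lbrakk>set cs \<subseteq> carrier R; c \<in> carrier R; \<And>k. u k \<in> carrier M\<rbrakk>
   \<Longrightarrow> lincomb M (cs @ [c]) u = lincomb M cs (u \<circ> Suc) \<oplus>\<^bsub>M\<^esub> c \<odot>\<^bsub>M\<^esub> u 0"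
  by (induction cs) (auto simp: lincomb_closed M.a_assoc)

lemma lincomb_eq_finsum:
  assumes "\<And>k. k < n \<Longrightarrow> c k \<in> carrier R" "\<And>k. u k \<in> carrier M"
  shows "lincomb M (map c (rev [0..<n])) u = (\<Oplus>\<^bsub>M\<^esub>k\<in>{..<n}. c k \<odot>\<^bsub>M\<^esub> u k)"
  using assms by (induction n) (auto simp: lessThan_Suc M.finsum_insert Pi_iff)

lemma homogeneous_eval_closed:
  "\<lbrakk>set cs \<subseteq> carrier R; g \<in> carrier M; h \<in> carrier M\<rbrakk> \<Longrightarrow> homogeneous_eval M cs g h \<in> carrier M"
  by (induction cs) auto

lemma homogeneous_eval_snoc:
  assumes gh: "g \<in> carrier M" "h \<in> carrier M"
  shows "\<lbrakk>set cs \<subseteq> carrier R; c \<in> carrier R\<rbrakk> \<Longrightarrow>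
    homogeneous_eval M (cs @ [c]) g h =
      g \<otimes>\<^bsub>M\<^esub> homogeneous_eval M cs g h \<oplus>\<^bsub>M\<^esub> c \<odot>\<^bsub>M\<^esub> h [^]\<^bsub>M\<^esub> length cs"
proof (induction cs)
  case (Cons a cs)
  have H: "homogeneous_eval M cs g h \<in> carrier M" using Cons.prems gh homogeneous_eval_closed by simp
  have "homogeneous_eval M ((a # cs) @ [c]) g h = a \<odot>\<^bsub>M\<^esub> (g [^]\<^bsub>M\<^esub> length cs \<otimes>\<^bsub>M\<^esub> g) \<oplus>\<^bsub>M\<^esub>
      h \<otimes>\<^bsub>M\<^esub> (g \<otimes>\<^bsub>M\<^esub> homogeneous_eval M cs g h \<oplus>\<^bsub>M\<^esub> c \<odot>\<^bsub>M\<^esub> h [^]\<^bsub>M\<^esub> length cs)"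
    using Cons by simp
  also have "a \<odot>\<^bsub>M\<^esub> (g [^]\<^bsub>M\<^esub> length cs \<otimes>\<^bsub>M\<^esub> g) = g \<otimes>\<^bsub>M\<^esub> (a \<odot>\<^bsub>M\<^esub> g [^]\<^bsub>M\<^esub> length cs)"
    using Cons.prems gh by (simp add: smult_assoc3 m_comm)
  also have "h \<otimes>\<^bsub>M\<^esub> (g \<otimes>\<^bsub>M\<^esub> homogeneous_eval M cs g h \<oplus>\<^bsub>M\<^esub> c \<odot>\<^bsub>M\<^esub> h [^]\<^bsub>M\<^esub> length cs)
     = g \<otimes>\<^bsub>M\<^esub> (h \<otimes>\<^bsub>M\<^esub> homogeneous_eval M cs g h) \<oplus>\<^bsub>M\<^esub> c \<odot>\<^bsub>M\<^esub> h [^]\<^bsub>M\<^esub> Suc (length cs)"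
    using Cons.prems gh H by (simp add: r_distr smult_assoc3 m_ac)
  finally show ?case using Cons.prems gh H by (simp add: r_distr M.a_assoc)
qed (use gh in simp)

text \<open>Horner's scheme: the coefficients \<open>ds\<close> of the quotient are the values at \<open>l\<close> of the initial
  segments of \<open>c # cs\<close>, and the remainder is the value of the whole list.\<close>

lemma homogeneous_eval_synthetic_division:
  assumes gh: "g \<in> carrier M" "h \<in> carrier M" and l: "l \<in> carrier R"
  shows "\<lbrakk>set cs \<subseteq> carrier R; c \<in> carrier R\<rbrakk> \<Longrightarrow>
    \<exists>ds. set ds \<subseteq> carrier R \<and> length ds = length cs \<and> (cs \<noteq> [] \<longrightarrow> hd ds = c) \<and>
      homogeneous_eval M (c # cs) g h =
        (g \<ominus>\<^bsub>M\<^esub> l \<odot>\<^bsub>M\<^esub> h) \<otimes>\<^bsub>M\<^esub> homogeneous_eval M ds g h \<oplus>\<^bsub>M\<^esub> R.eval (c # cs) l \<odot>\<^bsub>M\<^esub> h [^]\<^bsub>M\<^esub> length cs"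
proof (induction cs rule: rev_induct)
  case Nil
  then show ?case using gh l by (intro exI[of _ "[]"]) simp
next
  case (snoc a cs)
  then obtain ds where ds: "set ds \<subseteq> carrier R" "length ds = length cs" "cs \<noteq> [] \<longrightarrow> hd ds = c"
    and eq: "homogeneous_eval M (c # cs) g h =
        (g \<ominus>\<^bsub>M\<^esub> l \<odot>\<^bsub>M\<^esub> h) \<otimes>\<^bsub>M\<^esub> homogeneous_eval M ds g h \<oplus>\<^bsub>M\<^esub> R.eval (c # cs) l \<odot>\<^bsub>M\<^esub> h [^]\<^bsub>M\<^esub> length cs"
    by auto
  define e where "e = R.eval (c # cs) l"
  have sub: "set (c # cs) \<subseteq> carrier R" "a \<in> carrier R" using snoc.prems by auto
  have e: "e \<in> carrier R" unfolding e_def using R.eval_in_carrier[OF sub(1) l] .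
  define D where "D = homogeneous_eval M ds g h"
  have D: "D \<in> carrier M" unfolding D_def using homogeneous_eval_closed ds gh by simp
  define H where "H = h [^]\<^bsub>M\<^esub> length cs"
  have H: "H \<in> carrier M" using gh by (simp add: H_def)
  define G where "G = g \<ominus>\<^bsub>M\<^esub> l \<odot>\<^bsub>M\<^esub> h"
  have G: "G \<in> carrier M" using gh l by (simp add: G_def)
  have g: "g = G \<oplus>\<^bsub>M\<^esub> l \<odot>\<^bsub>M\<^esub> h" using gh l unfolding G_def by (simp add: M.minus_eq M.a_assoc M.l_neg)
  have "homogeneous_eval M (c # cs @ [a]) g h
      = g \<otimes>\<^bsub>M\<^esub> (G \<otimes>\<^bsub>M\<^esub> D \<oplus>\<^bsub>M\<^esub> e \<odot>\<^bsub>M\<^esub> H) \<oplus>\<^bsub>M\<^esub> a \<odot>\<^bsub>M\<^esub> (H \<otimes>\<^bsub>M\<^esub> h)"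
    using homogeneous_eval_snoc[OF gh sub] eq unfolding e_def D_def H_def G_def by simp
  also have "\<dots> = G \<otimes>\<^bsub>M\<^esub> (g \<otimes>\<^bsub>M\<^esub> D) \<oplus>\<^bsub>M\<^esub> e \<odot>\<^bsub>M\<^esub> (g \<otimes>\<^bsub>M\<^esub> H) \<oplus>\<^bsub>M\<^esub> a \<odot>\<^bsub>M\<^esub> (H \<otimes>\<^bsub>M\<^esub> h)"
    using gh G D H e sub by (simp add: r_distr smult_assoc3 m_ac)
  also have "g \<otimes>\<^bsub>M\<^esub> H = G \<otimes>\<^bsub>M\<^esub> H \<oplus>\<^bsub>M\<^esub> l \<odot>\<^bsub>M\<^esub> (H \<otimes>\<^bsub>M\<^esub> h)"
    using G H gh l by (subst g) (simp add: l_distr smult_assoc2 m_comm[of h H])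
  also have "G \<otimes>\<^bsub>M\<^esub> (g \<otimes>\<^bsub>M\<^esub> D) \<oplus>\<^bsub>M\<^esub> e \<odot>\<^bsub>M\<^esub> (G \<otimes>\<^bsub>M\<^esub> H \<oplus>\<^bsub>M\<^esub> l \<odot>\<^bsub>M\<^esub> (H \<otimes>\<^bsub>M\<^esub> h)) \<oplus>\<^bsub>M\<^esub> a \<odot>\<^bsub>M\<^esub> (H \<otimes>\<^bsub>M\<^esub> h)
     = G \<otimes>\<^bsub>M\<^esub> (g \<otimes>\<^bsub>M\<^esub> D \<oplus>\<^bsub>M\<^esub> e \<odot>\<^bsub>M\<^esub> H) \<oplus>\<^bsub>M\<^esub> (e \<otimes> l \<oplus> a) \<odot>\<^bsub>M\<^esub> (H \<otimes>\<^bsub>M\<^esub> h)"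
    using gh G D H e sub l
    by (simp add: r_distr smult_assoc3 smult_r_distr smult_l_distr smult_assoc1 M.a_ac)
  also have "g \<otimes>\<^bsub>M\<^esub> D \<oplus>\<^bsub>M\<^esub> e \<odot>\<^bsub>M\<^esub> H = homogeneous_eval M (ds @ [e]) g h"
    unfolding D_def H_def ds(2)[symmetric] using homogeneous_eval_snoc[OF gh ds(1) e] by simp
  also have "e \<otimes> l \<oplus> a = R.eval (c # cs @ [a]) l"
    unfolding e_def using R.eval_append_aux[OF sub l] by simp
  finally show ?case
    unfolding G_def H_def
    using ds e snoc.prems by (intro exI[of _ "ds @ [e]"]) (auto simp: e_def hd_append)
qed

text \<open>In the domain \<open>M / P\<close> the fraction \<open>g / h\<close> is algebraic over the algebraically closed field of
  scalars, so it is itself a scalar \<open>l\<close>. Linear factors are split off until one of them lies in \<open>P\<close>.\<close>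

lemma homogeneous_root:
  assumes K: "algebraically_closed R" and P: "primeideal P M"
    and gh: "g \<in> carrier M" "h \<in> carrier M - P"
  shows "\<lbrakk>set cs \<subseteq> carrier R; \<not> set cs \<subseteq> {\<zero>}; homogeneous_eval M cs g h \<in> P\<rbrakk>
    \<Longrightarrow> \<exists>l\<in>carrier R. g \<ominus>\<^bsub>M\<^esub> l \<odot>\<^bsub>M\<^esub> h \<in> P"
proof (induction "length cs" arbitrary: cs)
  case (Suc n)
  interpret K: algebraically_closed R by fact
  interpret P: primeideal P M by fact
  have h: "h \<in> carrier M" "h \<notin> P" using gh by auto
  obtain c ds where cs: "cs = c # ds" "length ds = n" using Suc.hyps(2) by (cases cs) auto
  have mem: "c \<in> carrier R" "set ds \<subseteq> carrier R" using Suc.prems cs by auto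
  have dsM: "homogeneous_eval M ds g h \<in> carrier M" using homogeneous_eval_closed mem gh h by simp
  show ?case
  proof (cases "c = \<zero>")
    case True
    then have "h \<otimes>\<^bsub>M\<^esub> homogeneous_eval M ds g h \<in> P" using Suc.prems(3) cs gh h dsM by simp
    then have "homogeneous_eval M ds g h \<in> P" using P.I_prime[OF h(1) dsM] h by blast
    then show ?thesis using Suc.hyps(1)[of ds] cs mem Suc.prems(2) True by auto
  next
    case False
    have "ds \<noteq> []"
    proof
      assume "ds = []"
      then have c1: "c \<odot>\<^bsub>M\<^esub> \<one>\<^bsub>M\<^esub> \<in> P" using Suc.prems(3) cs h mem by simp
      have "(inv c \<odot>\<^bsub>M\<^esub> \<one>\<^bsub>M\<^esub>) \<otimes>\<^bsub>M\<^esub> (c \<odot>\<^bsub>M\<^esub> \<one>\<^bsub>M\<^esub>) \<in> P"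
        using P.I_l_closed[OF c1] K.field_Units False mem by simp
      moreover have "(inv c \<odot>\<^bsub>M\<^esub> \<one>\<^bsub>M\<^esub>) \<otimes>\<^bsub>M\<^esub> (c \<odot>\<^bsub>M\<^esub> \<one>\<^bsub>M\<^esub>) = \<one>\<^bsub>M\<^esub>"
        using K.field_Units False mem by (simp add: smult_assoc2 smult_assoc3 smult_assoc1[symmetric])
      ultimately show False using P.one_imp_carrier P.I_notcarr by simp
    qed
    then obtain l where l: "l \<in> carrier R" "R.eval (c # ds) l = \<zero>"
      using K.ex_root[of ds c] mem False by auto
    obtain es where es: "set es \<subseteq> carrier R" "length es = length ds" "ds \<noteq> [] \<longrightarrow> hd es = c"
      "homogeneous_eval M (c # ds) g h =
        (g \<ominus>\<^bsub>M\<^esub> l \<odot>\<^bsub>M\<^esub> h) \<otimes>\<^bsub>M\<^esub> homogeneous_eval M es g h \<oplus>\<^bsub>M\<^esub> R.eval (c # ds) l \<odot>\<^bsub>M\<^esub> h [^]\<^bsub>M\<^esub> length ds"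
      using homogeneous_eval_synthetic_division[OF gh(1) h(1) l(1) mem(2,1)] by blast
    have esM: "homogeneous_eval M es g h \<in> carrier M" using homogeneous_eval_closed es gh h by simp
    have "(g \<ominus>\<^bsub>M\<^esub> l \<odot>\<^bsub>M\<^esub> h) \<otimes>\<^bsub>M\<^esub> homogeneous_eval M es g h \<in> P"
      using es(4) l Suc.prems(3) cs(1) h gh esM by simp
    then consider "g \<ominus>\<^bsub>M\<^esub> l \<odot>\<^bsub>M\<^esub> h \<in> P" | "homogeneous_eval M es g h \<in> P"
      using P.I_prime[OF M.minus_closed[OF gh(1) smult_closed[OF l(1) h(1)]] esM] by blast
    then show ?thesis
    proof cases
      case 2
      have "c \<in> set es" using es \<open>ds \<noteq> []\<close> by (metis hd_in_set length_0_conv)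
      then show ?thesis using Suc.hyps(1)[of es] es cs 2 False by auto
    qed (use l in blast)
  qed
qed simp

end

section \<open>Characters of tori\<close>

primrec monomial :: "('k, 'm) ring_scheme \<Rightarrow> nat \<Rightarrow> (nat \<Rightarrow> int) \<Rightarrow> (nat \<Rightarrow> 'k) \<Rightarrow> 'k" where
  "monomial K 0 a x = \<one>\<^bsub>K\<^esub>"
| "monomial K (Suc n) a x = monomial K n a x \<otimes>\<^bsub>K\<^esub> (x n [^]\<^bsub>mult_of K\<^esub> a n)"

context field
begin

lemma comm_group_mult_of: "comm_group (mult_of R)"
  using units_comm_group by (simp add: Ring_Divisibility.mult_of_def units_of_def field_Units)

interpretation U: comm_group "mult_of R" by (rule comm_group_mult_of)

lemma monomial_closed: "(\<And>i. i < n \<Longrightarrow> x i \<in> carrier R - {\<zero>}) \<Longrightarrow> monomial R n a x \<in> carrier R - {\<zero>}"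
proof (induction n)
  case (Suc n)
  then have "monomial R n a x \<in> carrier (mult_of R)" "x n \<in> carrier (mult_of R)" by auto
  from mult_of.m_closed[OF this(1) U.int_pow_closed[OF this(2)]] show ?case by simp
qed simp

lemma monomial_cong:
  "\<lbrakk>\<And>i. i < n \<Longrightarrow> x i = y i; \<And>i. i < n \<Longrightarrow> a i = b i\<rbrakk> \<Longrightarrow> monomial R n a x = monomial R n b y"
  by (induction n) auto

lemma monomial_zero: "(\<And>i. i < n \<Longrightarrow> a i = 0) \<Longrightarrow> monomial R n a x = \<one>"
  by (induction n) auto

lemma monomial_add:
  assumes "\<And>i. i < n \<Longrightarrow> x i \<in> carrier R - {\<zero>}"
  shows "monomial R n (\<lambda>i. a i + b i) x = monomial R n a x \<otimes> monomial R n b x"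
  using assms
proof (induction n)
  case (Suc n)
  have m: "monomial R n a x \<in> carrier R" "monomial R n b x \<in> carrier R"
    using monomial_closed[of n x] Suc.prems by auto
  have x: "x n \<in> carrier (mult_of R)" using Suc.prems by simp
  have p: "x n [^]\<^bsub>mult_of R\<^esub> c \<in> carrier R" for c :: int using U.int_pow_closed[OF x, of c] by simp
  have "x n [^]\<^bsub>mult_of R\<^esub> (a n + b n) = x n [^]\<^bsub>mult_of R\<^esub> a n \<otimes> x n [^]\<^bsub>mult_of R\<^esub> b n"
    using U.int_pow_mult[OF x] by simp
  then show ?case using Suc m p by (simp add: m_ac)
qed simp

lemma monomial_mult:
  assumes "\<And>i. i < n \<Longrightarrow> x i \<in> carrier R - {\<zero>}" "\<And>i. i < n \<Longrightarrow> y i \<in> carrier R - {\<zero>}"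
  shows "monomial R n a (\<lambda>i. x i \<otimes> y i) = monomial R n a x \<otimes> monomial R n a y"
  using assms
proof (induction n)
  case (Suc n)
  have m: "monomial R n a x \<in> carrier R" "monomial R n a y \<in> carrier R"
    using monomial_closed[of n] Suc.prems by auto
  have xy: "x n \<in> carrier (mult_of R)" "y n \<in> carrier (mult_of R)" using Suc.prems by auto
  have p: "x n [^]\<^bsub>mult_of R\<^esub> a n \<in> carrier R" "y n [^]\<^bsub>mult_of R\<^esub> a n \<in> carrier R"
    using U.int_pow_closed[OF xy(1)] U.int_pow_closed[OF xy(2)] by simp_all
  have "(x n \<otimes> y n) [^]\<^bsub>mult_of R\<^esub> a n = x n [^]\<^bsub>mult_of R\<^esub> a n \<otimes> y n [^]\<^bsub>mult_of R\<^esub> a n"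
    using U.int_pow_distrib[OF xy, of "a n"] by simp
  then show ?case using Suc m p by (simp add: m_ac)
qed simp

lemma monomial_single:
  assumes "\<And>i. i < n \<Longrightarrow> x i \<in> carrier R - {\<zero>}" "j < n"
  shows "monomial R n (\<lambda>i. if i = j then k else 0) x = x j [^]\<^bsub>mult_of R\<^esub> k"
  using assms
proof (induction n)
  case (Suc n)
  show ?case
  proof (cases "j = n")
    case True
    have "x n [^]\<^bsub>mult_of R\<^esub> k \<in> carrier R" using U.int_pow_closed[of "x n" k] Suc.prems(1)[of n] by simp
    then show ?thesis using True by (simp add: monomial_zero)
  next
    case False
    then have j: "j < n" using Suc.prems by simp
    have "x j [^]\<^bsub>mult_of R\<^esub> k \<in> carrier R" using U.int_pow_closed[of "x j" k] Suc.prems(1)[of j] j by simp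
    then show ?thesis using False j Suc.IH Suc.prems(1) by simp
  qed
qed simp

end

text \<open>A homomorphism from a subgroup of \<open>\<int>\<^sup>n\<close> to the divisible group \<open>K\<^sup>*\<close> extends to \<open>\<int>\<^sup>n\<close>, and
  the homomorphisms on \<open>\<int>\<^sup>n\<close> are the evaluations of monomials at points. The homomorphism is given
  by its graph \<open>\<Lambda>\<close>, so that single-valuedness is a condition at exponent zero. In the induction
  on \<open>n\<close>, the last coordinates occurring in \<open>\<Lambda>\<close> form a subgroup \<open>d\<int>\<close>, and the last coordinate of
  the point is a \<open>d\<close>-th root.\<close>

lemma (in algebraically_closed) ex_point_with_monomial_values:
  assumes val: "\<And>a c. (a, c) \<in> \<Lambda> \<Longrightarrow> c \<in> carrier L - {\<zero>}"
    and diff: "\<And>a b c d. \<lbrakk>(a, c) \<in> \<Lambda>; (b, d) \<in> \<Lambda>\<rbrakk> \<Longrightarrow> (\<lambda>i. a i - b i, c \<otimes> inv\<^bsub>mult_of L\<^esub> d) \<in> \<Lambda>"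
    and single: "\<And>a c. \<lbrakk>(a, c) \<in> \<Lambda>; \<And>i. i < n \<Longrightarrow> a i = 0\<rbrakk> \<Longrightarrow> c = \<one>"
  shows "\<exists>x. (\<forall>i<n. x i \<in> carrier L - {\<zero>}) \<and> (\<forall>(a, c)\<in>\<Lambda>. monomial L n a x = c)"
  using assms
proof (induction n arbitrary: \<Lambda>)
  case 0
  then show ?case by auto
next
  case (Suc n)
  interpret U: comm_group "mult_of L" by (rule comm_group_mult_of)
  define \<Lambda>' where "\<Lambda>' = {(a, c). (a, c) \<in> \<Lambda> \<and> a n = 0}"
  have "\<exists>x. (\<forall>i<n. x i \<in> carrier L - {\<zero>}) \<and> (\<forall>(a, c)\<in>\<Lambda>'. monomial L n a x = c)"
  proof (rule Suc.IH)
    show "c \<in> carrier L - {\<zero>}" if "(a, c) \<in> \<Lambda>'" for a c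
      using that Suc.prems(1) by (auto simp: \<Lambda>'_def)
    show "(\<lambda>i. a i - b i, c \<otimes> inv\<^bsub>mult_of L\<^esub> d) \<in> \<Lambda>'" if "(a, c) \<in> \<Lambda>'" "(b, d) \<in> \<Lambda>'" for a b c d
      using that Suc.prems(2) by (auto simp: \<Lambda>'_def)
    show "c = \<one>" if "(a, c) \<in> \<Lambda>'" "\<And>i. i < n \<Longrightarrow> a i = 0" for a c
      using that Suc.prems(3)[of a c] by (auto simp: \<Lambda>'_def less_Suc_eq)
  qed
  then obtain x where x: "\<And>i. i < n \<Longrightarrow> x i \<in> carrier L - {\<zero>}"
    and mon': "\<And>a c. \<lbrakk>(a, c) \<in> \<Lambda>; a n = 0\<rbrakk> \<Longrightarrow> monomial L n a x = c"
    by (fastforce simp: \<Lambda>'_def)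
  show ?case
  proof (cases "\<forall>(a, c)\<in>\<Lambda>. a n = 0")
    case True
    have "monomial L (Suc n) a (x(n := \<one>)) = c" if ac: "(a, c) \<in> \<Lambda>" for a c
    proof -
      have "a n = 0" using True ac by auto
      moreover have "monomial L n a (x(n := \<one>)) = monomial L n a x" by (rule monomial_cong) auto
      moreover have "monomial L n a x \<in> carrier L" using monomial_closed[of n x] x by simp
      ultimately show ?thesis using mon'[OF ac] by simp
    qed
    moreover have "\<forall>i<Suc n. (x(n := \<one>)) i \<in> carrier L - {\<zero>}" using x by (simp add: less_Suc_eq)
    ultimately show ?thesis by blast
  next
    case False
    have neg: "(\<lambda>i. - a i, inv\<^bsub>mult_of L\<^esub> c) \<in> \<Lambda>" if ac: "(a, c) \<in> \<Lambda>" for a c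
    proof -
      have c: "c \<in> carrier (mult_of L)" using Suc.prems(1)[OF ac] by simp
      have "(\<lambda>i. a i - a i, c \<otimes> inv\<^bsub>mult_of L\<^esub> c) \<in> \<Lambda>" using Suc.prems(2)[OF ac ac] .
      then have "(\<lambda>i. 0, \<one>) \<in> \<Lambda>" using U.r_inv[OF c] by simp
      from Suc.prems(2)[OF this ac] show ?thesis using U.inv_closed[OF c] by simp
    qed
    \<comment> \<open>\<open>N d\<close>: the positive number \<open>d\<close> is the last exponent of some member of \<open>\<Lambda>\<close>\<close>
    define N where "N d \<longleftrightarrow> 0 < d \<and> (\<exists>b e. (b, e) \<in> \<Lambda> \<and> b n = int d)" for d
    have "\<exists>d. N d"
    proof -
      obtain a c where ac: "(a, c) \<in> \<Lambda>" "a n \<noteq> 0" using False by blast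
      show ?thesis
      proof (cases "0 < a n")
        case True
        then have "N (nat (a n))" unfolding N_def using ac(1) by auto
        then show ?thesis ..
      next
        case False
        then have "N (nat (- a n))" unfolding N_def using neg[OF ac(1)] ac(2)
          by (auto intro!: exI[of _ "\<lambda>i. - a i"])
        then show ?thesis ..
      qed
    qed
    then obtain d where d: "N d" and min: "\<And>d'. N d' \<Longrightarrow> d \<le> d'"
      using exists_least_iff[of N] by (metis not_less)
    obtain b e where b: "(b, e) \<in> \<Lambda>" "b n = int d" and d0: "0 < d" using d by (auto simp: N_def)
    define m where "m a = monomial L n a x" for a
    have m: "m a \<in> carrier (mult_of L)" for a using monomial_closed[of n x] x by (simp add: m_def)
    have e: "e \<in> carrier (mult_of L)" using Suc.prems(1)[OF b(1)] by simp
    \<comment> \<open>The last coordinate \<open>y\<close> is chosen so that the monomial with exponent \<open>b\<close> has value \<open>e\<close>.\<close>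
    have q: "e \<otimes> inv\<^bsub>mult_of L\<^esub> (m b) \<in> carrier (mult_of L)"
      using mult_of.m_closed[OF e U.inv_closed[OF m]] by simp
    then obtain y where y: "y \<in> carrier L" "y [^] d = e \<otimes> inv\<^bsub>mult_of L\<^esub> (m b)"
      using ex_nth_root[OF _ d0, of "e \<otimes> inv\<^bsub>mult_of L\<^esub> (m b)"] by auto
    have "y \<noteq> \<zero>" using y q d0 by (auto simp: nat_pow_zero)
    define z where "z = x(n := y)"
    have z: "\<And>i. i < Suc n \<Longrightarrow> z i \<in> carrier L - {\<zero>}"
      using x y \<open>y \<noteq> \<zero>\<close> by (auto simp: z_def less_Suc_eq)
    have zn: "monomial L n a z = m a" for a unfolding m_def z_def by (rule monomial_cong) auto
    have zb: "monomial L (Suc n) b z = e"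
    proof -
      have "y [^]\<^bsub>mult_of L\<^esub> b n = e \<otimes> inv\<^bsub>mult_of L\<^esub> (m b)"
        unfolding b(2) int_pow_int using y(2) by (simp add: Ring_Divisibility.nat_pow_mult_of)
      then have "monomial L (Suc n) b z = m b \<otimes> (e \<otimes> inv\<^bsub>mult_of L\<^esub> (m b))" by (simp add: zn) (simp add: z_def)
      also have "\<dots> = m b \<otimes>\<^bsub>mult_of L\<^esub> (e \<otimes>\<^bsub>mult_of L\<^esub> inv\<^bsub>mult_of L\<^esub> (m b))" by simp
      also have "\<dots> = e" using m[of b] e mult_of.m_lcomm[OF m[of b] e U.inv_closed[OF m[of b]]] U.r_inv[OF m[of b]]
        mult_of.r_one[OF e] by simp
      finally show ?thesis .
    qed
    have nonneg: "monomial L (Suc n) a z = c" if "(a, c) \<in> \<Lambda>" "0 \<le> a n" for a c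
      using that
    proof (induction "nat (a n)" arbitrary: a c rule: less_induct)
      case less
      have c: "c \<in> carrier (mult_of L)" using Suc.prems(1)[OF less.prems(1)] by simp
      show ?case
      proof (cases "a n = 0")
        case True
        then show ?thesis using mon'[OF less.prems(1) True] m[of a] by (simp add: zn) (simp add: m_def)
      next
        case False
        then have "N (nat (a n))" unfolding N_def using less.prems by auto
        then have le: "int d \<le> a n" using min less.prems(2) by fastforce
        define a' where "a' = (\<lambda>i. a i - b i)"
        have "(a', c \<otimes> inv\<^bsub>mult_of L\<^esub> e) \<in> \<Lambda>" unfolding a'_def using Suc.prems(2)[OF less.prems(1) b(1)] .
        then have IH: "monomial L (Suc n) a' z = c \<otimes> inv\<^bsub>mult_of L\<^esub> e"
          using less.hyps[of a'] le b(2) d0 by (simp add: a'_def)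
        have "monomial L (Suc n) a z = monomial L (Suc n) (\<lambda>i. a' i + b i) z"
          by (rule monomial_cong) (auto simp: a'_def)
        also have "\<dots> = monomial L (Suc n) a' z \<otimes> monomial L (Suc n) b z"
          by (rule monomial_add) (rule z)
        also have "\<dots> = (c \<otimes>\<^bsub>mult_of L\<^esub> inv\<^bsub>mult_of L\<^esub> e) \<otimes>\<^bsub>mult_of L\<^esub> e"
          unfolding IH zb by simp
        also have "\<dots> = c" using mult_of.m_assoc[OF c U.inv_closed[OF e] e] U.l_inv[OF e] mult_of.r_one[OF c] by simp
        finally show ?thesis .
      qed
    qed
    have "monomial L (Suc n) a z = c" if ac: "(a, c) \<in> \<Lambda>" for a c
    proof (cases "0 \<le> a n")
      case False
      define a' where "a' = (\<lambda>i. - a i)"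
      have c: "c \<in> carrier (mult_of L)" using Suc.prems(1)[OF ac] by simp
      have M: "monomial L (Suc n) a z \<in> carrier (mult_of L)" using monomial_closed[of "Suc n" z a] z by simp
      have "monomial L (Suc n) a' z = inv\<^bsub>mult_of L\<^esub> c"
        using nonneg[of a' "inv\<^bsub>mult_of L\<^esub> c"] neg[OF ac] False by (simp add: a'_def)
      moreover have "\<one> = monomial L (Suc n) (\<lambda>i. a i + a' i) z"
        by (rule monomial_zero[symmetric]) (simp add: a'_def)
      moreover have "\<dots> = monomial L (Suc n) a z \<otimes> monomial L (Suc n) a' z"
        by (rule monomial_add) (rule z)
      ultimately have "monomial L (Suc n) a z \<otimes>\<^bsub>mult_of L\<^esub> inv\<^bsub>mult_of L\<^esub> c = \<one>\<^bsub>mult_of L\<^esub>" by simp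
      then have "inv\<^bsub>mult_of L\<^esub> (inv\<^bsub>mult_of L\<^esub> c) = monomial L (Suc n) a z"
        using U.inv_equality[OF _ U.inv_closed[OF c] M] by blast
      then show ?thesis using U.inv_inv[OF c] by simp
    qed (use nonneg ac in blast)
    then show ?thesis using z by blast
  qed
qed

section \<open>Weight decomposition\<close>

context regular_action
begin

lemma act_closed: "\<lbrakk>g \<in> carrier G; r \<in> carrier R\<rbrakk> \<Longrightarrow> \<phi> g r \<in> carrier R"
  using action.element_image by blast

lemma act_mult: "\<lbrakk>g \<in> carrier G; h \<in> carrier G; r \<in> carrier R\<rbrakk> \<Longrightarrow> \<phi> (g \<otimes>\<^bsub>G\<^esub> h) r = \<phi> g (\<phi> h r)"
  using action.composition_rule by blast

lemma act_one: "r \<in> carrier R \<Longrightarrow> \<phi> \<one>\<^bsub>G\<^esub> r = r"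
  using action.id_eq_one by (metis restrict_apply')

lemma act_inv: "\<lbrakk>g \<in> carrier G; r \<in> carrier R\<rbrakk> \<Longrightarrow> \<phi> (inv\<^bsub>G\<^esub> g) (\<phi> g r) = r"
  using act_mult[of "inv\<^bsub>G\<^esub> g" g r] act_one by simp

lemma act_inv': "\<lbrakk>g \<in> carrier G; r \<in> carrier R\<rbrakk> \<Longrightarrow> \<phi> g (\<phi> (inv\<^bsub>G\<^esub> g) r) = r"
  using act_mult[of g "inv\<^bsub>G\<^esub> g" r] act_one by simp

lemma act_hom: "g \<in> carrier G \<Longrightarrow> ring_hom_cring R R (\<phi> g)"
  using ring_automorphism R.M_cring
  by (intro ring_hom_cring.intro ring_hom_cring_axioms.intro) auto

lemma act_eq_zero_iff: "\<lbrakk>g \<in> carrier G; r \<in> carrier R\<rbrakk> \<Longrightarrow> \<phi> g r = \<zero>\<^bsub>R\<^esub> \<longleftrightarrow> r = \<zero>\<^bsub>R\<^esub>"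
  using act_inv[of g r] act_inv[of g "\<zero>\<^bsub>R\<^esub>"] ring_hom_cring.hom_zero[OF act_hom, of g] by force

lemma ex_stable_span:
  assumes r: "r \<in> carrier R"
  obtains N :: nat and v c m where "\<forall>i<N. v i \<in> carrier R" "\<forall>i<N. c i \<in> carrier K"
    "r = (\<Oplus>\<^bsub>R\<^esub>i\<in>{..<N}. c i \<odot>\<^bsub>R\<^esub> v i)" "\<forall>i<N. \<forall>j<N. m i j \<in> A"
    "\<forall>g\<in>carrier G. \<forall>j<N. \<phi> g (v j) = (\<Oplus>\<^bsub>R\<^esub>i\<in>{..<N}. m i j g \<odot>\<^bsub>R\<^esub> v i)"
proof -
  obtain N :: nat and v m where *: "(\<forall>i<N. v i \<in> carrier R) \<and>
      (\<forall>c. (\<forall>i<N. c i \<in> carrier K) \<and> (\<Oplus>\<^bsub>R\<^esub>i\<in>{..<N}. c i \<odot>\<^bsub>R\<^esub> v i) = \<zero>\<^bsub>R\<^esub> \<longrightarrow> (\<forall>i<N. c i = \<zero>)) \<and>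
      (\<exists>c. (\<forall>i<N. c i \<in> carrier K) \<and> r = (\<Oplus>\<^bsub>R\<^esub>i\<in>{..<N}. c i \<odot>\<^bsub>R\<^esub> v i)) \<and>
      (\<forall>i<N. \<forall>j<N. m i j \<in> A) \<and>
      (\<forall>g\<in>carrier G. \<forall>j<N. \<phi> g (v j) = (\<Oplus>\<^bsub>R\<^esub>i\<in>{..<N}. m i j g \<odot>\<^bsub>R\<^esub> v i))"
    using rational[OF r] by (elim exE)
  obtain c where "\<forall>i<N. c i \<in> carrier K" "r = (\<Oplus>\<^bsub>R\<^esub>i\<in>{..<N}. c i \<odot>\<^bsub>R\<^esub> v i)"
    using *[THEN conjunct2, THEN conjunct2, THEN conjunct1] by (elim exE conjE)
  then show thesis using * by (intro that) (elim conjE, assumption)+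
qed

end

text \<open>A torus \<open>T\<close> in the acting group: the coordinates \<open>\<psi>\<close> identify it with \<open>(K\<^sup>*)\<^sup>n\<close>, and
  regular functions on the group restrict to Laurent polynomials.\<close>

locale torus_action = regular_action K G A R \<phi>
  for K :: "('k, 'm) ring_scheme" and G :: "('g, 'n) monoid_scheme" and A
    and R :: "('k, 'r, 's) module_scheme" (structure) and \<phi> +
  fixes T :: "'g set" and n :: nat and \<psi> :: "'g \<Rightarrow> nat \<Rightarrow> 'k"
  assumes T: "subgroup T G"
    and bij: "bij_betw \<psi> T (carrier (Gm_power K n))"
    and psi_mult: "\<lbrakk>s \<in> T; t \<in> T; i < n\<rbrakk> \<Longrightarrow> \<psi> (s \<otimes>\<^bsub>G\<^esub> t) i = \<psi> s i \<otimes>\<^bsub>K\<^esub> \<psi> t i"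
    and coord: "f \<in> A \<Longrightarrow> \<exists>g\<in>Gm_power_coord K n. \<forall>t\<in>T. f t = g (\<psi> t)"
begin

lemma T_carrier: "t \<in> T \<Longrightarrow> t \<in> carrier G"
  using subgroup.mem_carrier[OF T] .

lemma Gm_power_carrier: "carrier (Gm_power K n) = {..<n} \<rightarrow>\<^sub>E carrier K - {\<zero>\<^bsub>K\<^esub>}"
  by (simp add: Gm_power_def)

lemma psi_mem: "t \<in> T \<Longrightarrow> \<psi> t \<in> carrier (Gm_power K n)"
  using bij by (auto simp: bij_betw_def)

lemma psi_nonzero: "\<lbrakk>t \<in> T; i < n\<rbrakk> \<Longrightarrow> \<psi> t i \<in> carrier K - {\<zero>\<^bsub>K\<^esub>}"
  using psi_mem[of t] unfolding Gm_power_carrier by auto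

definition char :: "(nat \<Rightarrow> int) \<Rightarrow> 'g \<Rightarrow> 'k" where
  "char a t = monomial K n a (\<psi> t)"

lemma char_nonzero: "t \<in> T \<Longrightarrow> char a t \<in> carrier K - {\<zero>\<^bsub>K\<^esub>}"
  unfolding char_def by (rule monomial_closed) (rule psi_nonzero)

lemma char_closed: "t \<in> T \<Longrightarrow> char a t \<in> carrier K"
  using char_nonzero by blast

lemma char_mult:
  assumes "s \<in> T" "t \<in> T"
  shows "char a (s \<otimes>\<^bsub>G\<^esub> t) = char a s \<otimes>\<^bsub>K\<^esub> char a t"
proof -
  have "char a (s \<otimes>\<^bsub>G\<^esub> t) = monomial K n a (\<lambda>i. \<psi> s i \<otimes>\<^bsub>K\<^esub> \<psi> t i)"
    unfolding char_def by (rule monomial_cong) (simp_all add: psi_mult assms)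
  also have "\<dots> = char a s \<otimes>\<^bsub>K\<^esub> char a t"
    unfolding char_def by (rule monomial_mult) (simp_all add: psi_nonzero[simplified] assms)
  finally show ?thesis .
qed

lemma char_add: "t \<in> T \<Longrightarrow> char (\<lambda>i. a i + b i) t = char a t \<otimes>\<^bsub>K\<^esub> char b t"
  unfolding char_def by (rule monomial_add) (rule psi_nonzero)

lemma char_zero: "char (\<lambda>_. 0) t = \<one>\<^bsub>K\<^esub>"
  unfolding char_def by (rule monomial_zero) simp

lemma char_one: "char a \<one>\<^bsub>G\<^esub> = \<one>\<^bsub>K\<^esub>"
proof -
  have "\<one>\<^bsub>G\<^esub> \<in> T" using subgroup.one_closed[OF T] .
  then have c: "char a \<one>\<^bsub>G\<^esub> \<in> carrier K - {\<zero>\<^bsub>K\<^esub>}" "char a \<one>\<^bsub>G\<^esub> \<otimes>\<^bsub>K\<^esub> char a \<one>\<^bsub>G\<^esub> = char a \<one>\<^bsub>G\<^esub> \<otimes>\<^bsub>K\<^esub> \<one>\<^bsub>K\<^esub>"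
    using char_mult[of "\<one>\<^bsub>G\<^esub>" "\<one>\<^bsub>G\<^esub>" a] char_nonzero[of "\<one>\<^bsub>G\<^esub>" a] by simp_all
  then show ?thesis using m_lcancel[of "char a \<one>\<^bsub>G\<^esub>" "char a \<one>\<^bsub>G\<^esub>" "\<one>\<^bsub>K\<^esub>"] by blast
qed

text \<open>A list of exponents and coefficients stands for a sum of characters with coefficients in \<open>R\<close>. The
  same character may occur repeatedly, which makes sums and products immediate.\<close>

primrec char_sum :: "((nat \<Rightarrow> int) \<times> 'r) list \<Rightarrow> 'g \<Rightarrow> 'r" where
  "char_sum [] t = \<zero>"
| "char_sum (p # ps) t = char (fst p) t \<odot> snd p \<oplus> char_sum ps t"

lemma char_sum_closed: "\<lbrakk>snd ` set ps \<subseteq> carrier R; t \<in> T\<rbrakk> \<Longrightarrow> char_sum ps t \<in> carrier R"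
  by (induction ps) (auto simp: char_closed)

lemma char_sum_append:
  "\<lbrakk>snd ` set ps \<subseteq> carrier R; snd ` set qs \<subseteq> carrier R; t \<in> T\<rbrakk>
   \<Longrightarrow> char_sum (ps @ qs) t = char_sum ps t \<oplus> char_sum qs t"
  by (induction ps) (auto simp: char_closed char_sum_closed R.M.a_assoc)

lemma char_sum_smult:
  "\<lbrakk>snd ` set ps \<subseteq> carrier R; t \<in> T; c \<in> carrier K\<rbrakk>
   \<Longrightarrow> char_sum (map (\<lambda>p. (fst p, c \<odot> snd p)) ps) t = c \<odot> char_sum ps t"
  by (induction ps)
    (auto simp: char_closed char_sum_closed R.smult_r_distr R.smult_assoc1[symmetric] m_comm)

lemma char_sum_shift:
  "\<lbrakk>snd ` set ps \<subseteq> carrier R; t \<in> T\<rbrakk>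
   \<Longrightarrow> char_sum (map (\<lambda>p. (\<lambda>i. fst p i + b i, snd p)) ps) t = char b t \<odot> char_sum ps t"
  by (induction ps)
    (auto simp: char_closed char_sum_closed char_add R.smult_r_distr R.smult_assoc1[symmetric] m_comm)

definition char_sums :: "('g \<Rightarrow> 'r) set" where
  "char_sums = {h. \<exists>ps. snd ` set ps \<subseteq> carrier R \<and> (\<forall>t\<in>T. h t = char_sum ps t)}"

lemma char_sums_const: "r \<in> carrier R \<Longrightarrow> (\<lambda>_. r) \<in> char_sums"
  unfolding char_sums_def
  by (intro CollectI exI[of _ "[(\<lambda>_. 0, r)]"]) (simp add: char_zero)

lemma char_sums_add:
  assumes "h \<in> char_sums" "h' \<in> char_sums"
  shows "(\<lambda>t. h t \<oplus> h' t) \<in> char_sums"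
proof -
  obtain ps qs where "snd ` set ps \<subseteq> carrier R" "\<forall>t\<in>T. h t = char_sum ps t"
    "snd ` set qs \<subseteq> carrier R" "\<forall>t\<in>T. h' t = char_sum qs t"
    using assms unfolding char_sums_def by blast
  then show ?thesis unfolding char_sums_def
    by (intro CollectI exI[of _ "ps @ qs"]) (auto simp: char_sum_append)
qed

lemma char_sums_smult:
  assumes "c \<in> carrier K" "h \<in> char_sums"
  shows "(\<lambda>t. c \<odot> h t) \<in> char_sums"
proof -
  obtain ps where "snd ` set ps \<subseteq> carrier R" "\<forall>t\<in>T. h t = char_sum ps t"
    using assms unfolding char_sums_def by blast
  then show ?thesis unfolding char_sums_def
    using assms(1)
    by (intro CollectI exI[of _ "map (\<lambda>p. (fst p, c \<odot> snd p)) ps"]) (auto simp: char_sum_smult)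
qed

lemma char_sums_shift:
  assumes "h \<in> char_sums"
  shows "(\<lambda>t. char b t \<odot> h t) \<in> char_sums"
proof -
  obtain ps where "snd ` set ps \<subseteq> carrier R" "\<forall>t\<in>T. h t = char_sum ps t"
    using assms unfolding char_sums_def by blast
  then show ?thesis unfolding char_sums_def
    by (intro CollectI exI[of _ "map (\<lambda>p. (\<lambda>i. fst p i + b i, snd p)) ps"]) (auto simp: char_sum_shift)
qed

lemma char_sums_cong: "\<lbrakk>h \<in> char_sums; \<And>t. t \<in> T \<Longrightarrow> h' t = h t\<rbrakk> \<Longrightarrow> h' \<in> char_sums"
  unfolding char_sums_def by simp

lemma char_sums_closed: "\<lbrakk>h \<in> char_sums; t \<in> T\<rbrakk> \<Longrightarrow> h t \<in> carrier R"
  unfolding char_sums_def using char_sum_closed by auto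

text \<open>The functions \<open>g\<close> by which \<open>char_sums\<close> may be multiplied form a subalgebra; it contains the
  coordinates and their inverses because these are characters.\<close>

lemma char_sums_coord:
  assumes g: "g \<in> Gm_power_coord K n" and h: "h \<in> char_sums"
  shows "(\<lambda>t. g (\<psi> t) \<odot> h t) \<in> char_sums"
proof -
  define W where "W = carrier (Gm_power K n)"
  define FA :: "('k, (nat \<Rightarrow> 'k) \<Rightarrow> 'k) module" where "FA = fun_algebra K W"
  define L where "L = {g \<in> carrier FA. \<forall>h\<in>char_sums. (\<lambda>t. g (\<psi> t) \<odot> h t) \<in> char_sums}"
  have FA: "carrier FA = W \<rightarrow>\<^sub>E carrier K" "\<one>\<^bsub>FA\<^esub> = (\<lambda>x\<in>W. \<one>\<^bsub>K\<^esub>)" "\<zero>\<^bsub>FA\<^esub> = (\<lambda>x\<in>W. \<zero>\<^bsub>K\<^esub>)"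
    "\<And>f g. f \<otimes>\<^bsub>FA\<^esub> g = (\<lambda>x\<in>W. f x \<otimes>\<^bsub>K\<^esub> g x)" "\<And>f g. f \<oplus>\<^bsub>FA\<^esub> g = (\<lambda>x\<in>W. f x \<oplus>\<^bsub>K\<^esub> g x)"
    "\<And>c f. c \<odot>\<^bsub>FA\<^esub> f = (\<lambda>x\<in>W. c \<otimes>\<^bsub>K\<^esub> f x)"
    by (simp_all add: FA_def fun_algebra_def)
  have W: "\<psi> t \<in> W" if "t \<in> T" for t using psi_mem[OF that] by (simp add: W_def)
  have val: "f x \<in> carrier K" if "f \<in> carrier FA" "x \<in> W" for f x using that by (auto simp: FA)
  have LI: "f \<in> L" if f: "f \<in> carrier FA"
    and ex: "\<And>h. h \<in> char_sums \<Longrightarrow> \<exists>h'\<in>char_sums. \<forall>t\<in>T. f (\<psi> t) \<odot> h t = h' t" for f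
    unfolding L_def
  proof (intro CollectI conjI ballI)
    fix h assume "h \<in> char_sums"
    then obtain h' where h': "h' \<in> char_sums" "\<forall>t\<in>T. f (\<psi> t) \<odot> h t = h' t" using ex by blast
    show "(\<lambda>t. f (\<psi> t) \<odot> h t) \<in> char_sums"
      by (rule char_sums_cong[OF h'(1)]) (use h'(2) in blast)
  qed (rule f)
  have LE: "f \<in> carrier FA" "\<And>h. h \<in> char_sums \<Longrightarrow> (\<lambda>t. f (\<psi> t) \<odot> h t) \<in> char_sums" if "f \<in> L" for f
    using that unfolding L_def by auto
  have smult: "c \<odot>\<^bsub>FA\<^esub> f \<in> L" if c: "c \<in> carrier K" and f: "f \<in> L" for c f
  proof (rule LI)
    show "c \<odot>\<^bsub>FA\<^esub> f \<in> carrier FA" using c LE(1)[OF f] by (auto simp: FA)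
    fix h assume h: "h \<in> char_sums"
    have eq: "(c \<odot>\<^bsub>FA\<^esub> f) (\<psi> t) \<odot> h t = c \<odot> (f (\<psi> t) \<odot> h t)" if t: "t \<in> T" for t
      using W[OF t] val[OF LE(1)[OF f] W[OF t]] c char_sums_closed[OF h t]
      by (simp add: FA R.smult_assoc1)
    show "\<exists>h'\<in>char_sums. \<forall>t\<in>T. (c \<odot>\<^bsub>FA\<^esub> f) (\<psi> t) \<odot> h t = h' t"
      by (rule bexI[OF ballI char_sums_smult[OF c LE(2)[OF f h]]]) (erule eq)
  qed
  have sub: "subring L FA"
  proof (intro subring.intro subgroup.intro submonoid.intro)
    show "L \<subseteq> carrier (add_monoid FA)" "L \<subseteq> carrier FA" by (auto simp: L_def)
    show "x \<otimes>\<^bsub>add_monoid FA\<^esub> y \<in> L" if x: "x \<in> L" and y: "y \<in> L" for x y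
    proof (rule LI)
      show "x \<otimes>\<^bsub>add_monoid FA\<^esub> y \<in> carrier FA" using LE(1)[OF x] LE(1)[OF y] by (auto simp: FA)
      fix h assume h: "h \<in> char_sums"
      have eq: "(x \<otimes>\<^bsub>add_monoid FA\<^esub> y) (\<psi> t) \<odot> h t = x (\<psi> t) \<odot> h t \<oplus> y (\<psi> t) \<odot> h t" if t: "t \<in> T" for t
        using W[OF t] val[OF LE(1)[OF x] W[OF t]] val[OF LE(1)[OF y] W[OF t]] char_sums_closed[OF h t]
        by (simp add: FA R.smult_l_distr)
      show "\<exists>h'\<in>char_sums. \<forall>t\<in>T. (x \<otimes>\<^bsub>add_monoid FA\<^esub> y) (\<psi> t) \<odot> h t = h' t"
        by (rule bexI[OF ballI char_sums_add[OF LE(2)[OF x h] LE(2)[OF y h]]]) (erule eq)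
    qed
    show "x \<otimes>\<^bsub>FA\<^esub> y \<in> L" if x: "x \<in> L" and y: "y \<in> L" for x y
    proof (rule LI)
      show "x \<otimes>\<^bsub>FA\<^esub> y \<in> carrier FA" using LE(1)[OF x] LE(1)[OF y] by (auto simp: FA)
      fix h assume h: "h \<in> char_sums"
      have eq: "(x \<otimes>\<^bsub>FA\<^esub> y) (\<psi> t) \<odot> h t = x (\<psi> t) \<odot> (y (\<psi> t) \<odot> h t)" if t: "t \<in> T" for t
        using W[OF t] val[OF LE(1)[OF x] W[OF t]] val[OF LE(1)[OF y] W[OF t]] char_sums_closed[OF h t]
        by (simp add: FA R.smult_assoc1)
      show "\<exists>h'\<in>char_sums. \<forall>t\<in>T. (x \<otimes>\<^bsub>FA\<^esub> y) (\<psi> t) \<odot> h t = h' t"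
        by (rule bexI[OF ballI LE(2)[OF x LE(2)[OF y h]]]) (erule eq)
    qed
    show one: "\<one>\<^bsub>FA\<^esub> \<in> L"
    proof (rule LI)
      show "\<one>\<^bsub>FA\<^esub> \<in> carrier FA" by (auto simp: FA)
      fix h assume h: "h \<in> char_sums"
      have eq: "\<one>\<^bsub>FA\<^esub> (\<psi> t) \<odot> h t = h t" if t: "t \<in> T" for t
        using W[OF t] char_sums_closed[OF h t] by (simp add: FA)
      show "\<exists>h'\<in>char_sums. \<forall>t\<in>T. \<one>\<^bsub>FA\<^esub> (\<psi> t) \<odot> h t = h' t"
        by (rule bexI[OF ballI h]) (erule eq)
    qed
    have "\<zero>\<^bsub>K\<^esub> \<odot>\<^bsub>FA\<^esub> \<one>\<^bsub>FA\<^esub> = \<zero>\<^bsub>FA\<^esub>" by (auto simp: FA)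
    then show "\<one>\<^bsub>add_monoid FA\<^esub> \<in> L" using smult[OF _ one, of "\<zero>\<^bsub>K\<^esub>"] by simp
    show "inv\<^bsub>add_monoid FA\<^esub> x \<in> L" if x: "x \<in> L" for x
    proof -
      have xW: "x z \<in> carrier K" if "z \<in> W" for z using val[OF LE(1)[OF x] that] .
      define y where "y = (\<ominus>\<^bsub>K\<^esub> \<one>\<^bsub>K\<^esub>) \<odot>\<^bsub>FA\<^esub> x"
      have y: "y = (\<lambda>z\<in>W. \<ominus>\<^bsub>K\<^esub> x z)" unfolding y_def FA using xW by (auto simp: l_minus)
      have "inv\<^bsub>add_monoid FA\<^esub> x = y"
        unfolding m_inv_def
      proof (rule the_equality)
        show "y \<in> carrier (add_monoid FA) \<and> x \<otimes>\<^bsub>add_monoid FA\<^esub> y = \<one>\<^bsub>add_monoid FA\<^esub> \<and>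
            y \<otimes>\<^bsub>add_monoid FA\<^esub> x = \<one>\<^bsub>add_monoid FA\<^esub>"
          using xW by (auto simp: FA y r_neg l_neg)
        fix z assume z: "z \<in> carrier (add_monoid FA) \<and> x \<otimes>\<^bsub>add_monoid FA\<^esub> z = \<one>\<^bsub>add_monoid FA\<^esub> \<and>
            z \<otimes>\<^bsub>add_monoid FA\<^esub> x = \<one>\<^bsub>add_monoid FA\<^esub>"
        then have zE: "z \<in> W \<rightarrow>\<^sub>E carrier K" and eq: "(\<lambda>u\<in>W. z u \<oplus>\<^bsub>K\<^esub> x u) = (\<lambda>u\<in>W. \<zero>\<^bsub>K\<^esub>)" by (simp_all add: FA)
        show "z = y"
        proof (rule PiE_ext[OF zE])
          show "y \<in> W \<rightarrow>\<^sub>E carrier K" using xW by (auto simp: y)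
          fix u assume u: "u \<in> W"
          then have "z u \<oplus>\<^bsub>K\<^esub> x u = \<zero>\<^bsub>K\<^esub>" using fun_cong[OF eq, of u] by simp
          then have "\<ominus>\<^bsub>K\<^esub> x u = z u" using minus_equality[of "z u" "x u"] xW[OF u] PiE_mem[OF zE u] by simp
          then show "z u = y u" using u by (simp add: y)
        qed
      qed
      then show ?thesis using smult[OF _ x, of "\<ominus>\<^bsub>K\<^esub> \<one>\<^bsub>K\<^esub>"] by (simp add: y_def)
    qed
  qed
  have gen: "f \<in> L" if f: "f \<in> carrier FA" and b: "\<And>t. t \<in> T \<Longrightarrow> f (\<psi> t) = char b t" for f b
  proof (rule LI[OF f])
    fix h assume h: "h \<in> char_sums"
    show "\<exists>h'\<in>char_sums. \<forall>t\<in>T. f (\<psi> t) \<odot> h t = h' t"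
      by (rule bexI[OF ballI char_sums_shift[OF h, of b]]) (simp add: b)
  qed
  have "(\<Union>i<n. {\<lambda>x\<in>W. x i, \<lambda>x\<in>W. inv\<^bsub>K\<^esub> (x i)}) \<subseteq> L"
  proof -
    have "(\<lambda>x\<in>W. x i) \<in> L" "(\<lambda>x\<in>W. inv\<^bsub>K\<^esub> (x i)) \<in> L" if i: "i < n" for i
    proof -
      have xi: "x i \<in> carrier K - {\<zero>\<^bsub>K\<^esub>}" if "x \<in> W" for x using that i by (auto simp: W_def Gm_power_carrier)
      interpret U: comm_group "mult_of K" by (rule comm_group_mult_of)
      have single: "char (\<lambda>j. if j = i then k else 0) t = \<psi> t i [^]\<^bsub>mult_of K\<^esub> k" if "t \<in> T" for t k
        unfolding char_def by (rule monomial_single[OF psi_nonzero[OF that] i])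
      show "(\<lambda>x\<in>W. x i) \<in> L"
      proof (rule gen)
        show "(\<lambda>x\<in>W. x i) \<in> carrier FA" using xi by (auto simp: FA)
        show "(\<lambda>x\<in>W. x i) (\<psi> t) = char (\<lambda>j. if j = i then 1 else 0) t" if "t \<in> T" for t
          using W[OF that] single[OF that, of 1] U.int_pow_1[of "\<psi> t i"] xi[OF W[OF that]] by simp
      qed
      show "(\<lambda>x\<in>W. inv\<^bsub>K\<^esub> (x i)) \<in> L"
      proof (rule gen)
        show "(\<lambda>x\<in>W. inv\<^bsub>K\<^esub> (x i)) \<in> carrier FA" using xi field_Units by (auto simp: FA)
        show "(\<lambda>x\<in>W. inv\<^bsub>K\<^esub> (x i)) (\<psi> t) = char (\<lambda>j. if j = i then - 1 else 0) t" if t: "t \<in> T" for t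
        proof -
          have x: "\<psi> t i \<in> carrier (mult_of K)" "\<psi> t i \<in> Units K" using xi[OF W[OF t]] field_Units by auto
          have "char (\<lambda>j. if j = i then - 1 else 0) t = inv\<^bsub>mult_of K\<^esub> (\<psi> t i)"
            using single[OF t, of "- 1"] U.int_pow_neg[OF x(1), of 1] U.int_pow_1[OF x(1)] by simp
          also have "\<dots> = inv\<^bsub>K\<^esub> (\<psi> t i)"
            using U.inv_equality[of "inv\<^bsub>K\<^esub> (\<psi> t i)" "\<psi> t i"] x field_Units Units_inv_Units[OF x(2)] by auto
          finally show ?thesis using W[OF t] by simp
        qed
      qed
    qed
    then show ?thesis by blast
  qed
  then have "L \<in> {B. smult_subalgebra K FA B \<and> (\<Union>i<n. {\<lambda>x\<in>W. x i, \<lambda>x\<in>W. inv\<^bsub>K\<^esub> (x i)}) \<subseteq> B}"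
    using sub smult by (simp add: smult_subalgebra_def)
  moreover have "g \<in> \<Inter>{B. smult_subalgebra K FA B \<and> (\<Union>i<n. {\<lambda>x\<in>W. x i, \<lambda>x\<in>W. inv\<^bsub>K\<^esub> (x i)}) \<subseteq> B}"
    using g unfolding Gm_power_coord_def alg_generated_def FA_def W_def .
  ultimately have "g \<in> L" by blast
  then show ?thesis using LE(2) h by blast
qed

lemma orbit_map_in_char_sums:
  assumes r: "r \<in> carrier R"
  shows "(\<lambda>t. \<phi> t r) \<in> char_sums"
proof -
  obtain N :: nat and v c m where v: "\<forall>i<N. v i \<in> carrier R" and c: "\<forall>i<N. c i \<in> carrier K"
    and rsum: "r = (\<Oplus>i\<in>{..<N}. c i \<odot> v i)"
    and m: "\<forall>i<N. \<forall>j<N. m i j \<in> A"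
    and act: "\<forall>g\<in>carrier G. \<forall>j<N. \<phi> g (v j) = (\<Oplus>i\<in>{..<N}. m i j g \<odot> v i)"
    by (rule ex_stable_span[OF r]) (rule that)
  note v = v[rule_format] and c = c[rule_format] and m = m[rule_format] and act = act[rule_format]
  have sum: "(\<lambda>t. \<Oplus>i\<in>{..<M}. h i t) \<in> char_sums" if "\<And>i. i < M \<Longrightarrow> h i \<in> char_sums" for h and M :: nat
    using that
  proof (induction M)
    case 0
    show ?case using char_sums_const[of "\<zero>"] by simp
  next
    case (Suc M)
    show ?case
    proof (rule char_sums_cong)
      show "(\<lambda>t. h M t \<oplus> (\<Oplus>i\<in>{..<M}. h i t)) \<in> char_sums"
        using char_sums_add[of "h M" "\<lambda>t. \<Oplus>i\<in>{..<M}. h i t"] Suc by simp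
      show "(\<Oplus>i\<in>{..<Suc M}. h i t) = h M t \<oplus> (\<Oplus>i\<in>{..<M}. h i t)" if "t \<in> T" for t
        using char_sums_closed[OF Suc.prems that] by (simp add: lessThan_Suc R.M.finsum_insert Pi_iff)
    qed
  qed
  have orbit: "(\<lambda>t. \<phi> t (v j)) \<in> char_sums" if j: "j < N" for j
  proof (rule char_sums_cong)
    show "(\<lambda>t. \<Oplus>i\<in>{..<N}. m i j t \<odot> v i) \<in> char_sums"
    proof (rule sum)
      fix i assume i: "i < N"
      obtain g where g: "g \<in> Gm_power_coord K n" "\<forall>t\<in>T. m i j t = g (\<psi> t)" using coord[OF m[OF i j]] by blast
      show "(\<lambda>t. m i j t \<odot> v i) \<in> char_sums"
        by (rule char_sums_cong[OF char_sums_coord[OF g(1) char_sums_const[OF v[OF i]]]]) (simp add: g(2))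
    qed
    show "\<phi> t (v j) = (\<Oplus>i\<in>{..<N}. m i j t \<odot> v i)" if "t \<in> T" for t
      using act[OF T_carrier[OF that] j] .
  qed
  show ?thesis
  proof (rule char_sums_cong)
    show "(\<lambda>t. \<Oplus>j\<in>{..<N}. c j \<odot> \<phi> t (v j)) \<in> char_sums"
      using char_sums_smult[OF c orbit] by (intro sum) auto
    show "\<phi> t r = (\<Oplus>j\<in>{..<N}. c j \<odot> \<phi> t (v j))" if t: "t \<in> T" for t
    proof -
      interpret h: ring_hom_cring R R "\<phi> t" by (rule act_hom[OF T_carrier[OF t]])
      have "\<phi> t r = (\<Oplus>j\<in>{..<N}. (\<phi> t \<circ> (\<lambda>j. c j \<odot> v j)) j)"
        unfolding rsum using c v by (subst h.hom_finsum) auto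
      also have "\<dots> = (\<Oplus>j\<in>{..<N}. c j \<odot> \<phi> t (v j))"
        using c v scalar_linear[OF T_carrier[OF t]] act_closed[OF T_carrier[OF t]]
        by (intro R.M.finsum_cong') auto
      finally show ?thesis .
    qed
  qed
qed

text \<open>Dedekind's independence of characters with coefficients in \<open>R\<close>: if \<open>s\<close> distinguishes the first
  character from another one, replacing \<open>t\<close> by \<open>st\<close> and subtracting the multiple of the relation by
  the value of the first character at \<open>s\<close> eliminates the first character and keeps the other.\<close>

lemma characters_independent:
  "\<lbrakk>distinct (map (\<lambda>p. restrict (char (fst p)) T) ps); snd ` set ps \<subseteq> carrier R;
    \<And>t. t \<in> T \<Longrightarrow> char_sum ps t = \<zero>\<rbrakk> \<Longrightarrow> \<forall>p\<in>set ps. snd p = \<zero>"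
proof (induction "length ps" arbitrary: ps)
  case (Suc l)
  obtain p qs where ps: "ps = p # qs" "length qs = l"
    using Suc.hyps(2) by (metis length_Suc_conv)
  have R: "snd p \<in> carrier R" "snd ` set qs \<subseteq> carrier R" using Suc.prems(2) ps by auto
  have q0: "snd q = \<zero>" if q: "q \<in> set qs" for q
  proof -
    have "restrict (char (fst p)) T \<notin> (\<lambda>p. restrict (char (fst p)) T) ` set qs"
      using Suc.prems(1) by (simp add: ps(1))
    then have "restrict (char (fst q)) T \<noteq> restrict (char (fst p)) T" using imageI[OF q] by metis
    then obtain s where s: "s \<in> T" "char (fst q) s \<noteq> char (fst p) s" using restrict_ext by metis
    define d where "d q = char (fst q) s \<ominus>\<^bsub>K\<^esub> char (fst p) s" for q :: "(nat \<Rightarrow> int) \<times> 'r"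
    define qs' where "qs' = map (\<lambda>q. (fst q, d q \<odot> snd q)) qs"
    have d: "d q \<in> carrier K" for q using s char_closed by (simp add: d_def)
    have sum: "char_sum (map (\<lambda>q. (fst q, d q \<odot> snd q)) xs) t =
        char_sum xs (s \<otimes>\<^bsub>G\<^esub> t) \<ominus> char (fst p) s \<odot> char_sum xs t"
      if "snd ` set xs \<subseteq> carrier R" "t \<in> T" for xs t
      using that(1)
    proof (induction xs)
      case (Cons x xs)
      have c: "char (fst x) s \<in> carrier K" "char (fst x) t \<in> carrier K" "char (fst p) s \<in> carrier K"
        using char_closed s that by auto
      have x: "snd x \<in> carrier R" "snd ` set xs \<subseteq> carrier R" using Cons.prems by auto
      have st: "s \<otimes>\<^bsub>G\<^esub> t \<in> T" using subgroup.m_closed[OF T s(1) that(2)] .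
      define u where "u = char_sum xs (s \<otimes>\<^bsub>G\<^esub> t)"
      define w where "w = char_sum xs t"
      have uw: "u \<in> carrier R" "w \<in> carrier R" using char_sum_closed x st that by (auto simp: u_def w_def)
      have "char (fst x) t \<odot> (d x \<odot> snd x)
         = (char (fst x) s \<otimes>\<^bsub>K\<^esub> char (fst x) t) \<odot> snd x \<ominus> char (fst p) s \<odot> (char (fst x) t \<odot> snd x)"
        using c x
        by (simp add: d_def R.smult_assoc1[symmetric] minus_eq r_distr R.smult_l_distr R.M.minus_eq
            r_minus R.smult_l_minus R.smult_r_distr R.smult_r_minus m_comm)
      then show ?case
        using Cons.IH[OF x(2)] c x uw char_mult[OF s(1) that(2)] unfolding u_def[symmetric] w_def[symmetric]
        by (simp add: u_def[symmetric] w_def[symmetric] R.smult_r_distr R.M.minus_eq R.M.minus_add R.M.a_ac)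
    qed (use s char_closed in \<open>simp add: R.M.minus_eq\<close>)
    have "\<forall>q\<in>set qs'. snd q = \<zero>"
    proof (rule Suc.hyps(1))
      show "l = length qs'" using ps by (simp add: qs'_def)
      show "distinct (map (\<lambda>p. restrict (char (fst p)) T) qs')"
        using Suc.prems(1) ps by (simp add: qs'_def comp_def)
      show "snd ` set qs' \<subseteq> carrier R" using R d by (auto simp: qs'_def)
      fix t assume t: "t \<in> T"
      have st: "s \<otimes>\<^bsub>G\<^esub> t \<in> T" using subgroup.m_closed[OF T s(1) t] .
      have dp: "d p = \<zero>\<^bsub>K\<^esub>" using s char_closed by (simp add: d_def minus_eq r_neg)
      have "char_sum qs' t = char_sum (map (\<lambda>q. (fst q, d q \<odot> snd q)) ps) t"
        using R char_closed[OF t] char_sum_closed[of qs' t] t d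
        by (auto simp: ps(1) qs'_def dp image_subset_iff)
      also have "\<dots> = \<zero> \<ominus> char (fst p) s \<odot> \<zero>"
        using sum[OF Suc.prems(2) t] Suc.prems(3)[OF t] Suc.prems(3)[OF st] by simp
      finally show "char_sum qs' t = \<zero>" using char_closed[OF s(1)] by (simp add: R.M.minus_eq)
    qed
    then have "d q \<odot> snd q = \<zero>" using q by (auto simp: qs'_def)
    moreover have "d q \<in> Units K" using s d[of q] char_closed field_Units by (auto simp: d_def r_right_minus_eq)
    moreover have "snd q \<in> carrier R" using q R by auto
    ultimately have "snd q = inv\<^bsub>K\<^esub> (d q) \<odot> \<zero>"
      using d[of q] R.smult_assoc1[of "inv\<^bsub>K\<^esub> (d q)" "d q" "snd q"] by simp
    then show ?thesis using \<open>d q \<in> Units K\<close> by simp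
  qed
  have "char_sum qs t = \<zero>" if "t \<in> T" for t
    using q0
  proof (induction qs)
    case (Cons q qs)
    then show ?case using char_closed[OF that] by simp
  qed simp
  moreover have e: "\<one>\<^bsub>G\<^esub> \<in> T" using subgroup.one_closed[OF T] .
  ultimately have "snd p = \<zero>" using Suc.prems(3)[OF e] R by (simp add: ps(1) char_one)
  then show ?case using q0 ps by auto
qed simp

definition weight_space :: "(nat \<Rightarrow> int) \<Rightarrow> 'r set" where
  "weight_space a = {r \<in> carrier R. \<forall>t\<in>T. \<phi> t r = char a t \<odot> r}"

text \<open>\<open>R\<close> is the sum of the weight spaces of \<open>T\<close>. The map \<open>t \<mapsto> \<phi> t r\<close> is a sum of characters with
  coefficients in \<open>R\<close>; in a representation of least length the characters are distinct. Comparing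
  the values at \<open>st\<close> with \<open>\<phi> s\<close> of the values at \<open>t\<close>, independence shows that the coefficients are
  weight vectors. Their sum is the value at the identity, which is \<open>r\<close>.\<close>

theorem weight_decomposition:
  assumes r: "r \<in> carrier R" and H: "additive_subgroup H R" and sub: "\<And>a. weight_space a \<subseteq> H"
  shows "r \<in> H"
proof -
  define rep where "rep ps \<longleftrightarrow> snd ` set ps \<subseteq> carrier R \<and> (\<forall>t\<in>T. \<phi> t r = char_sum ps t)" for ps
  have "\<exists>ps. rep ps" using orbit_map_in_char_sums[OF r] unfolding char_sums_def rep_def by blast
  then obtain ps where ps: "rep ps" and min: "\<And>qs. rep qs \<Longrightarrow> length ps \<le> length qs"
    using ex_has_least_nat[of rep _ length] by blast
  have R: "snd ` set ps \<subseteq> carrier R" and eq: "\<And>t. t \<in> T \<Longrightarrow> \<phi> t r = char_sum ps t"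
    using ps by (auto simp: rep_def)
  have dist: "distinct (map (\<lambda>p. restrict (char (fst p)) T) ps)"
  proof (rule ccontr)
    assume "\<not> ?thesis"
    define f where "f = (\<lambda>p :: (nat \<Rightarrow> int) \<times> 'r. restrict (char (fst p)) T)"
    have "\<not> distinct (map f ps)" using \<open>\<not> distinct _\<close> by (simp add: f_def)
    then obtain xs ys zs y where "map f ps = xs @ [y] @ ys @ [y] @ zs"
      using not_distinct_decomp by blast
    then obtain us ps1 where 1: "ps = us @ ps1" "map f ps1 = y # ys @ [y] @ zs"
      unfolding map_eq_append_conv by auto
    then obtain p ps2 where 2: "ps1 = p # ps2" "f p = y" "map f ps2 = ys @ [y] @ zs"
      by (auto simp: map_eq_Cons_conv)
    then obtain vs ps3 where 3: "ps2 = vs @ ps3" "map f ps3 = y # zs"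
      unfolding map_eq_append_conv by auto
    then obtain q ws where 4: "ps3 = q # ws" "f q = y" by (auto simp: map_eq_Cons_conv)
    have split: "ps = us @ [p] @ vs @ [q] @ ws"
      and y: "restrict (char (fst p)) T = y" "restrict (char (fst q)) T = y"
      using 1 2 3 4 by (simp_all add: f_def)
    have pq: "char (fst p) t = char (fst q) t" if "t \<in> T" for t
      using fun_cong[OF trans[OF y(1) y(2)[symmetric]], of t] that by simp
    have parts: "snd ` set us \<subseteq> carrier R" "snd p \<in> carrier R" "snd ` set vs \<subseteq> carrier R"
      "snd q \<in> carrier R" "snd ` set ws \<subseteq> carrier R" using R split by auto
    \<comment> \<open>merging the two terms with the same character shortens the representation\<close>
    define qs where "qs = us @ (fst p, snd p \<oplus> snd q) # vs @ ws"
    have "rep qs" unfolding rep_def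
    proof (intro conjI ballI)
      show "snd ` set qs \<subseteq> carrier R" using parts by (auto simp: qs_def)
      fix t assume t: "t \<in> T"
      have "char_sum ps t = char_sum qs t"
        unfolding split qs_def using parts t char_closed[OF t] pq[OF t]
        by (simp add: char_sum_append char_sum_closed image_Un R.smult_r_distr R.M.a_ac)
      then show "\<phi> t r = char_sum qs t" using eq[OF t] by simp
    qed
    from min[OF this] show False by (simp add: split qs_def)
  qed
  have weight: "snd p \<in> weight_space (fst p)" if p: "p \<in> set ps" for p
  proof -
    have "\<phi> s (snd p) = char (fst p) s \<odot> snd p" if s: "s \<in> T" for s
    proof -
      have sG: "s \<in> carrier G" using T_carrier[OF s] .
      interpret h: ring_hom_cring R R "\<phi> s" by (rule act_hom[OF sG])
      \<comment> \<open>\<open>e q\<close> vanishes if and only if \<open>s\<close> acts on the coefficient of \<open>q\<close> by the character of \<open>q\<close>\<close>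
      define e where "e q = \<phi> s (snd q) \<ominus> char (fst q) s \<odot> snd q" for q
      define qs where "qs = map (\<lambda>q. (fst q, e q)) ps"
      have e: "e q \<in> carrier R" if "snd q \<in> carrier R" for q
        using that char_closed[OF s] by (simp add: e_def)
      have sum: "char_sum (map (\<lambda>q. (fst q, e q)) xs) t = \<phi> s (char_sum xs t) \<ominus> char_sum xs (s \<otimes>\<^bsub>G\<^esub> t)"
        if "snd ` set xs \<subseteq> carrier R" "t \<in> T" for xs t
        using that(1)
      proof (induction xs)
        case (Cons x xs)
        have c: "char (fst x) s \<in> carrier K" "char (fst x) t \<in> carrier K"
          using char_closed s that by auto
        have x: "snd x \<in> carrier R" "snd ` set xs \<subseteq> carrier R" using Cons.prems by auto
        have st: "s \<otimes>\<^bsub>G\<^esub> t \<in> T" using subgroup.m_closed[OF T s(1) that(2)] .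
        have uw: "char_sum xs (s \<otimes>\<^bsub>G\<^esub> t) \<in> carrier R" "char_sum xs t \<in> carrier R"
          using char_sum_closed x st that by auto
        have "char (fst x) t \<odot> e x
          = char (fst x) t \<odot> \<phi> s (snd x) \<ominus> (char (fst x) s \<otimes>\<^bsub>K\<^esub> char (fst x) t) \<odot> snd x"
          using c x by (simp add: e_def R.M.minus_eq R.smult_r_distr R.smult_r_minus
              R.smult_assoc1[symmetric] m_comm)
        then show ?case
          using Cons.IH[OF x(2)] c x uw char_mult[OF s that(2)] scalar_linear[OF sG c(2) x(1)]
          by (simp add: R.M.minus_eq R.M.minus_add R.M.a_ac)
      qed (simp add: R.M.minus_eq)
      have "\<forall>q\<in>set qs. snd q = \<zero>"
      proof (rule characters_independent)
        show "distinct (map (\<lambda>p. restrict (char (fst p)) T) qs)" using dist by (simp add: qs_def comp_def)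
        show "snd ` set qs \<subseteq> carrier R" using R e by (auto simp: qs_def)
        fix t assume t: "t \<in> T"
        have st: "s \<otimes>\<^bsub>G\<^esub> t \<in> T" using subgroup.m_closed[OF T s(1) t] .
        have "\<phi> s (char_sum ps t) = char_sum ps (s \<otimes>\<^bsub>G\<^esub> t)"
          using eq[OF t] eq[OF st] act_mult[OF sG T_carrier[OF t] r] by simp
        then show "char_sum qs t = \<zero>"
          using sum[OF R t] char_sum_closed[OF R st] by (simp add: qs_def R.M.minus_eq R.M.r_neg)
      qed
      then have "e p = \<zero>" using p by (auto simp: qs_def)
      moreover have "snd p \<in> carrier R" using p R by auto
      ultimately show ?thesis using char_closed[OF s] by (simp add: e_def)
    qed
    then show ?thesis using p R by (auto simp: weight_space_def)
  qed
  interpret H: additive_subgroup H R by fact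
  have "char_sum qs \<one>\<^bsub>G\<^esub> \<in> H" if "set qs \<subseteq> set ps" for qs
    using that
  proof (induction qs)
    case (Cons q qs)
    then have "snd q \<in> H" "snd q \<in> carrier R" using weight[of q] sub R by auto
    then show ?case using Cons by (simp add: char_one)
  qed simp
  moreover have "\<one>\<^bsub>G\<^esub> \<in> T" using subgroup.one_closed[OF T] .
  ultimately show ?thesis using eq[of "\<one>\<^bsub>G\<^esub>"] act_one[OF r] by simp
qed

end

section \<open>Congruences modulo ideals and local finiteness\<close>

context ideal
begin

lemma minus_mem_refl: "x \<in> carrier R \<Longrightarrow> x \<ominus> x \<in> I"
  by (simp add: minus_eq r_neg zero_closed)

lemma minus_mem_sym: "\<lbrakk>x \<in> carrier R; y \<in> carrier R; x \<ominus> y \<in> I\<rbrakk> \<Longrightarrow> y \<ominus> x \<in> I"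
proof -
  assume "x \<in> carrier R" "y \<in> carrier R" and I: "x \<ominus> y \<in> I"
  then have "y \<ominus> x = \<ominus> (x \<ominus> y)" by (simp add: minus_eq minus_add a_comm)
  then show ?thesis using I_l_closed[OF I, of "\<ominus> \<one>"] \<open>x \<in> carrier R\<close> \<open>y \<in> carrier R\<close> by (simp add: l_minus)
qed

lemma minus_mem_trans:
  "\<lbrakk>x \<in> carrier R; y \<in> carrier R; z \<in> carrier R; x \<ominus> y \<in> I; y \<ominus> z \<in> I\<rbrakk> \<Longrightarrow> x \<ominus> z \<in> I"
proof -
  assume *: "x \<in> carrier R" "y \<in> carrier R" "z \<in> carrier R" and I: "x \<ominus> y \<in> I" "y \<ominus> z \<in> I"
  have "\<ominus> y \<oplus> (y \<oplus> \<ominus> z) = \<ominus> z" using * by (simp add: r_neg1)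
  then have "x \<ominus> z = (x \<ominus> y) \<oplus> (y \<ominus> z)" using * by (simp add: minus_eq a_assoc)
  then show ?thesis using additive_subgroup.a_closed[OF additive_subgroup_axioms, OF I] by simp
qed

lemma minus_mem_add:
  "\<lbrakk>x \<in> carrier R; y \<in> carrier R; u \<in> carrier R; v \<in> carrier R; x \<ominus> y \<in> I; u \<ominus> v \<in> I\<rbrakk>
   \<Longrightarrow> (x \<oplus> u) \<ominus> (y \<oplus> v) \<in> I"
proof -
  assume *: "x \<in> carrier R" "y \<in> carrier R" "u \<in> carrier R" "v \<in> carrier R"
    and I: "x \<ominus> y \<in> I" "u \<ominus> v \<in> I"
  have "(x \<oplus> u) \<ominus> (y \<oplus> v) = (x \<ominus> y) \<oplus> (u \<ominus> v)" using * by (simp add: minus_eq minus_add a_ac)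
  then show ?thesis using additive_subgroup.a_closed[OF additive_subgroup_axioms, OF I] by simp
qed

lemma minus_mem_mult:
  "\<lbrakk>x \<in> carrier R; y \<in> carrier R; u \<in> carrier R; v \<in> carrier R; x \<ominus> y \<in> I; u \<ominus> v \<in> I\<rbrakk>
   \<Longrightarrow> x \<otimes> u \<ominus> y \<otimes> v \<in> I"
proof -
  assume *: "x \<in> carrier R" "y \<in> carrier R" "u \<in> carrier R" "v \<in> carrier R"
    and I: "x \<ominus> y \<in> I" "u \<ominus> v \<in> I"
  have "x \<otimes> u \<ominus> y \<otimes> u \<in> I"
    using I_r_closed[OF I(1) *(3)] * by (simp add: minus_eq l_distr l_minus)
  moreover have "y \<otimes> u \<ominus> y \<otimes> v \<in> I"
    using I_l_closed[OF I(2) *(2)] * by (simp add: minus_eq r_distr r_minus)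
  ultimately show ?thesis using minus_mem_trans[of "x \<otimes> u" "y \<otimes> u" "y \<otimes> v"] * by simp
qed

lemma mem_iff_of_minus_mem: "\<lbrakk>x \<in> carrier R; y \<in> carrier R; x \<ominus> y \<in> I\<rbrakk> \<Longrightarrow> x \<in> I \<longleftrightarrow> y \<in> I"
proof -
  have imp: "x \<in> I" if "x \<in> carrier R" "y \<in> carrier R" "x \<ominus> y \<in> I" "y \<in> I" for x y
  proof -
    have "x = (x \<ominus> y) \<oplus> y" using that(1,2) by (simp add: minus_eq a_assoc l_neg)
    then show ?thesis using additive_subgroup.a_closed[OF additive_subgroup_axioms, OF that(3,4)] by simp
  qed
  assume *: "x \<in> carrier R" "y \<in> carrier R" "x \<ominus> y \<in> I"
  then show "x \<in> I \<longleftrightarrow> y \<in> I" using imp[of x y] imp[of y x] minus_mem_sym by blast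
qed

end

lemma (in algebra) ideal_smult_closed:
  assumes "ideal I M" "c \<in> carrier R" "x \<in> I"
  shows "c \<odot>\<^bsub>M\<^esub> x \<in> I"
proof -
  interpret I: ideal I M by fact
  have "(c \<odot>\<^bsub>M\<^esub> \<one>\<^bsub>M\<^esub>) \<otimes>\<^bsub>M\<^esub> x = c \<odot>\<^bsub>M\<^esub> x"
    using assms I.Icarr by (simp add: smult_assoc2)
  then show ?thesis using I.I_l_closed[OF assms(3), of "c \<odot>\<^bsub>M\<^esub> \<one>\<^bsub>M\<^esub>"] assms(2) by simp
qed

lemma (in algebra) ideal_smult_cancel:
  assumes "field R" "ideal I M" "c \<in> carrier R - {\<zero>}" "x \<in> carrier M" "c \<odot>\<^bsub>M\<^esub> x \<in> I"
  shows "x \<in> I"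
proof -
  interpret K: field R by fact
  have c: "inv c \<in> carrier R" "inv c \<otimes> c = \<one>" using assms(3) K.field_Units by auto
  have "inv c \<odot>\<^bsub>M\<^esub> (c \<odot>\<^bsub>M\<^esub> x) = x" using assms(3,4) c smult_assoc1[of "inv c" c x] by simp
  then show ?thesis using ideal_smult_closed[OF assms(2) c(1) assms(5)] by simp
qed

context regular_action
begin

lemma
  assumes g: "g \<in> carrier G"
  shows act_ring_one: "\<phi> g \<one>\<^bsub>R\<^esub> = \<one>\<^bsub>R\<^esub>"
    and act_zero: "\<phi> g \<zero>\<^bsub>R\<^esub> = \<zero>\<^bsub>R\<^esub>"
    and act_ring_mult: "\<lbrakk>x \<in> carrier R; y \<in> carrier R\<rbrakk> \<Longrightarrow> \<phi> g (x \<otimes>\<^bsub>R\<^esub> y) = \<phi> g x \<otimes>\<^bsub>R\<^esub> \<phi> g y"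
    and act_add: "\<lbrakk>x \<in> carrier R; y \<in> carrier R\<rbrakk> \<Longrightarrow> \<phi> g (x \<oplus>\<^bsub>R\<^esub> y) = \<phi> g x \<oplus>\<^bsub>R\<^esub> \<phi> g y"
    and act_uminus: "x \<in> carrier R \<Longrightarrow> \<phi> g (\<ominus>\<^bsub>R\<^esub> x) = \<ominus>\<^bsub>R\<^esub> \<phi> g x"
proof -
  interpret h: ring_hom_cring R R "\<phi> g" by (rule act_hom[OF g])
  show "\<phi> g \<one>\<^bsub>R\<^esub> = \<one>\<^bsub>R\<^esub>" "\<phi> g \<zero>\<^bsub>R\<^esub> = \<zero>\<^bsub>R\<^esub>" by simp_all
  show "\<phi> g (x \<otimes>\<^bsub>R\<^esub> y) = \<phi> g x \<otimes>\<^bsub>R\<^esub> \<phi> g y" "\<phi> g (x \<oplus>\<^bsub>R\<^esub> y) = \<phi> g x \<oplus>\<^bsub>R\<^esub> \<phi> g y"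
    if "x \<in> carrier R" "y \<in> carrier R" using that by simp_all
  show "\<phi> g (\<ominus>\<^bsub>R\<^esub> x) = \<ominus>\<^bsub>R\<^esub> \<phi> g x" if "x \<in> carrier R" using that by simp
qed

lemma fixed_subring:
  assumes "H \<subseteq> carrier G"
  shows "subring {r \<in> carrier R. \<forall>g\<in>H. \<phi> g r = r} R"
proof (rule R.subringI)
  have H: "g \<in> carrier G" if "g \<in> H" for g using assms that by blast
  show "\<one>\<^bsub>R\<^esub> \<in> {r \<in> carrier R. \<forall>g\<in>H. \<phi> g r = r}"
    using act_ring_one[OF H] by simp
  show "\<ominus>\<^bsub>R\<^esub> h \<in> {r \<in> carrier R. \<forall>g\<in>H. \<phi> g r = r}" if "h \<in> {r \<in> carrier R. \<forall>g\<in>H. \<phi> g r = r}" for h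
    using act_uminus[OF H] that by simp
  fix x y assume xy: "x \<in> {r \<in> carrier R. \<forall>g\<in>H. \<phi> g r = r}" "y \<in> {r \<in> carrier R. \<forall>g\<in>H. \<phi> g r = r}"
  show "x \<otimes>\<^bsub>R\<^esub> y \<in> {r \<in> carrier R. \<forall>g\<in>H. \<phi> g r = r}"
    using act_ring_mult[OF H] xy by simp
  show "x \<oplus>\<^bsub>R\<^esub> y \<in> {r \<in> carrier R. \<forall>g\<in>H. \<phi> g r = r}"
    using act_add[OF H] xy by simp
qed auto

text \<open>The powers of \<open>g\<close> move \<open>r\<close> within a finite-dimensional subspace, so they satisfy a linear relation.
  Because \<open>g\<close> acts injectively, the relation can be divided by powers of \<open>g\<close> until its constant
  term, the last entry of the list, is nonzero.\<close>

lemma ex_orbit_dependence: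
  assumes g: "g \<in> carrier G" and r: "r \<in> carrier R"
  shows "\<exists>cs. set cs \<subseteq> carrier K \<and> cs \<noteq> [] \<and> last cs \<noteq> \<zero> \<and> lincomb R cs (\<lambda>k. (\<phi> g ^^ k) r) = \<zero>\<^bsub>R\<^esub>"
proof -
  interpret h: ring_hom_cring R R "\<phi> g" by (rule act_hom[OF g])
  define u where "u k = (\<phi> g ^^ k) r" for k
  have u: "u k \<in> carrier R" for k by (induction k) (auto simp: u_def r g act_closed)
  have uS: "u \<circ> Suc = (\<lambda>k. \<phi> g (u k))" by (auto simp: u_def)
  obtain N :: nat and v c m where v: "\<forall>i<N. v i \<in> carrier R" and c: "\<forall>i<N. c i \<in> carrier K"
    and rsum: "r = (\<Oplus>\<^bsub>R\<^esub>i\<in>{..<N}. c i \<odot>\<^bsub>R\<^esub> v i)"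
    and m: "\<forall>i<N. \<forall>j<N. m i j \<in> A"
    and act: "\<forall>g\<in>carrier G. \<forall>j<N. \<phi> g (v j) = (\<Oplus>\<^bsub>R\<^esub>i\<in>{..<N}. m i j g \<odot>\<^bsub>R\<^esub> v i)"
    by (rule ex_stable_span[OF r]) (rule that)
  note v = v[rule_format] and m = m[rule_format] and act = act[rule_format, OF g]
  \<comment> \<open>the span of \<open>v\<close>, a stable subspace that contains \<open>r\<close>\<close>
  define E where "E = {w. \<exists>c. (\<forall>i<N. c i \<in> carrier K) \<and> w = (\<Oplus>\<^bsub>R\<^esub>i\<in>{..<N}. c i \<odot>\<^bsub>R\<^esub> v i)}"
  have E0: "\<zero>\<^bsub>R\<^esub> \<in> E"
  proof -
    have "(\<Oplus>\<^bsub>R\<^esub>i\<in>{..<N}. \<zero> \<odot>\<^bsub>R\<^esub> v i) = (\<Oplus>\<^bsub>R\<^esub>i\<in>{..<N}. \<zero>\<^bsub>R\<^esub>)"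
      by (rule R.M.finsum_cong') (use v in auto)
    then show ?thesis unfolding E_def by (intro CollectI exI[of _ "\<lambda>_. \<zero>"]) simp
  qed
  have Eadd: "x \<oplus>\<^bsub>R\<^esub> c \<odot>\<^bsub>R\<^esub> y \<in> E" if xE: "x \<in> E" and yE: "y \<in> E" and c: "c \<in> carrier K" for x y c
  proof -
    obtain a b where a: "\<forall>i<N. a i \<in> carrier K" "x = (\<Oplus>\<^bsub>R\<^esub>i\<in>{..<N}. a i \<odot>\<^bsub>R\<^esub> v i)"
      and b: "\<forall>i<N. b i \<in> carrier K" "y = (\<Oplus>\<^bsub>R\<^esub>i\<in>{..<N}. b i \<odot>\<^bsub>R\<^esub> v i)"
      using xE yE unfolding E_def by auto
    have "x \<oplus>\<^bsub>R\<^esub> c \<odot>\<^bsub>R\<^esub> y = x \<oplus>\<^bsub>R\<^esub> (\<Oplus>\<^bsub>R\<^esub>i\<in>{..<N}. c \<odot>\<^bsub>R\<^esub> (b i \<odot>\<^bsub>R\<^esub> v i))"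
      unfolding b(2) using b(1) v c by (subst R.finsum_smult_ldistr) auto
    also have "\<dots> = (\<Oplus>\<^bsub>R\<^esub>i\<in>{..<N}. a i \<odot>\<^bsub>R\<^esub> v i \<oplus>\<^bsub>R\<^esub> c \<odot>\<^bsub>R\<^esub> (b i \<odot>\<^bsub>R\<^esub> v i))"
      unfolding a(2) using a(1) b(1) v c by (subst R.M.finsum_addf) auto
    also have "\<dots> = (\<Oplus>\<^bsub>R\<^esub>i\<in>{..<N}. (a i \<oplus> c \<otimes> b i) \<odot>\<^bsub>R\<^esub> v i)"
      using a(1) b(1) v c by (intro R.M.finsum_cong') (auto simp: R.smult_l_distr R.smult_assoc1)
    finally show ?thesis unfolding E_def
      using a(1) b(1) c by (intro CollectI exI[of _ "\<lambda>i. a i \<oplus> c \<otimes> b i"]) auto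
  qed
  have coord_val: "f x \<in> carrier K" if "f \<in> A" "x \<in> carrier G" for f x
    using that subringE(1)[of A "fun_algebra K (carrier G)"] coord_subalgebra
    unfolding smult_subalgebra_def fun_algebra_def by auto
  have Eact: "\<phi> g w \<in> E" if w: "w \<in> E" for w
  proof -
    obtain c where c: "\<And>i. i < N \<Longrightarrow> c i \<in> carrier K" and w: "w = (\<Oplus>\<^bsub>R\<^esub>i\<in>{..<N}. c i \<odot>\<^bsub>R\<^esub> v i)"
      using w unfolding E_def by auto
    have "\<phi> g (\<Oplus>\<^bsub>R\<^esub>i\<in>{..<M}. c i \<odot>\<^bsub>R\<^esub> v i) \<in> E" if "M \<le> N" for M
      using that
    proof (induction M)
      case (Suc M)
      have M: "M < N" using Suc.prems by simp
      have vE: "\<phi> g (v M) \<in> E" 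
        unfolding act[OF M] E_def using coord_val[OF m g] M
        by (intro CollectI exI[of _ "\<lambda>i. m i M g"] conjI refl) simp
      have "(\<Oplus>\<^bsub>R\<^esub>i\<in>{..<Suc M}. c i \<odot>\<^bsub>R\<^esub> v i) = c M \<odot>\<^bsub>R\<^esub> v M \<oplus>\<^bsub>R\<^esub> (\<Oplus>\<^bsub>R\<^esub>i\<in>{..<M}. c i \<odot>\<^bsub>R\<^esub> v i)"
        using c v M by (simp add: lessThan_Suc R.M.finsum_insert Pi_iff)
      moreover have S: "(\<Oplus>\<^bsub>R\<^esub>i\<in>{..<M}. c i \<odot>\<^bsub>R\<^esub> v i) \<in> carrier R"
        using c v M by (intro R.M.finsum_closed) auto
      ultimately have "\<phi> g (\<Oplus>\<^bsub>R\<^esub>i\<in>{..<Suc M}. c i \<odot>\<^bsub>R\<^esub> v i)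
          = \<phi> g (\<Oplus>\<^bsub>R\<^esub>i\<in>{..<M}. c i \<odot>\<^bsub>R\<^esub> v i) \<oplus>\<^bsub>R\<^esub> c M \<odot>\<^bsub>R\<^esub> \<phi> g (v M)"
        using c[OF M] v[OF M] scalar_linear[OF g c[OF M] v[OF M]] by (simp add: R.M.a_comm)
      then show ?case using Eadd[OF Suc.IH vE c[OF M]] M by simp
    qed (use E0 in simp)
    from this[of N] show ?thesis by (simp add: w)
  qed
  have "u k \<in> E" for k
  proof (induction k)
    case 0
    show ?case using c rsum by (auto simp: u_def E_def)
  next
    case (Suc k)
    then show ?case using Eact by (simp add: u_def)
  qed
  then have "\<forall>k. \<exists>c. (\<forall>i<N. c i \<in> carrier K) \<and> u k = (\<Oplus>\<^bsub>R\<^esub>i\<in>{..<N}. c i \<odot>\<^bsub>R\<^esub> v i)"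
    by (simp add: E_def)
  then obtain x where x: "\<forall>k. (\<forall>i<N. x k i \<in> carrier K) \<and> u k = (\<Oplus>\<^bsub>R\<^esub>i\<in>{..<N}. x k i \<odot>\<^bsub>R\<^esub> v i)"
    by (rule choice[THEN exE])
  obtain c where c: "\<forall>k\<in>{..<Suc N}. c k \<in> carrier K" "\<exists>k\<in>{..<Suc N}. c k \<noteq> \<zero>"
    "(\<Oplus>\<^bsub>R\<^esub>k\<in>{..<Suc N}. c k \<odot>\<^bsub>R\<^esub> u k) = \<zero>\<^bsub>R\<^esub>"
    using R.ex_linear_dependence[OF field_axioms, of N v "{..<Suc N}" x u] v x by auto
  have "\<exists>cs. set cs \<subseteq> carrier K \<and> cs \<noteq> [] \<and> last cs \<noteq> \<zero> \<and> lincomb R cs u = \<zero>\<^bsub>R\<^esub>"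
    if "set cs \<subseteq> carrier K" "\<not> set cs \<subseteq> {\<zero>}" "lincomb R cs u = \<zero>\<^bsub>R\<^esub>" for cs
    using that
  proof (induction cs rule: rev_induct)
    case (snoc d ds)
    show ?case
    proof (cases "d = \<zero>")
      case True
      have ds: "set ds \<subseteq> carrier K" using snoc.prems by simp
      have hom: "lincomb R es (\<lambda>k. \<phi> g (u k)) = \<phi> g (lincomb R es u)" if "set es \<subseteq> carrier K" for es
        using that
      proof (induction es)
        case (Cons e es)
        then show ?case using u R.lincomb_closed[of es u] scalar_linear[OF g _ u] by simp
      qed simp
      have "\<phi> g (lincomb R ds u) = \<zero>\<^bsub>R\<^esub>"
        using snoc.prems(3) R.lincomb_snoc[OF ds zero_closed u] True u R.lincomb_closed[OF ds u] g
        by (simp add: uS hom[OF ds] act_closed)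
      then have "lincomb R ds u = \<zero>\<^bsub>R\<^esub>" using act_eq_zero_iff[OF g R.lincomb_closed[OF ds u]] by simp
      then show ?thesis using snoc.IH[OF ds] snoc.prems(2) True by simp
    next
      case False
      then show ?thesis using snoc.prems by (intro exI[of _ "ds @ [d]"]) simp
    qed
  qed simp
  from this[of "map c (rev [0..<Suc N])"] show ?thesis
    using c R.lincomb_eq_finsum[of "Suc N" c u] u unfolding u_def[symmetric] by (force simp del: upt_Suc)
qed

end

section \<open>Eigenvalues modulo a prime\<close>

locale central_torus_action = torus_action K G A R \<phi> T n \<psi>
  for K :: "('k, 'm) ring_scheme" and G :: "('g, 'n) monoid_scheme" and A
    and R :: "('k, 'r, 's) module_scheme" (structure) and \<phi> and T n \<psi> +
  assumes krull: "krull_domain R"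
    and central: "\<lbrakk>g \<in> carrier G; t \<in> T\<rbrakk> \<Longrightarrow> g \<otimes>\<^bsub>G\<^esub> t = t \<otimes>\<^bsub>G\<^esub> g"
    and fixed_fractions: "carrier (fixed_ring (frac_action \<phi>) T (total_quotient R)) =
      total_quotient_embed R ` carrier (total_quotient (fixed_ring \<phi> T R))"
begin

sublocale RD: domain R
  using krull[unfolded krull_domain_def] by (rule conjunct1)

definition invariants :: "'r set" where
  "invariants = {r \<in> carrier R. \<forall>t\<in>T. \<phi> t r = r}"

lemma fixed_ring_eq: "fixed_ring \<phi> T R = R\<lparr>carrier := invariants\<rparr>"
  by (simp add: fixed_ring_def invariants_def)

lemma invariants_subring: "subring invariants R"
  unfolding invariants_def using T_carrier by (intro fixed_subring) auto

lemma invariants_closed: "x \<in> invariants \<Longrightarrow> x \<in> carrier R"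
  by (simp add: invariants_def)

lemma invariants_saturated:
  assumes y: "y \<in> invariants - {\<zero>}" and q: "q \<in> carrier R" and yq: "y \<otimes> q \<in> invariants"
  shows "q \<in> invariants"
proof -
  have "\<phi> t q = q" if t: "t \<in> T" for t
  proof -
    have tG: "t \<in> carrier G" using T_carrier[OF t] .
    have yR: "y \<in> carrier R" "y \<noteq> \<zero>" "\<phi> t y = y" using y t by (auto simp: invariants_def)
    have "y \<otimes> \<phi> t q = \<phi> t (y \<otimes> q)" using act_ring_mult[OF tG yR(1) q] yR by simp
    also have "\<dots> = y \<otimes> q" using yq t by (simp add: invariants_def)
    finally show ?thesis using RD.m_lcancel[of y "\<phi> t q" q] yR q act_closed[OF tG q] by simp
  qed
  then show ?thesis using q by (simp add: invariants_def)
qed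

lemma act_weight_space:
  assumes g: "g \<in> carrier G" and r: "r \<in> weight_space a"
  shows "\<phi> g r \<in> weight_space a"
proof -
  have rR: "r \<in> carrier R" using r by (simp add: weight_space_def)
  have "\<phi> t (\<phi> g r) = char a t \<odot> \<phi> g r" if t: "t \<in> T" for t
  proof -
    have tG: "t \<in> carrier G" using T_carrier[OF t] .
    have "\<phi> t (\<phi> g r) = \<phi> g (\<phi> t r)"
      using act_mult[OF tG g rR] act_mult[OF g tG rR] central[OF g t] by simp
    also have "\<dots> = \<phi> g (char a t \<odot> r)" using r t by (simp add: weight_space_def)
    finally show ?thesis using scalar_linear[OF g char_closed[OF t] rR] by simp
  qed
  then show ?thesis using act_closed[OF g rR] by (simp add: weight_space_def)
qed

lemma invariants_eq_weight_space: "invariants = weight_space (\<lambda>_. 0)"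
  by (auto simp: invariants_def weight_space_def char_zero)

lemma act_invariants: "\<lbrakk>g \<in> carrier G; x \<in> invariants\<rbrakk> \<Longrightarrow> \<phi> g x \<in> invariants"
  unfolding invariants_eq_weight_space by (rule act_weight_space)

text \<open>The fraction \<open>s / r\<close> of two vectors of the same weight is fixed by \<open>T\<close>, hence by hypothesis a
  fraction of invariants.\<close>

lemma weight_spaces_proportional:
  assumes r: "r \<in> weight_space a" "r \<noteq> \<zero>" and s: "s \<in> weight_space a" "s \<noteq> \<zero>"
  shows "\<exists>x\<in>invariants - {\<zero>}. \<exists>y\<in>invariants - {\<zero>}. x \<otimes> s = y \<otimes> r"
proof -
  have rR: "r \<in> carrier R - {\<zero>}" and sR: "s \<in> carrier R - {\<zero>}"
    using r s by (auto simp: weight_space_def)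
  have scale: "\<phi> t u = char a t \<odot> u" if "t \<in> T" "u \<in> weight_space a" for t u
    using that by (simp add: weight_space_def)
  have mem: "(\<phi> t c, \<phi> t d) \<in> fraction R s r" if t: "t \<in> T" and cd: "(c, d) \<in> fraction R s r" for t c d
  proof -
    have tG: "t \<in> carrier G" using T_carrier[OF t] .
    have c: "c \<in> carrier R" "d \<in> carrier R - {\<zero>}" "s \<otimes> d = c \<otimes> r"
      using cd by (auto simp: fraction_def RD.nonzerodivisors_eq)
    have k: "char a t \<in> carrier K - {\<zero>\<^bsub>K\<^esub>}" using char_nonzero[OF t] .
    have cl: "\<phi> t c \<in> carrier R" "\<phi> t d \<in> carrier R" using act_closed[OF tG] c by auto
    have "char a t \<odot> (s \<otimes> \<phi> t d) = \<phi> t s \<otimes> \<phi> t d"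
      using scale[OF t s(1)] k cl sR by (simp add: R.smult_assoc2)
    also have "\<dots> = \<phi> t c \<otimes> \<phi> t r"
      using act_ring_mult[OF tG, of s d] act_ring_mult[OF tG, of c r] c rR sR by simp
    also have "\<dots> = char a t \<odot> (\<phi> t c \<otimes> r)"
      using scale[OF t r(1)] k cl rR by (simp add: R.smult_assoc3)
    finally have eq: "char a t \<odot> (s \<otimes> \<phi> t d) = char a t \<odot> (\<phi> t c \<otimes> r)" .
    have "u = v" if "u \<in> carrier R" "v \<in> carrier R" "char a t \<odot> u = char a t \<odot> v" for u v
    proof -
      have i: "inv\<^bsub>K\<^esub> (char a t) \<in> carrier K" "inv\<^bsub>K\<^esub> (char a t) \<otimes>\<^bsub>K\<^esub> char a t = \<one>\<^bsub>K\<^esub>" using k field_Units by auto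
      have "inv\<^bsub>K\<^esub> (char a t) \<odot> (char a t \<odot> w) = w" if "w \<in> carrier R" for w
        using R.smult_assoc1[OF i(1), of "char a t" w] k i(2) that by simp
      then show ?thesis using that by metis
    qed
    then have "s \<otimes> \<phi> t d = \<phi> t c \<otimes> r" using eq cl rR sR by simp
    moreover have "\<phi> t d \<noteq> \<zero>" using act_eq_zero_iff[OF tG, of d] c by simp
    ultimately show ?thesis using cl by (simp add: fraction_def RD.nonzerodivisors_eq)
  qed
  have "frac_action \<phi> t (fraction R s r) = fraction R s r" if t: "t \<in> T" for t
  proof
    show "frac_action \<phi> t (fraction R s r) \<subseteq> fraction R s r"
      using mem[OF t] by (auto simp: frac_action_def)
    show "fraction R s r \<subseteq> frac_action \<phi> t (fraction R s r)"
    proof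
      fix z assume z: "z \<in> fraction R s r"
      obtain c d where cd: "z = (c, d)" by (cases z)
      have R: "c \<in> carrier R" "d \<in> carrier R" using z cd by (auto simp: fraction_def RD.nonzerodivisors_eq)
      have "inv\<^bsub>G\<^esub> t \<in> T" using subgroup.m_inv_closed[OF T t] .
      then have "(\<phi> (inv\<^bsub>G\<^esub> t) c, \<phi> (inv\<^bsub>G\<^esub> t) d) \<in> fraction R s r" using mem z cd by blast
      moreover have "z = map_prod (\<phi> t) (\<phi> t) (\<phi> (inv\<^bsub>G\<^esub> t) c, \<phi> (inv\<^bsub>G\<^esub> t) d)"
        using act_inv'[OF T_carrier[OF t]] R cd by simp
      ultimately show "z \<in> frac_action \<phi> t (fraction R s r)" unfolding frac_action_def by (rule rev_image_eqI)
    qed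
  qed
  then have "fraction R s r \<in> carrier (fixed_ring (frac_action \<phi>) T (total_quotient R))"
    using sR rR by (auto simp: fixed_ring_def total_quotient_def RD.nonzerodivisors_eq)
  then obtain z where z: "z \<in> carrier (total_quotient (fixed_ring \<phi> T R))"
    and eq: "fraction R s r = total_quotient_embed R z"
    unfolding fixed_fractions by blast
  interpret RT: domain "R\<lparr>carrier := invariants\<rparr>" by (rule RD.subring_is_domain[OF invariants_subring])
  obtain x y where xy: "x \<in> invariants" "y \<in> invariants - {\<zero>}"
    and zxy: "z = fraction (R\<lparr>carrier := invariants\<rparr>) x y"
    using z unfolding fixed_ring_eq total_quotient_def RT.nonzerodivisors_eq by auto
  have xyR: "x \<in> carrier R" "y \<in> carrier R - {\<zero>}" using xy invariants_closed by auto
  have "(x, y) \<in> z" unfolding zxy using RT.fraction_refl[of x y] xy by simp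
  then have "fraction R x y \<subseteq> fraction R s r" unfolding eq total_quotient_embed_def by auto
  then have "(x, y) \<in> fraction R s r" using RD.fraction_refl[OF xyR] by blast
  then have sy: "s \<otimes> y = x \<otimes> r" by (simp add: fraction_def)
  have "s \<otimes> y \<noteq> \<zero>" using RD.integral[of s y] sR xyR by auto
  then have "x \<noteq> \<zero>" using sy rR by auto
  moreover have "y \<otimes> s = x \<otimes> r" using sy R.m_comm[of s y] sR xyR by simp
  ultimately show ?thesis using xy by blast
qed

end

text \<open>A prime \<open>P\<close> of \<open>R\<close> over a prime \<open>p\<close> of height one of \<open>R\<^sup>T\<close>. An element \<open>g\<close> of the inertia group of
  \<open>p\<close> is to be corrected by an element of \<open>T\<close> so that it acts trivially on \<open>R / P\<close>.\<close>

locale inertia_lifting = central_torus_action K G A R \<phi> T n \<psi>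
  for K :: "('k, 'm) ring_scheme" and G :: "('g, 'n) monoid_scheme" and A
    and R :: "('k, 'r, 's) module_scheme" (structure) and \<phi> and T n \<psi> +
  fixes P p :: "'r set"
  assumes P: "primeideal P R"
    and contr: "P \<inter> invariants = p"
    and p_spec: "p \<in> Spec (R\<lparr>carrier := invariants\<rparr>)"
    and p_height: "height (R\<lparr>carrier := invariants\<rparr>) p = 1"
begin

sublocale P: primeideal P R by (rule P)

text \<open>The local ring of \<open>R\<^sup>T\<close> at \<open>p\<close> is a valuation ring, so numerator and denominator of the fraction
  \<open>s / r\<close> can be chosen not both in \<open>p\<close>.\<close>

lemma weight_spaces_locally_proportional:
  assumes r: "r \<in> weight_space a" "r \<noteq> \<zero>" and s: "s \<in> weight_space a" "s \<noteq> \<zero>"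
  shows "\<exists>x\<in>invariants. \<exists>y\<in>invariants. x \<otimes> s = y \<otimes> r \<and> (x \<notin> P \<or> y \<notin> P)"
proof -
  obtain V where V: "krull_family R V" using krull_domain_imp_krull_family[OF krull] by blast
  interpret V: krull_family "R\<lparr>carrier := invariants\<rparr>" V
    using krull_family.krull_family_subring[OF V invariants_subring invariants_saturated] .
  obtain x y where xy: "x \<in> invariants - {\<zero>}" "y \<in> invariants - {\<zero>}" "x \<otimes> s = y \<otimes> r"
    using weight_spaces_proportional[OF r s] by blast
  obtain x' y' where *: "x' \<in> invariants" "y' \<in> invariants" "x \<otimes> y' = x' \<otimes> y" "x' \<notin> p \<or> y' \<notin> p"
    using V.height_one_imp_valuation_ring[OF p_spec p_height, of x y] xy by auto
  have R: "x \<in> carrier R" "y \<in> carrier R" "x' \<in> carrier R" "y' \<in> carrier R" "r \<in> carrier R" "s \<in> carrier R"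
    using xy * r s invariants_closed by (auto simp: weight_space_def)
  have "y \<otimes> (x' \<otimes> s) = (x' \<otimes> y) \<otimes> s" using R by (simp add: R.m_ac)
  also have "\<dots> = y' \<otimes> (x \<otimes> s)" unfolding *(3)[symmetric] using R by (simp add: R.m_ac)
  also have "\<dots> = y \<otimes> (y' \<otimes> r)" unfolding xy(3) using R by (simp add: R.m_ac)
  finally have "x' \<otimes> s = y' \<otimes> r" using RD.m_lcancel[of y "x' \<otimes> s" "y' \<otimes> r"] xy(2) R by simp
  moreover have "x' \<notin> P \<or> y' \<notin> P" using *(1,2,4) contr by blast
  ultimately show ?thesis using *(1,2) by blast
qed

definition trivial_mod :: "'g \<Rightarrow> bool" where
  "trivial_mod g \<longleftrightarrow> g \<in> carrier G \<and> (\<forall>x\<in>invariants. \<phi> g x \<ominus> x \<in> P)"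

lemma trivial_mod_inv:
  assumes g: "trivial_mod g"
  shows "trivial_mod (inv\<^bsub>G\<^esub> g)"
proof -
  have gG: "g \<in> carrier G" using g by (simp add: trivial_mod_def)
  have "\<phi> (inv\<^bsub>G\<^esub> g) x \<ominus> x \<in> P" if x: "x \<in> invariants" for x
  proof -
    have y: "\<phi> (inv\<^bsub>G\<^esub> g) x \<in> invariants" using act_invariants x gG by simp
    then have "x \<ominus> \<phi> (inv\<^bsub>G\<^esub> g) x \<in> P"
      using g act_inv'[OF gG invariants_closed[OF x]] unfolding trivial_mod_def by metis
    then show ?thesis using P.minus_mem_sym[OF invariants_closed[OF x] invariants_closed[OF y]] by blast
  qed
  then show ?thesis using gG by (simp add: trivial_mod_def)
qed

lemma trivial_mod_funpow:
  assumes g: "trivial_mod g" and x: "x \<in> invariants"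
  shows "(\<phi> g ^^ k) x \<in> invariants \<and> (\<phi> g ^^ k) x \<ominus> x \<in> P"
proof (induction k)
  case 0
  show ?case using x P.minus_mem_refl[OF invariants_closed[OF x]] by simp
next
  case (Suc k)
  have gG: "g \<in> carrier G" using g by (simp add: trivial_mod_def)
  have y: "(\<phi> g ^^ Suc k) x \<in> invariants" using act_invariants[OF gG] Suc by simp
  have "(\<phi> g ^^ Suc k) x \<ominus> (\<phi> g ^^ k) x \<in> P" using g Suc by (simp add: trivial_mod_def)
  then show ?case
    using P.minus_mem_trans[OF invariants_closed[OF y] invariants_closed[OF conjunct1[OF Suc]]
        invariants_closed[OF x]] Suc y by blast
qed

text \<open>Write \<open>\<phi> g r = (w / h) r\<close> with invariants \<open>w\<close> and \<open>h\<close>, where \<open>h \<notin> P\<close>. As \<open>g\<close> acts trivially on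
  \<open>R\<^sup>T / p\<close>, its \<open>k\<close>-th power multiplies \<open>r\<close> modulo \<open>P\<close> by the \<open>k\<close>-th power of \<open>w / h\<close>. Since the orbit
  of \<open>r\<close> under the powers of \<open>g\<close> spans a finite-dimensional space, \<open>w / h\<close> is algebraic over \<open>K\<close>
  modulo \<open>P\<close>, hence a scalar \<open>l\<close>. It is nonzero because the relation has a nonzero constant term.
  Divisions are avoided by multiplying with powers of \<open>h\<close>.\<close>

lemma ex_eigenvalue_mod:
  assumes g: "trivial_mod g" and r: "r \<in> weight_space a" "r \<notin> P"
  shows "\<exists>l\<in>carrier K - {\<zero>\<^bsub>K\<^esub>}. \<phi> g r \<ominus> l \<odot> r \<in> P"
proof -
  have gG: "g \<in> carrier G" using g by (simp add: trivial_mod_def)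
  have rR: "r \<in> carrier R" using r by (simp add: weight_space_def)
  have "r \<noteq> \<zero>" using r(2) P.zero_closed by auto
  moreover have "\<phi> g r \<noteq> \<zero>" using calculation act_eq_zero_iff[OF gG rR] by simp
  ultimately obtain h w where hw: "h \<in> invariants" "w \<in> invariants"
    and hr: "h \<otimes> \<phi> g r = w \<otimes> r" and or: "h \<notin> P \<or> w \<notin> P"
    using weight_spaces_locally_proportional[OF r(1) _ act_weight_space[OF gG r(1)]] by blast
  have hR: "h \<in> carrier R" "w \<in> carrier R" using hw invariants_closed by auto
  have hP: "h \<notin> P"
  proof
    assume "h \<in> P"
    then have "w \<otimes> r \<in> P" using P.I_r_closed[OF _ act_closed[OF gG rR], of h] hr by simp
    then show False using P.I_prime[OF hR(2) rR] or \<open>h \<in> P\<close> r(2) by blast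
  qed
  define u where "u k = (\<phi> g ^^ k) r" for k
  have u: "u k \<in> carrier R" for k by (induction k) (auto simp: u_def rR gG act_closed)
  have uS: "u (Suc k) = \<phi> g (u k)" for k by (simp add: u_def)
  have step: "h \<otimes> u (Suc k) \<ominus> w \<otimes> u k \<in> P" for k
  proof -
    define h' where "h' k = (\<phi> g ^^ k) h" for k
    define w' where "w' k = (\<phi> g ^^ k) w" for k
    have h': "h' k \<in> carrier R" "h' k \<ominus> h \<in> P" and w': "w' k \<in> carrier R" "w' k \<ominus> w \<in> P" for k
      using trivial_mod_funpow[OF g hw(1), of k] trivial_mod_funpow[OF g hw(2), of k] invariants_closed
      by (auto simp: h'_def w'_def)
    have eq: "h' k \<otimes> u (Suc k) = w' k \<otimes> u k"
    proof (induction k)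
      case 0
      show ?case using hr by (simp add: h'_def w'_def u_def)
    next
      case (Suc k)
      have "h' (Suc k) \<otimes> u (Suc (Suc k)) = \<phi> g (h' k \<otimes> u (Suc k))"
        using act_ring_mult[OF gG h'(1)[of k] u[of "Suc k"]] by (simp add: h'_def uS)
      also have "\<dots> = w' (Suc k) \<otimes> u (Suc k)"
        unfolding Suc using act_ring_mult[OF gG w'(1)[of k] u[of k]] by (simp add: w'_def uS)
      finally show ?case .
    qed
    have "h \<otimes> u (Suc k) \<ominus> h' k \<otimes> u (Suc k) \<in> P"
      by (rule P.minus_mem_mult)
        (use hR h' u P.minus_mem_sym[OF h'(1) hR(1) h'(2)] P.minus_mem_refl[OF u] in auto)
    moreover have "h' k \<otimes> u (Suc k) \<ominus> w \<otimes> u k \<in> P"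
      unfolding eq by (rule P.minus_mem_mult) (use hR w' u P.minus_mem_refl[OF u] in auto)
    ultimately show ?thesis
      using P.minus_mem_trans[of "h \<otimes> u (Suc k)" "h' k \<otimes> u (Suc k)" "w \<otimes> u k"] hR h'(1) u by simp
  qed
  have pow: "h [^] k \<otimes> u k \<ominus> w [^] k \<otimes> r \<in> P" for k
  proof (induction k)
    case 0
    show ?case using rR P.minus_mem_refl[OF rR] by (simp add: u_def)
  next
    case (Suc k)
    have hk: "h [^] k \<in> carrier R" "w [^] k \<in> carrier R" using hR by auto
    have "h [^] k \<otimes> (h \<otimes> u (Suc k)) \<ominus> h [^] k \<otimes> (w \<otimes> u k) \<in> P"
      by (rule P.minus_mem_mult) (use hk hR u step P.minus_mem_refl[OF hk(1)] in auto)
    moreover have "w \<otimes> (h [^] k \<otimes> u k) \<ominus> w \<otimes> (w [^] k \<otimes> r) \<in> P"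
      by (rule P.minus_mem_mult) (use hk hR u rR Suc P.minus_mem_refl[OF hR(2)] in auto)
    moreover have "w \<otimes> (h [^] k \<otimes> u k) = h [^] k \<otimes> (w \<otimes> u k)"
      using hk hR u by (simp add: R.m_ac)
    moreover have "h [^] Suc k \<otimes> u (Suc k) = h [^] k \<otimes> (h \<otimes> u (Suc k))"
      "w [^] Suc k \<otimes> r = w \<otimes> (w [^] k \<otimes> r)"
      using hk hR u rR by (simp_all add: R.m_ac)
    ultimately show ?case
      using P.minus_mem_trans[of "h [^] Suc k \<otimes> u (Suc k)" "h [^] k \<otimes> (w \<otimes> u k)"
          "w [^] Suc k \<otimes> r"] hk hR u rR by simp
  qed
  \<comment> \<open>up to powers of \<open>h\<close>, a polynomial in \<open>g\<close> multiplies \<open>r\<close> modulo \<open>P\<close> by its value at \<open>w / h\<close>\<close>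
  have lin: "h [^] length cs \<otimes> lincomb R cs u \<ominus> (h \<otimes> homogeneous_eval R cs w h) \<otimes> r \<in> P"
    if "set cs \<subseteq> carrier K" for cs
    using that
  proof (induction cs)
    case Nil
    show ?case using rR hR P.minus_mem_refl[of "\<zero>"] by simp
  next
    case (Cons c cs)
    define l where "l = length cs"
    define L where "L = lincomb R cs u"
    define H where "H = homogeneous_eval R cs w h"
    have c: "c \<in> carrier K" "set cs \<subseteq> carrier K" using Cons.prems by auto
    have L: "L \<in> carrier R" and H: "H \<in> carrier R"
      using R.lincomb_closed[OF c(2), of u] R.homogeneous_eval_closed[OF c(2)] u hR by (auto simp: L_def H_def)
    have hk: "h [^] l \<in> carrier R" "w [^] l \<in> carrier R" using hR by auto
    have IH: "h [^] l \<otimes> L \<ominus> (h \<otimes> H) \<otimes> r \<in> P"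
      using Cons.IH[OF c(2)] by (simp add: l_def L_def H_def)
    define k where "k = c \<odot> h"
    have k: "k \<in> carrier R" using c hR by (simp add: k_def)
    have "k \<otimes> (h [^] l \<otimes> u l) \<ominus> k \<otimes> (w [^] l \<otimes> r) \<in> P"
      by (rule P.minus_mem_mult) (use k hk u rR pow P.minus_mem_refl[OF k] in auto)
    moreover have "h \<otimes> (h [^] l \<otimes> L) \<ominus> h \<otimes> ((h \<otimes> H) \<otimes> r) \<in> P"
      by (rule P.minus_mem_mult) (use hR hk L H rR IH P.minus_mem_refl[OF hR(1)] in auto)
    ultimately have "(k \<otimes> (h [^] l \<otimes> u l) \<oplus> h \<otimes> (h [^] l \<otimes> L)) \<ominus>
        (k \<otimes> (w [^] l \<otimes> r) \<oplus> h \<otimes> ((h \<otimes> H) \<otimes> r)) \<in> P"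
      using k hk hR u rR L H by (intro P.minus_mem_add) auto
    moreover have "k \<otimes> (h [^] l \<otimes> u l) \<oplus> h \<otimes> (h [^] l \<otimes> L)
        = h [^] Suc l \<otimes> (c \<odot> u l \<oplus> L)"
      using hk hR u L c by (simp add: k_def R.r_distr R.smult_assoc2 R.smult_assoc3 R.m_ac)
    moreover have "k \<otimes> (w [^] l \<otimes> r) \<oplus> h \<otimes> ((h \<otimes> H) \<otimes> r)
        = (h \<otimes> (c \<odot> w [^] l \<oplus> h \<otimes> H)) \<otimes> r"
      using hk hR rR H c by (simp add: k_def R.r_distr R.l_distr R.smult_assoc2 R.smult_assoc3 R.m_ac)
    ultimately show ?case by (simp add: l_def L_def H_def)
  qed
  obtain cs where cs: "set cs \<subseteq> carrier K" "cs \<noteq> []" "last cs \<noteq> \<zero>\<^bsub>K\<^esub>" "lincomb R cs u = \<zero>"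
    using ex_orbit_dependence[OF gG rR] unfolding u_def by blast
  define H where "H = homogeneous_eval R cs w h"
  have H: "H \<in> carrier R" using R.homogeneous_eval_closed[OF cs(1)] hR by (simp add: H_def)
  have "\<zero> \<ominus> (h \<otimes> H) \<otimes> r \<in> P" using lin[OF cs(1)] cs(4) hR by (simp add: H_def)
  then have "(h \<otimes> H) \<otimes> r \<in> P"
    using P.mem_iff_of_minus_mem[of "\<zero>" "(h \<otimes> H) \<otimes> r"] hR H rR P.zero_closed by simp
  then have HP: "H \<in> P" using P.I_prime[of "h \<otimes> H" r] P.I_prime[of h H] hR H rR hP r(2) by auto
  have ac: "algebraically_closed K" by unfold_locales
  have "\<not> set cs \<subseteq> {\<zero>\<^bsub>K\<^esub>}" using cs(2,3) last_in_set by blast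
  then obtain l where l: "l \<in> carrier K" "w \<ominus> l \<odot> h \<in> P"
    using R.homogeneous_root[OF ac P hR(2), of h cs] hR hP cs(1) HP unfolding H_def by auto
  have "l \<noteq> \<zero>\<^bsub>K\<^esub>"
  proof
    assume "l = \<zero>\<^bsub>K\<^esub>"
    then have wP: "w \<in> P" using l(2) hR by (simp add: R.M.minus_eq)
    obtain ds d where ds: "cs = ds @ [d]" using cs(2) by (metis append_butlast_last_id)
    have d: "d \<in> carrier K - {\<zero>\<^bsub>K\<^esub>}" "set ds \<subseteq> carrier K" using cs ds by auto
    define D where "D = homogeneous_eval R ds w h"
    have D: "D \<in> carrier R" using R.homogeneous_eval_closed[OF d(2)] hR by (simp add: D_def)
    have "H = w \<otimes> D \<oplus> d \<odot> h [^] length ds"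
      unfolding H_def ds D_def using R.homogeneous_eval_snoc[OF hR(2,1) d(2)] d(1) by simp
    then have "H \<ominus> d \<odot> h [^] length ds = w \<otimes> D"
      using hR D d by (simp add: R.M.minus_eq R.M.a_assoc R.M.r_neg)
    then have "d \<odot> h [^] length ds \<in> P"
      using P.mem_iff_of_minus_mem[of H "d \<odot> h [^] length ds"] HP H d hR P.I_r_closed[OF wP D] by simp
    then have "h [^] length ds \<in> P"
      using R.ideal_smult_cancel[OF field_axioms P.ideal_axioms d(1)] hR by simp
    then show False using P.pow_mem_imp_mem[OF hR(1)] hP by blast
  qed
  moreover have "\<phi> g r \<ominus> l \<odot> r \<in> P"
  proof -
    have "h \<otimes> (\<phi> g r \<ominus> l \<odot> r) = (w \<ominus> l \<odot> h) \<otimes> r"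
      using hR rR act_closed[OF gG rR] l(1) hr
      by (simp add: R.M.minus_eq R.r_distr R.l_distr R.r_minus R.l_minus R.smult_assoc2 R.smult_assoc3)
    then have "h \<otimes> (\<phi> g r \<ominus> l \<odot> r) \<in> P" using P.I_r_closed[OF l(2) rR] by simp
    then show ?thesis
      using P.I_prime[of h "\<phi> g r \<ominus> l \<odot> r"] hR hP act_closed[OF gG rR] rR l(1) by simp
  qed
  ultimately show ?thesis using l(1) by blast
qed

text \<open>The eigenvalue modulo \<open>P\<close> depends on the weight only: vectors of the same weight are proportional
  with factors on which \<open>g\<close> acts trivially modulo \<open>P\<close>.\<close>

lemma eigenvalue_mod_unique:
  assumes g: "trivial_mod g"
    and r: "r \<in> weight_space a" "r \<notin> P" "c \<in> carrier K" "\<phi> g r \<ominus> c \<odot> r \<in> P"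
    and s: "s \<in> weight_space a" "s \<notin> P" "d \<in> carrier K" "\<phi> g s \<ominus> d \<odot> s \<in> P"
  shows "c = d"
proof (rule ccontr)
  assume "c \<noteq> d"
  have gG: "g \<in> carrier G" using g by (simp add: trivial_mod_def)
  have rR: "r \<in> carrier R" "s \<in> carrier R" using r s by (auto simp: weight_space_def)
  have gr: "\<phi> g r \<in> carrier R" "\<phi> g s \<in> carrier R" using act_closed[OF gG] rR by auto
  have "r \<noteq> \<zero>" "s \<noteq> \<zero>" using r(2) s(2) P.zero_closed by auto
  then obtain x y where xy: "x \<in> invariants" "y \<in> invariants" "x \<otimes> s = y \<otimes> r" "x \<notin> P \<or> y \<notin> P"
    using weight_spaces_locally_proportional[OF r(1) _ s(1)] by blast
  have R: "x \<in> carrier R" "y \<in> carrier R" using xy invariants_closed by auto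
  have xP: "x \<notin> P"
  proof
    assume "x \<in> P"
    then have "y \<otimes> r \<in> P" using P.I_r_closed[OF _ rR(2), of x] xy(3) by simp
    then show False using P.I_prime[OF R(2) rR(1)] xy(4) \<open>x \<in> P\<close> r(2) by blast
  qed
  have gx: "\<phi> g x \<in> carrier R" "\<phi> g y \<in> carrier R" "\<phi> g x \<ominus> x \<in> P" "\<phi> g y \<ominus> y \<in> P"
    using g xy act_closed[OF gG] R by (auto simp: trivial_mod_def)
  have "\<phi> g x \<otimes> \<phi> g s = \<phi> g y \<otimes> \<phi> g r"
    using act_ring_mult[OF gG R(1) rR(2)] act_ring_mult[OF gG R(2) rR(1)] xy(3) by simp
  moreover have 1: "\<phi> g x \<otimes> \<phi> g s \<ominus> x \<otimes> (d \<odot> s) \<in> P"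
    by (rule P.minus_mem_mult) (use gx R gr rR s in auto)
  moreover have 2: "\<phi> g y \<otimes> \<phi> g r \<ominus> y \<otimes> (c \<odot> r) \<in> P"
    by (rule P.minus_mem_mult) (use gx R gr rR r in auto)
  ultimately have "x \<otimes> (d \<odot> s) \<ominus> y \<otimes> (c \<odot> r) \<in> P"
    using P.minus_mem_trans[of "x \<otimes> (d \<odot> s)" "\<phi> g x \<otimes> \<phi> g s" "y \<otimes> (c \<odot> r)"]
      P.minus_mem_sym[of "\<phi> g x \<otimes> \<phi> g s" "x \<otimes> (d \<odot> s)"] R rR gx gr r(3) s(3) by simp
  moreover have "y \<otimes> (c \<odot> r) = c \<odot> (x \<otimes> s)"
    unfolding xy(3) using R rR r(3) by (simp add: R.smult_assoc3)
  moreover have "x \<otimes> (d \<odot> s) = d \<odot> (x \<otimes> s)" using R rR s(3) by (simp add: R.smult_assoc3)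
  ultimately have "(d \<ominus>\<^bsub>K\<^esub> c) \<odot> (x \<otimes> s) \<in> P"
    using R rR r(3) s(3) by (simp add: minus_eq R.M.minus_eq R.smult_l_distr R.smult_l_minus)
  moreover have "d \<ominus>\<^bsub>K\<^esub> c \<in> carrier K - {\<zero>\<^bsub>K\<^esub>}" using \<open>c \<noteq> d\<close> r(3) s(3) r_right_minus_eq[of d c] by auto
  ultimately have "x \<otimes> s \<in> P" using R.ideal_smult_cancel[OF field_axioms P.ideal_axioms] R rR by blast
  then show False using P.I_prime[OF R(1) rR(2)] xP s(2) by blast
qed

text \<open>The eigenvalues of \<open>g\<close> modulo \<open>P\<close> are multiplicative in the weight, because \<open>P\<close> is prime. So they
  extend to a homomorphism on all exponents, which is evaluation at some \<open>t \<in> T\<close>. Then \<open>g\<close> times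
  the inverse of \<open>t\<close> fixes modulo \<open>P\<close> every weight vector outside \<open>P\<close>. A weight vector in \<open>P\<close>
  is mapped into \<open>P\<close>: otherwise its image would be an eigenvector of the inverse of \<open>g\<close> modulo \<open>P\<close>,
  so that the vector itself would lie outside \<open>P\<close>. The weight vectors span \<open>R\<close>.\<close>

theorem ex_torus_element_correcting:
  assumes g: "trivial_mod g"
  shows "\<exists>t\<in>T. \<forall>r\<in>carrier R. \<phi> (g \<otimes>\<^bsub>G\<^esub> t) r \<ominus> r \<in> P"
proof -
  have gG: "g \<in> carrier G" using g by (simp add: trivial_mod_def)
  interpret U: comm_group "mult_of K" by (rule comm_group_mult_of)
  define \<Lambda>\<^sub>0 where "\<Lambda>\<^sub>0 = {(a, c). c \<in> carrier K - {\<zero>\<^bsub>K\<^esub>} \<and>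
    (\<exists>r\<in>weight_space a. r \<notin> P \<and> \<phi> g r \<ominus> c \<odot> r \<in> P)}"
  have mult: "(\<lambda>i. a i + b i, c \<otimes>\<^bsub>K\<^esub> d) \<in> \<Lambda>\<^sub>0" if ac: "(a, c) \<in> \<Lambda>\<^sub>0" and bd: "(b, d) \<in> \<Lambda>\<^sub>0" for a b c d
  proof -
    obtain r where r: "r \<in> weight_space a" "r \<notin> P" "\<phi> g r \<ominus> c \<odot> r \<in> P" and c: "c \<in> carrier K - {\<zero>\<^bsub>K\<^esub>}"
      using ac by (auto simp: \<Lambda>\<^sub>0_def)
    obtain s where s: "s \<in> weight_space b" "s \<notin> P" "\<phi> g s \<ominus> d \<odot> s \<in> P" and d: "d \<in> carrier K - {\<zero>\<^bsub>K\<^esub>}"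
      using bd by (auto simp: \<Lambda>\<^sub>0_def)
    have R: "r \<in> carrier R" "s \<in> carrier R" using r s by (auto simp: weight_space_def)
    have "\<phi> t (r \<otimes> s) = char (\<lambda>i. a i + b i) t \<odot> (r \<otimes> s)" if t: "t \<in> T" for t
    proof -
      have "\<phi> t (r \<otimes> s) = (char a t \<odot> r) \<otimes> (char b t \<odot> s)"
        using act_ring_mult[OF T_carrier[OF t] R] r(1) s(1) t by (simp add: weight_space_def)
      then show ?thesis using R char_closed[OF t] by (simp add: char_add[OF t] R.smult_assoc1[symmetric] R.smult_assoc2 R.smult_assoc3 m_comm)
    qed
    then have "r \<otimes> s \<in> weight_space (\<lambda>i. a i + b i)" using R by (simp add: weight_space_def)
    moreover have "r \<otimes> s \<notin> P" using P.I_prime[OF R] r(2) s(2) by blast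
    moreover have "\<phi> g (r \<otimes> s) \<ominus> (c \<otimes>\<^bsub>K\<^esub> d) \<odot> (r \<otimes> s) \<in> P"
    proof -
      have "\<phi> g r \<otimes> \<phi> g s \<ominus> (c \<odot> r) \<otimes> (d \<odot> s) \<in> P"
        by (rule P.minus_mem_mult) (use R c d r s act_closed[OF gG] in auto)
      then show ?thesis
        using R c d by (simp add: act_ring_mult[OF gG] R.smult_assoc1[symmetric] R.smult_assoc2 R.smult_assoc3 m_comm)
    qed
    moreover have "c \<otimes>\<^bsub>K\<^esub> d \<in> carrier K - {\<zero>\<^bsub>K\<^esub>}" using c d integral by auto
    ultimately show ?thesis by (auto simp: \<Lambda>\<^sub>0_def)
  qed
  have unique: "c = d" if ac: "(a, c) \<in> \<Lambda>\<^sub>0" and bd: "(b, d) \<in> \<Lambda>\<^sub>0" and eq: "\<And>i. i < n \<Longrightarrow> a i = b i" for a b c d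
  proof -
    have "char a = char b" unfolding char_def by (intro ext monomial_cong) (auto simp: eq)
    then have "weight_space a = weight_space b" by (simp add: weight_space_def)
    then show ?thesis using ac bd eigenvalue_mod_unique[OF g] unfolding \<Lambda>\<^sub>0_def by blast
  qed
  have unit: "(\<lambda>_. 0, \<one>\<^bsub>K\<^esub>) \<in> \<Lambda>\<^sub>0"
  proof -
    have "\<one> \<in> invariants" using subringE(3)[OF invariants_subring] .
    moreover have "\<one> \<notin> P" using P.one_imp_carrier P.I_notcarr by blast
    moreover have "\<phi> g \<one> \<ominus> \<one>\<^bsub>K\<^esub> \<odot> \<one> \<in> P"
      using act_ring_one[OF gG] P.minus_mem_refl[of "\<one>"] by simp
    ultimately show ?thesis unfolding \<Lambda>\<^sub>0_def invariants_eq_weight_space by auto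
  qed
  \<comment> \<open>the graph on the group generated by the weights that occur outside \<open>P\<close>\<close>
  define \<Lambda> where "\<Lambda> = {(\<lambda>i. a i - b i, c \<otimes>\<^bsub>K\<^esub> inv\<^bsub>mult_of K\<^esub> d) | a b c d. (a, c) \<in> \<Lambda>\<^sub>0 \<and> (b, d) \<in> \<Lambda>\<^sub>0}"
  have quot: "(\<lambda>i. a i - b i, c \<otimes>\<^bsub>K\<^esub> inv\<^bsub>mult_of K\<^esub> d) \<in> \<Lambda>" if "(a, c) \<in> \<Lambda>\<^sub>0" "(b, d) \<in> \<Lambda>\<^sub>0" for a b c d
    unfolding \<Lambda>_def using that by blast
  have U: "c \<in> carrier (mult_of K)" if "(a, c) \<in> \<Lambda>\<^sub>0" for a c using that by (simp add: \<Lambda>\<^sub>0_def)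
  have "\<exists>x. (\<forall>i<n. x i \<in> carrier K - {\<zero>\<^bsub>K\<^esub>}) \<and> (\<forall>(a, c)\<in>\<Lambda>. monomial K n a x = c)"
  proof (rule ex_point_with_monomial_values)
    show "c \<in> carrier K - {\<zero>\<^bsub>K\<^esub>}" if ac: "(a, c) \<in> \<Lambda>" for a c
    proof -
      obtain d e where "c = d \<otimes>\<^bsub>K\<^esub> inv\<^bsub>mult_of K\<^esub> e" "d \<in> carrier (mult_of K)" "e \<in> carrier (mult_of K)"
        using ac U unfolding \<Lambda>_def by blast
      then show ?thesis using mult_of.m_closed[of d "inv\<^bsub>mult_of K\<^esub> e"] U.inv_closed[of e] by simp
    qed
    show "(\<lambda>i. a i - b i, c \<otimes>\<^bsub>K\<^esub> inv\<^bsub>mult_of K\<^esub> d) \<in> \<Lambda>" if ac: "(a, c) \<in> \<Lambda>" and bd: "(b, d) \<in> \<Lambda>" for a b c d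
    proof -
      obtain a1 a2 c1 c2 where 1: "a = (\<lambda>i. a1 i - a2 i)" "c = c1 \<otimes>\<^bsub>K\<^esub> inv\<^bsub>mult_of K\<^esub> c2" "(a1, c1) \<in> \<Lambda>\<^sub>0" "(a2, c2) \<in> \<Lambda>\<^sub>0"
        using ac unfolding \<Lambda>_def by blast
      obtain b1 b2 d1 d2 where 2: "b = (\<lambda>i. b1 i - b2 i)" "d = d1 \<otimes>\<^bsub>K\<^esub> inv\<^bsub>mult_of K\<^esub> d2" "(b1, d1) \<in> \<Lambda>\<^sub>0" "(b2, d2) \<in> \<Lambda>\<^sub>0"
        using bd unfolding \<Lambda>_def by blast
      note c1 = U[OF 1(3)] and c2 = U[OF 1(4)] and d1 = U[OF 2(3)] and d2 = U[OF 2(4)]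
      have i: "inv\<^bsub>mult_of K\<^esub> c2 \<in> carrier (mult_of K)" "inv\<^bsub>mult_of K\<^esub> d1 \<in> carrier (mult_of K)"
        "inv\<^bsub>mult_of K\<^esub> d2 \<in> carrier (mult_of K)" using U.inv_closed c2 d1 d2 by auto
      have "inv\<^bsub>mult_of K\<^esub> (d1 \<otimes>\<^bsub>mult_of K\<^esub> inv\<^bsub>mult_of K\<^esub> d2) = inv\<^bsub>mult_of K\<^esub> d1 \<otimes>\<^bsub>mult_of K\<^esub> d2"
        using U.inv_mult[OF d1 i(3)] U.inv_inv[OF d2] by simp
      moreover have "inv\<^bsub>mult_of K\<^esub> (c2 \<otimes>\<^bsub>mult_of K\<^esub> d1) = inv\<^bsub>mult_of K\<^esub> c2 \<otimes>\<^bsub>mult_of K\<^esub> inv\<^bsub>mult_of K\<^esub> d1"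
        using U.inv_mult[OF c2 d1] .
      ultimately have "c \<otimes>\<^bsub>K\<^esub> inv\<^bsub>mult_of K\<^esub> d = (c1 \<otimes>\<^bsub>K\<^esub> d2) \<otimes>\<^bsub>K\<^esub> inv\<^bsub>mult_of K\<^esub> (c2 \<otimes>\<^bsub>K\<^esub> d1)"
        unfolding 1 2 using c1 c2 d1 d2 i by (simp add: m_ac)
      moreover have "(\<lambda>i. a i - b i) = (\<lambda>i. (a1 i + b2 i) - (a2 i + b1 i))" unfolding 1 2 by auto
      ultimately show ?thesis using quot[OF mult[OF 1(3) 2(4)] mult[OF 1(4) 2(3)]] by (simp only:)
    qed
    show "c = \<one>\<^bsub>K\<^esub>" if ac: "(a, c) \<in> \<Lambda>" and zero: "\<And>i. i < n \<Longrightarrow> a i = 0" for a c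
    proof -
      obtain a1 a2 c1 c2 where 1: "a = (\<lambda>i. a1 i - a2 i)" "c = c1 \<otimes>\<^bsub>K\<^esub> inv\<^bsub>mult_of K\<^esub> c2" "(a1, c1) \<in> \<Lambda>\<^sub>0" "(a2, c2) \<in> \<Lambda>\<^sub>0"
        using ac unfolding \<Lambda>_def by blast
      have "c1 = c2" using unique[OF 1(3,4)] zero 1(1) by simp
      then show ?thesis using 1(2) U.r_inv[OF U[OF 1(4)]] by simp
    qed
  qed
  then obtain x where point: "(\<forall>i<n. x i \<in> carrier K - {\<zero>\<^bsub>K\<^esub>}) \<and> (\<forall>(a, c)\<in>\<Lambda>. monomial K n a x = c)"
    by (rule exE)
  have x: "x i \<in> carrier K - {\<zero>\<^bsub>K\<^esub>}" if "i < n" for i using point that by simp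
  have mon: "monomial K n a x = c" if "(a, c) \<in> \<Lambda>" for a c
    using bspec[OF conjunct2[OF point] that] by simp
  have "restrict x {..<n} \<in> carrier (Gm_power K n)" using x by (auto simp: Gm_power_carrier)
  then obtain t where t: "t \<in> T" "\<psi> t = restrict x {..<n}" using bij by (metis bij_betw_def imageE)
  have eigen: "char a t = c" if ac: "(a, c) \<in> \<Lambda>\<^sub>0" for a c
  proof -
    have c: "c \<in> carrier K" using ac by (simp add: \<Lambda>\<^sub>0_def)
    have "inv\<^bsub>mult_of K\<^esub> \<one>\<^bsub>K\<^esub> = \<one>\<^bsub>K\<^esub>" using U.inv_equality[of "\<one>\<^bsub>K\<^esub>" "\<one>\<^bsub>K\<^esub>"] by simp
    then have "(a, c) \<in> \<Lambda>" using quot[OF ac unit] c by simp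
    moreover have "char a t = monomial K n a x" unfolding char_def t(2) by (rule monomial_cong) auto
    ultimately show ?thesis using mon by simp
  qed
  define t' where "t' = inv\<^bsub>G\<^esub> t"
  have t': "t' \<in> T" unfolding t'_def using subgroup.m_inv_closed[OF T t(1)] .
  have tG: "t \<in> carrier G" "t' \<in> carrier G" using T_carrier t(1) t' by auto
  have gtG: "g \<otimes>\<^bsub>G\<^esub> t' \<in> carrier G" using gG tG by simp
  define H where "H = {r \<in> carrier R. \<phi> (g \<otimes>\<^bsub>G\<^esub> t') r \<ominus> r \<in> P}"
  have H: "additive_subgroup H R"
  proof (unfold additive_subgroup_def, rule R.M.add.subgroupI)
    have "\<zero> \<in> H" using act_zero[OF gtG] P.minus_mem_refl[of "\<zero>"] by (simp add: H_def)
    then show "H \<noteq> {}" by blast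
    show "H \<subseteq> carrier R" by (auto simp: H_def)
    show "a \<oplus> b \<in> H" if "a \<in> H" "b \<in> H" for a b
      using that P.minus_mem_add[of "\<phi> (g \<otimes>\<^bsub>G\<^esub> t') a" a "\<phi> (g \<otimes>\<^bsub>G\<^esub> t') b" b] act_closed[OF gtG]
      by (simp add: H_def act_add[OF gtG])
    show "\<ominus> a \<in> H" if a: "a \<in> H" for a
    proof -
      have aR: "a \<in> carrier R" "\<phi> (g \<otimes>\<^bsub>G\<^esub> t') a \<in> carrier R" using a act_closed[OF gtG] by (auto simp: H_def)
      have "\<ominus> \<phi> (g \<otimes>\<^bsub>G\<^esub> t') a \<ominus> \<ominus> a = a \<ominus> \<phi> (g \<otimes>\<^bsub>G\<^esub> t') a"
        using aR by (simp add: R.M.minus_eq R.M.a_comm)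
      then show ?thesis
        using aR a P.minus_mem_sym[OF aR(2,1)] by (simp add: H_def act_uminus[OF gtG])
    qed
  qed
  have "weight_space a \<subseteq> H" for a
  proof
    fix r assume r: "r \<in> weight_space a"
    have rR: "r \<in> carrier R" using r by (simp add: weight_space_def)
    have gr: "\<phi> g r \<in> carrier R" using act_closed[OF gG rR] .
    define k where "k = char a t'"
    have k: "k \<in> carrier K" using char_closed[OF t'] by (simp add: k_def)
    have kt: "k \<otimes>\<^bsub>K\<^esub> char a t = \<one>\<^bsub>K\<^esub>"
      using char_mult[OF t' t(1), of a] tG by (simp add: k_def t'_def char_one)
    have act: "\<phi> (g \<otimes>\<^bsub>G\<^esub> t') r = k \<odot> \<phi> g r"
      using act_mult[OF gG tG(2) rR] r t' scalar_linear[OF gG k rR] by (simp add: weight_space_def k_def)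
    have "\<phi> (g \<otimes>\<^bsub>G\<^esub> t') r \<ominus> r \<in> P"
    proof (cases "r \<in> P")
      case False
      obtain l where l: "l \<in> carrier K - {\<zero>\<^bsub>K\<^esub>}" "\<phi> g r \<ominus> l \<odot> r \<in> P"
        using ex_eigenvalue_mod[OF g r False] by blast
      then have "(a, l) \<in> \<Lambda>\<^sub>0" using r False by (auto simp: \<Lambda>\<^sub>0_def)
      then have kl: "k \<otimes>\<^bsub>K\<^esub> l = \<one>\<^bsub>K\<^esub>" using kt eigen by simp
      have "k \<odot> (\<phi> g r \<ominus> l \<odot> r) = k \<odot> \<phi> g r \<ominus> (k \<otimes>\<^bsub>K\<^esub> l) \<odot> r"
        using k l(1) gr rR by (simp add: R.M.minus_eq R.smult_r_distr R.smult_r_minus R.smult_assoc1)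
      also have "\<dots> = \<phi> (g \<otimes>\<^bsub>G\<^esub> t') r \<ominus> r" using kl act rR by simp
      finally show ?thesis using R.ideal_smult_closed[OF P.ideal_axioms k l(2)] by simp
    next
      case True
      have "\<phi> g r \<in> P"
      proof (rule ccontr)
        assume nP: "\<phi> g r \<notin> P"
        obtain l where l: "l \<in> carrier K - {\<zero>\<^bsub>K\<^esub>}" "\<phi> (inv\<^bsub>G\<^esub> g) (\<phi> g r) \<ominus> l \<odot> \<phi> g r \<in> P"
          using ex_eigenvalue_mod[OF trivial_mod_inv[OF g] act_weight_space[OF gG r] nP] by blast
        then have "r \<ominus> l \<odot> \<phi> g r \<in> P" using act_inv[OF gG rR] by simp
        then have "l \<odot> \<phi> g r \<in> P"
          using P.mem_iff_of_minus_mem[of r "l \<odot> \<phi> g r"] rR gr l(1) True by simp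
        then show False using R.ideal_smult_cancel[OF field_axioms P.ideal_axioms l(1) gr] nP by blast
      qed
      then have "\<phi> (g \<otimes>\<^bsub>G\<^esub> t') r \<in> P" unfolding act using R.ideal_smult_closed[OF P.ideal_axioms k] by blast
      moreover have "\<ominus> r \<in> P" using R.ideal_smult_closed[OF P.ideal_axioms _ True, of "\<ominus>\<^bsub>K\<^esub> \<one>\<^bsub>K\<^esub>"] rR
        by (simp add: R.smult_l_minus)
      ultimately show ?thesis
        unfolding R.M.minus_eq by (rule additive_subgroup.a_closed[OF P.additive_subgroup_axioms])
    qed
    then show "r \<in> H" using rR by (simp add: H_def)
  qed
  then have "\<forall>r\<in>carrier R. \<phi> (g \<otimes>\<^bsub>G\<^esub> t') r \<ominus> r \<in> P"
    using weight_decomposition[OF _ H] unfolding H_def by blast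
  then show ?thesis using t' by blast
qed

end

section \<open>Lifting inertia groups\<close>

context central_torus_action
begin

lemma invariants_minus_eq:
  assumes "x \<in> invariants" "y \<in> invariants"
  shows "x \<ominus>\<^bsub>fixed_ring \<phi> T R\<^esub> y = x \<ominus> y"
  unfolding fixed_ring_eq using R.subring_minus[OF invariants_subring assms] .

lemma minus_invariants:
  assumes "g \<in> carrier G" "x \<in> invariants"
  shows "\<phi> g x \<ominus> x \<in> invariants"
proof -
  note sub = subringE[OF invariants_subring]
  show ?thesis unfolding R.M.minus_eq
    by (intro sub(7) sub(5) act_invariants assms)
qed

lemma inertia_subset_inertia_contract:
  "inertia G \<phi> R P \<subseteq> inertia G \<phi> (fixed_ring \<phi> T R) (P \<inter> carrier (fixed_ring \<phi> T R))"
proof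
  fix g assume g: "g \<in> inertia G \<phi> R P"
  then have gG: "g \<in> carrier G" by (simp add: inertia_def)
  have "\<phi> g x \<ominus>\<^bsub>fixed_ring \<phi> T R\<^esub> x \<in> P \<inter> invariants" if x: "x \<in> invariants" for x
    using invariants_minus_eq[OF act_invariants[OF gG x] x] minus_invariants[OF gG x] g
      invariants_closed[OF x] by (simp add: inertia_def)
  then show "g \<in> inertia G \<phi> (fixed_ring \<phi> T R) (P \<inter> carrier (fixed_ring \<phi> T R))"
    using gG by (simp add: inertia_def fixed_ring_eq)
qed

lemma fixed_by_group_subset: "carrier (fixed_ring \<phi> (carrier G) R) \<subseteq> invariants"
  using T_carrier by (auto simp: fixed_ring_def invariants_def)

text \<open>The inertia group of \<open>P\<close> is contained in that of its contraction to \<open>R\<^sup>T\<close>.\<close>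

theorem refl_over_subset_refl_fixed: "refl_over G \<phi> R T \<subseteq> refl_fixed G \<phi> R T"
  unfolding refl_over_def refl_fixed_def
proof (rule G.mono_generate)
  show "(\<Union>P\<in>Ht1_over G \<phi> R T. inertia G \<phi> R P) \<subseteq>
      (\<Union>P\<in>Ht1_fixed G \<phi> R T. inertia G \<phi> (fixed_ring \<phi> T R) P)"
  proof (rule UN_least)
    fix P assume P: "P \<in> Ht1_over G \<phi> R T"
    let ?p = "P \<inter> carrier (fixed_ring \<phi> T R)"
    have prime: "primeideal P R" using P by (simp add: Ht1_over_def Let_def Spec_def)
    have "primeideal ?p (fixed_ring \<phi> T R)"
      using R.primeideal_contract[OF invariants_subring prime] by (simp add: fixed_ring_eq)
    moreover have "?p \<inter> carrier (fixed_ring \<phi> (carrier G) R) = P \<inter> carrier (fixed_ring \<phi> (carrier G) R)"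
      using fixed_by_group_subset by (auto simp: fixed_ring_eq)
    ultimately have "?p \<in> Ht1_fixed G \<phi> R T"
      using P by (simp add: Ht1_over_def Ht1_fixed_def Let_def Spec_def)
    then show "inertia G \<phi> R P \<subseteq> (\<Union>P\<in>Ht1_fixed G \<phi> R T. inertia G \<phi> (fixed_ring \<phi> T R) P)"
      using inertia_subset_inertia_contract[of P] by blast
  qed
qed

theorem inertia_lifts:
  assumes p: "p \<in> Ht1_fixed G \<phi> R T" and g: "g \<in> inertia G \<phi> (fixed_ring \<phi> T R) p"
  shows "\<exists>P\<in>Ht1_over G \<phi> R T. \<exists>t\<in>T. g \<otimes>\<^bsub>G\<^esub> t \<in> inertia G \<phi> R P"
proof -
  have gG: "g \<in> carrier G" using g by (simp add: inertia_def)
  have p_spec: "p \<in> Spec (R\<lparr>carrier := invariants\<rparr>)"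
    and p_height: "height (R\<lparr>carrier := invariants\<rparr>) p = 1"
    and p_G: "height (fixed_ring \<phi> (carrier G) R) (p \<inter> carrier (fixed_ring \<phi> (carrier G) R)) = 1"
    using p by (simp_all add: Ht1_fixed_def Let_def fixed_ring_eq)
  obtain V where V: "krull_family R V" using krull_domain_imp_krull_family[OF krull] by blast
  obtain P where P: "P \<in> Spec R" "height R P = 1" "P \<inter> invariants = p"
    using krull_family.ex_height_one_prime_over[OF V invariants_subring invariants_saturated p_spec p_height] .
  interpret L: inertia_lifting K G A R \<phi> T n \<psi> P p
  proof (intro inertia_lifting.intro inertia_lifting_axioms.intro)
    show "primeideal P R" using P(1) by (simp add: Spec_def)
  qed (rule central_torus_action_axioms P(3) p_spec p_height)+
  have "P \<inter> carrier (fixed_ring \<phi> (carrier G) R) = p \<inter> carrier (fixed_ring \<phi> (carrier G) R)"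
    using P(3) fixed_by_group_subset by blast
  then have over: "P \<in> Ht1_over G \<phi> R T"
    using P p_height p_G by (simp add: Ht1_over_def Let_def fixed_ring_eq)
  have "\<phi> g x \<ominus> x \<in> P" if x: "x \<in> invariants" for x
    using g x P(3) invariants_minus_eq[OF act_invariants[OF gG x] x]
    by (auto simp: inertia_def fixed_ring_eq)
  then have "L.trivial_mod g" using gG by (simp add: L.trivial_mod_def)
  then obtain t where t: "t \<in> T" "\<forall>r\<in>carrier R. \<phi> (g \<otimes>\<^bsub>G\<^esub> t) r \<ominus> r \<in> P"
    using L.ex_torus_element_correcting by blast
  then have "g \<otimes>\<^bsub>G\<^esub> t \<in> inertia G \<phi> R P" using gG T_carrier by (simp add: inertia_def)
  then show ?thesis using over t(1) by blast
qed

text \<open>A generator \<open>g\<close> of \<open>\<RR>(R\<^sup>T, G)\<close> and its correction \<open>gt\<close>, a generator of \<open>\<RR>(R, G; T)\<close>, have the same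
  restriction to \<open>R\<^sup>T\<close>, because \<open>T\<close> acts trivially there.\<close>

theorem restrict_refl_over_eq:
  "restrict_group \<phi> (refl_over G \<phi> R T) (carrier (fixed_ring \<phi> T R)) =
   restrict_group \<phi> (refl_fixed G \<phi> R T) (carrier (fixed_ring \<phi> T R))"
proof
  show "restrict_group \<phi> (refl_over G \<phi> R T) (carrier (fixed_ring \<phi> T R)) \<subseteq>
      restrict_group \<phi> (refl_fixed G \<phi> R T) (carrier (fixed_ring \<phi> T R))"
    unfolding restrict_group_def using refl_over_subset_refl_fixed by (rule image_mono)
next
  let ?I = "\<Union>P\<in>Ht1_over G \<phi> R T. inertia G \<phi> R P"
  have IG: "?I \<subseteq> carrier G" by (auto simp: inertia_def)
  have over: "refl_over G \<phi> R T \<subseteq> carrier G" unfolding refl_over_def using G.generate_incl[OF IG] .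
  have lift: "\<exists>h\<in>refl_over G \<phi> R T. \<forall>x\<in>invariants. \<phi> h x = \<phi> g x"
    if "g \<in> generate G (\<Union>p\<in>Ht1_fixed G \<phi> R T. inertia G \<phi> (fixed_ring \<phi> T R) p)" for g
    using that
  proof induction
    case one
    have "\<one>\<^bsub>G\<^esub> \<in> refl_over G \<phi> R T" unfolding refl_over_def by (rule generate.one)
    then show ?case by blast
  next
    case (incl g)
    then obtain p where p: "p \<in> Ht1_fixed G \<phi> R T" "g \<in> inertia G \<phi> (fixed_ring \<phi> T R) p" by blast
    then obtain P t where Pt: "P \<in> Ht1_over G \<phi> R T" "t \<in> T" "g \<otimes>\<^bsub>G\<^esub> t \<in> inertia G \<phi> R P"
      using inertia_lifts by blast
    have gG: "g \<in> carrier G" using p(2) by (simp add: inertia_def)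
    have "g \<otimes>\<^bsub>G\<^esub> t \<in> refl_over G \<phi> R T" unfolding refl_over_def by (rule generate.incl) (use Pt in blast)
    moreover have "\<phi> (g \<otimes>\<^bsub>G\<^esub> t) x = \<phi> g x" if "x \<in> invariants" for x
      using act_mult[OF gG T_carrier[OF Pt(2)]] that Pt(2) by (simp add: invariants_def)
    ultimately show ?case by blast
  next
    case (inv g)
    then obtain p where p: "p \<in> Ht1_fixed G \<phi> R T" "g \<in> inertia G \<phi> (fixed_ring \<phi> T R) p" by blast
    then obtain P t where Pt: "P \<in> Ht1_over G \<phi> R T" "t \<in> T" "g \<otimes>\<^bsub>G\<^esub> t \<in> inertia G \<phi> R P"
      using inertia_lifts by blast
    have gG: "g \<in> carrier G" using p(2) by (simp add: inertia_def)
    have tG: "t \<in> carrier G" using T_carrier[OF Pt(2)] .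
    have gtG: "g \<otimes>\<^bsub>G\<^esub> t \<in> carrier G" using gG tG by simp
    have "inv\<^bsub>G\<^esub> (g \<otimes>\<^bsub>G\<^esub> t) \<in> refl_over G \<phi> R T"
      unfolding refl_over_def by (rule generate.inv) (use Pt in blast)
    moreover have "\<phi> (inv\<^bsub>G\<^esub> (g \<otimes>\<^bsub>G\<^esub> t)) x = \<phi> (inv\<^bsub>G\<^esub> g) x" if x: "x \<in> invariants" for x
    proof -
      have y: "\<phi> (inv\<^bsub>G\<^esub> g) x \<in> invariants" using act_invariants x gG by simp
      then have "\<phi> (g \<otimes>\<^bsub>G\<^esub> t) (\<phi> (inv\<^bsub>G\<^esub> g) x) = x"
        using act_mult[OF gG tG] Pt(2) act_inv'[OF gG] invariants_closed[OF x] by (simp add: invariants_def)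
      then show ?thesis using act_inv[OF gtG invariants_closed[OF y]] by simp
    qed
    ultimately show ?case by blast
  next
    case (eng g h)
    then obtain g' h' where g': "g' \<in> refl_over G \<phi> R T" "\<forall>x\<in>invariants. \<phi> g' x = \<phi> g x"
      and h': "h' \<in> refl_over G \<phi> R T" "\<forall>x\<in>invariants. \<phi> h' x = \<phi> h x" by blast
    have fixed: "refl_fixed G \<phi> R T \<subseteq> carrier G"
      unfolding refl_fixed_def by (rule G.generate_incl) (auto simp: inertia_def)
    have gh: "g \<in> carrier G" "h \<in> carrier G" using eng.hyps fixed unfolding refl_fixed_def by blast+
    have "g' \<otimes>\<^bsub>G\<^esub> h' \<in> refl_over G \<phi> R T"
      using g'(1) h'(1) unfolding refl_over_def by (rule generate.eng)
    moreover have "\<phi> (g' \<otimes>\<^bsub>G\<^esub> h') x = \<phi> (g \<otimes>\<^bsub>G\<^esub> h) x" if x: "x \<in> invariants" for x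
      using act_mult[OF subsetD[OF over g'(1)] subsetD[OF over h'(1)] invariants_closed[OF x]]
        act_mult[OF gh invariants_closed[OF x]] g'(2) h'(2) x act_invariants[OF gh(2) x] by simp
    ultimately show ?case by blast
  qed
  show "restrict_group \<phi> (refl_fixed G \<phi> R T) (carrier (fixed_ring \<phi> T R)) \<subseteq>
      restrict_group \<phi> (refl_over G \<phi> R T) (carrier (fixed_ring \<phi> T R))"
  proof
    fix f assume "f \<in> restrict_group \<phi> (refl_fixed G \<phi> R T) (carrier (fixed_ring \<phi> T R))"
    then obtain g where g: "g \<in> refl_fixed G \<phi> R T" "f = restrict (\<phi> g) invariants"
      by (auto simp: restrict_group_def fixed_ring_eq)
    then obtain h where h: "h \<in> refl_over G \<phi> R T" "\<forall>x\<in>invariants. \<phi> h x = \<phi> g x"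
      using lift unfolding refl_fixed_def by blast
    then have "f = restrict (\<phi> h) invariants" unfolding g(2) by (intro restrict_ext) simp
    then show "f \<in> restrict_group \<phi> (refl_over G \<phi> R T) (carrier (fixed_ring \<phi> T R))"
      using h(1) by (auto simp: restrict_group_def fixed_ring_eq)
  qed
qed

end

text \<open>A submonoid of a group that is isomorphic to \<open>(K\<^sup>*)\<^sup>n\<close> is a subgroup: the preimage of the
  inverse coordinates of \<open>t\<close> multiplies \<open>t\<close> to the identity.\<close>

lemma algebraic_torus_imp_coordinates:
  assumes "group G"
    and one: "\<one>\<^bsub>G\<^esub> \<in> T" and mult: "\<forall>s\<in>T. \<forall>t\<in>T. s \<otimes>\<^bsub>G\<^esub> t \<in> T" and sub: "T \<subseteq> carrier G"
    and field: "field K"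
    and torus: "algebraic_torus K (G\<lparr>carrier := T\<rparr>) (restrict_coord A T)"
  obtains n \<psi> where "subgroup T G" "bij_betw \<psi> T (carrier (Gm_power K n))"
    "\<And>s t i. \<lbrakk>s \<in> T; t \<in> T; i < n\<rbrakk> \<Longrightarrow> \<psi> (s \<otimes>\<^bsub>G\<^esub> t) i = \<psi> s i \<otimes>\<^bsub>K\<^esub> \<psi> t i"
    "\<And>f. f \<in> A \<Longrightarrow> \<exists>g\<in>Gm_power_coord K n. \<forall>t\<in>T. f t = g (\<psi> t)"
proof -
  interpret G: group G by fact
  interpret K: field K by fact
  interpret U: comm_group "mult_of K" by (rule K.comm_group_mult_of)
  obtain n \<psi> where iso: "\<psi> \<in> iso (G\<lparr>carrier := T\<rparr>) (Gm_power K n)"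
    and coords: "(\<lambda>f. \<lambda>x\<in>T. f (\<psi> x)) ` Gm_power_coord K n = restrict_coord A T"
    using torus unfolding algebraic_torus_def alg_group_iso_def by auto
  have carr: "carrier (Gm_power K n) = (\<Pi>\<^sub>E i\<in>{..<n}. carrier (mult_of K))"
    by (simp add: Gm_power_def)
  have bij: "bij_betw \<psi> T (carrier (Gm_power K n))" using iso by (simp add: iso_def)
  have hom: "\<psi> (s \<otimes>\<^bsub>G\<^esub> t) = (\<lambda>i\<in>{..<n}. \<psi> s i \<otimes>\<^bsub>K\<^esub> \<psi> t i)" if "s \<in> T" "t \<in> T" for s t
  proof -
    have "\<psi> \<in> hom (G\<lparr>carrier := T\<rparr>) (Gm_power K n)" using iso by (simp add: iso_def)
    then have "\<psi> (s \<otimes>\<^bsub>G\<^esub> t) = \<psi> s \<otimes>\<^bsub>Gm_power K n\<^esub> \<psi> t" using that unfolding hom_def by auto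
    then show ?thesis by (simp add: Gm_power_def product_group_def)
  qed
  have mem: "\<psi> t i \<in> carrier (mult_of K)" if "t \<in> T" "i < n" for t i
    using bij_betwE[OF bij] that unfolding carr by (metis PiE_mem lessThan_iff)
  have inv: "inv\<^bsub>G\<^esub> t \<in> T" if t: "t \<in> T" for t
  proof -
    have "(\<lambda>i\<in>{..<n}. inv\<^bsub>mult_of K\<^esub> (\<psi> t i)) \<in> carrier (Gm_power K n)"
      unfolding carr using U.inv_closed[OF mem[OF t]] by (simp add: PiE_def Pi_def)
    then obtain s where s: "s \<in> T" "\<psi> s = (\<lambda>i\<in>{..<n}. inv\<^bsub>mult_of K\<^esub> (\<psi> t i))"
      using bij by (metis bij_betw_def imageE)
    have one_idem: "\<psi> \<one>\<^bsub>G\<^esub> i = \<one>\<^bsub>K\<^esub>" if i: "i < n" for i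
    proof -
      have "\<psi> \<one>\<^bsub>G\<^esub> i = \<psi> \<one>\<^bsub>G\<^esub> i \<otimes>\<^bsub>mult_of K\<^esub> \<psi> \<one>\<^bsub>G\<^esub> i"
        using fun_cong[OF hom[OF one one], of i] i by simp
      then have "\<psi> \<one>\<^bsub>G\<^esub> i = \<one>\<^bsub>mult_of K\<^esub>"
        using U.l_cancel_one'[OF mem[OF one i] mem[OF one i]] by simp
      then show ?thesis by simp
    qed
    have one_ext: "\<psi> \<one>\<^bsub>G\<^esub> \<in> extensional {..<n}"
      using bij_betwE[OF bij] one unfolding carr by (meson PiE_iff)
    have "\<psi> (s \<otimes>\<^bsub>G\<^esub> t) = \<psi> \<one>\<^bsub>G\<^esub>"
      unfolding hom[OF s(1) t]
    proof (rule extensionalityI[of _ "{..<n}"])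
      show "(\<lambda>i\<in>{..<n}. \<psi> s i \<otimes>\<^bsub>K\<^esub> \<psi> t i) i = \<psi> \<one>\<^bsub>G\<^esub> i" if "i \<in> {..<n}" for i
        using that U.l_inv[OF mem[OF t, of i]] one_idem[of i] by (simp add: s(2))
    qed (use one_ext in auto)
    then have "s \<otimes>\<^bsub>G\<^esub> t = \<one>\<^bsub>G\<^esub>"
      using bij_betw_imp_inj_on[OF bij] mult s(1) t one by (metis inj_onD)
    then have "inv\<^bsub>G\<^esub> t = s" using G.inv_equality s(1) t sub by blast
    then show ?thesis using s(1) by simp
  qed
  have subgroup: "subgroup T G" by (rule G.subgroupI) (use sub one inv mult in auto)
  have "\<exists>g\<in>Gm_power_coord K n. \<forall>t\<in>T. f t = g (\<psi> t)" if f: "f \<in> A" for f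
  proof -
    have "restrict f T \<in> (\<lambda>f. \<lambda>x\<in>T. f (\<psi> x)) ` Gm_power_coord K n"
      unfolding coords restrict_coord_def using f by blast
    then obtain g where g: "g \<in> Gm_power_coord K n" "restrict f T = (\<lambda>x\<in>T. g (\<psi> x))" by blast
    have "f t = g (\<psi> t)" if "t \<in> T" for t using fun_cong[OF g(2), of t] that by simp
    then show ?thesis using g(1) by blast
  qed
  moreover have "\<psi> (s \<otimes>\<^bsub>G\<^esub> t) i = \<psi> s i \<otimes>\<^bsub>K\<^esub> \<psi> t i" if "s \<in> T" "t \<in> T" "i < n" for s t i
    using hom[OF that(1,2)] that(3) by simp
  ultimately show thesis using that[OF subgroup bij] by blast
qed

theorem theorem1p2:
  fixes K :: "('k, 'm) ring_scheme"
    and G :: "('g, 'n) monoid_scheme"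
    and A :: "('g \<Rightarrow> 'k) set"
    and T :: "'g set"
    and R :: "('k, 'r) module"
    and \<phi> :: "'g \<Rightarrow> 'r \<Rightarrow> 'r"
  defines "G0 \<equiv> identity_component K G A"
  assumes "affine_algebraic_group K G A"
    and "reductive K (G\<lparr>carrier := G0\<rparr>) (restrict_coord A G0)"
    and "closed_subgroup K (G\<lparr>carrier := G0\<rparr>) (restrict_coord A G0) T"
    and "connectedin (zariski K (carrier G) A) T"
    and "algebraic_torus K (G\<lparr>carrier := T\<rparr>) (restrict_coord A T)"
    and "krull_domain R"
    and "effective_regular_action K G A R \<phi>"
    and "carrier G = centralizer G T"
    and "carrier (fixed_ring (frac_action \<phi>) T (total_quotient R)) =
         total_quotient_embed R ` carrier (total_quotient (fixed_ring \<phi> T R))"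
  shows "restrict_group \<phi> (refl_over G \<phi> R T) (carrier (fixed_ring \<phi> T R)) =
         restrict_group \<phi> (refl_fixed G \<phi> R T) (carrier (fixed_ring \<phi> T R))"
proof -
  interpret effective_regular_action K G A R \<phi> by fact
  have sub0: "subgroup T (G\<lparr>carrier := G0\<rparr>)" using assms(4) by (simp add: closed_subgroup_def)
  have one: "\<one>\<^bsub>G\<^esub> \<in> T" using subgroup.one_closed[OF sub0] by simp
  have mult: "\<forall>s\<in>T. \<forall>t\<in>T. s \<otimes>\<^bsub>G\<^esub> t \<in> T" using subgroup.m_closed[OF sub0] by simp
  have "topspace (zariski K (carrier G) A) \<subseteq> carrier G"
    by (auto simp: zariski_def topology_generated_by_topspace)
  then have "G0 \<subseteq> carrier G"
    unfolding G0_def identity_component_def using connected_component_of_subset_topspace by fast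
  then have TG: "T \<subseteq> carrier G" using subgroup.subset[OF sub0] by auto
  obtain n \<psi> where coords: "subgroup T G" "bij_betw \<psi> T (carrier (Gm_power K n))"
    "\<And>s t i. \<lbrakk>s \<in> T; t \<in> T; i < n\<rbrakk> \<Longrightarrow> \<psi> (s \<otimes>\<^bsub>G\<^esub> t) i = \<psi> s i \<otimes>\<^bsub>K\<^esub> \<psi> t i"
    "\<And>f. f \<in> A \<Longrightarrow> \<exists>g\<in>Gm_power_coord K n. \<forall>t\<in>T. f t = g (\<psi> t)"
    by (rule algebraic_torus_imp_coordinates[OF G.is_group one mult TG field_axioms assms(6)])
      (rule that)
  interpret central_torus_action K G A R \<phi> T n \<psi>
  proof (intro central_torus_action.intro torus_action.intro torus_action_axioms.intro
      central_torus_action_axioms.intro)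
    show "g \<otimes>\<^bsub>G\<^esub> t = t \<otimes>\<^bsub>G\<^esub> g" if "g \<in> carrier G" "t \<in> T" for g t
    proof -
      have "g \<in> centralizer G T" using that(1) assms(9) by blast
      then show ?thesis using that(2) unfolding centralizer_def by blast
    qed
  qed (fact regular_action_axioms coords assms(7,10))+
  show ?thesis by (rule restrict_refl_over_eq)
qed

end
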